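(* The decision problem Closeness Ratio Improvement is NP-hard, and W[2]-hard with respect to the parameter $k$, even when restricted to instances with target ratio $\tau=1$.
   Context: All graphs are finite, simple, undirected, unweighted and connected. For a graph $G=(V,E)$ and $u,v\in V$, $d_G(u,v)$ is the shortest-path distance, and the closeness centrality of $v$ is $C_G(v)=\sum_{u\in V}d_G(u,v)$. For a set $S$ of vertex pairs not in $E$, $G+S=(V,E\cup S)$. The closeness ratio of $a,b$ in $G$ is $R_G(a,b)=\frac{\min(C_G(a),C_G(b))}{\max(C_G(a),C_G(b))}\le 1$. Closeness Ratio Improvement (decision variant): given a graph $G=(V,E)$, vertices $a,b\in V$, a budget $k\in\mathbb N$ and a target ratio $\tau\in(0,1]$, decide whether there exists a set $T$ of at most $k$ vertex pairs (non-edges of $G$) such that $R_{G+T}(a,b)\ge\tau$. *)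

theory Defs
  imports Complex_Main "HOL-Computational_Algebra.Polynomial"
begin

section \<open>Deterministic multi-tape Turing machines\<close>

datatype move = GoLeft | Stay | GoRight

text \<open>
  Running states are \<open>0, \<dots>, states M - 1\<close> (\<open>0\<close> is initial), and \<open>states M\<close> is the halting state.
  Tape symbols are \<open>0, \<dots>, symbols M - 1\<close>, where \<open>0\<close> is the blank and \<open>1\<close>, \<open>2\<close> are the bits.
  Tapes are infinite in both directions; tape \<open>0\<close> holds the input, tape \<open>1\<close> the output.
\<close>

record tm =
  tapes :: nat
  states :: nat
  symbols :: nat
  delta :: "nat \<Rightarrow> nat list \<Rightarrow> nat \<times> (nat \<times> move) list"

definition tm_wf :: "tm \<Rightarrow> bool" where
  "tm_wf M \<longleftrightarrow> tapes M \<ge> 2 \<and> states M \<ge> 1 \<and> symbols M \<ge> 3 \<and>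
     (\<forall>q < states M. \<forall>ss. length ss = tapes M \<and> (\<forall>s \<in> set ss. s < symbols M) \<longrightarrow>
        fst (delta M q ss) \<le> states M \<and>
        length (snd (delta M q ss)) = tapes M \<and>
        (\<forall>(s, d) \<in> set (snd (delta M q ss)). s < symbols M))"

type_synonym tape = "(int \<Rightarrow> nat) \<times> int"
type_synonym config = "nat \<times> tape list"

fun head_read :: "tape \<Rightarrow> nat" where
  "head_read (c, h) = c h"

fun head_act :: "nat \<times> move \<Rightarrow> tape \<Rightarrow> tape" where
  "head_act (s, d) (c, h) =
     (c(h := s), case d of GoLeft \<Rightarrow> h - 1 | Stay \<Rightarrow> h | GoRight \<Rightarrow> h + 1)"

fun tm_step :: "tm \<Rightarrow> config \<Rightarrow> config" where
  "tm_step M (q, ts) =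
     (if q \<ge> states M then (q, ts)
      else let (q', as) = delta M q (map head_read ts) in (q', map2 head_act as ts))"

definition tape_of :: "bool list \<Rightarrow> int \<Rightarrow> nat" where
  "tape_of w i =
     (if 0 \<le> i \<and> i < int (length w) then (if w ! nat i then 2 else 1) else 0)"

definition tm_init :: "tm \<Rightarrow> bool list \<Rightarrow> config" where
  "tm_init M x = (0, (tape_of x, 0) # replicate (tapes M - 1) (tape_of [], 0))"

definition computes_within :: "tm \<Rightarrow> bool list \<Rightarrow> bool list \<Rightarrow> nat \<Rightarrow> bool" where
  "computes_within M x y t \<longleftrightarrow>
     (let (q, ts) = (tm_step M ^^ t) (tm_init M x)
      in q = states M \<and> fst (ts ! 1) = tape_of y)"

definition polytime :: "(bool list \<Rightarrow> bool list) \<Rightarrow> bool" where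
  "polytime f \<longleftrightarrow> (\<exists>M (p :: nat poly). tm_wf M \<and>
     (\<forall>x. computes_within M x (f x) (poly p (length x))))"

text \<open>Numbers are given in unary here, which does not affect computability.\<close>

definition computable :: "(nat \<Rightarrow> nat) \<Rightarrow> bool" where
  "computable g \<longleftrightarrow> (\<exists>M. tm_wf M \<and>
     (\<forall>n. \<exists>t. computes_within M (replicate n True) (replicate (g n) True) t))"


section \<open>Encodings\<close>

text \<open>A self-delimiting copy of \<open>w\<close>: its length in unary, then \<open>w\<close>.\<close>

definition sd :: "bool list \<Rightarrow> bool list" where
  "sd w = replicate (length w) True @ False # w"

fun bin :: "nat \<Rightarrow> bool list" where
  "bin n = (if n = 0 then [] else odd n # bin (n div 2))"

declare bin.simps [simp del]

lemma sd_append_inject [simp]: "sd v @ x = sd w @ y \<longleftrightarrow> v = w \<and> x = y"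
proof
  have *: "replicate m True @ False # u = replicate n True @ False # u' \<Longrightarrow> m = n \<and> u = u'"
    for m n u u'
  proof (induction m arbitrary: n)
    case 0
    then show ?case by (cases n) auto
  next
    case (Suc m)
    then show ?case by (cases n) auto
  qed
  assume "sd v @ x = sd w @ y"
  then show "v = w \<and> x = y"
    using *[of "length v" "v @ x" "length w" "w @ y"] by (auto simp: sd_def)
qed simp

lemma sd_inject [simp]: "sd v = sd w \<longleftrightarrow> v = w"
  using sd_append_inject[of v "[]" w "[]"] by simp

lemma sd_neq_Nil [simp]: "sd w \<noteq> []" "[] \<noteq> sd w"
  by (simp_all add: sd_def)

lemma concat_sd_inject: "concat (map sd vs) = concat (map sd ws) \<Longrightarrow> vs = ws"
proof (induction vs arbitrary: ws)
  case Nil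
  then show ?case by (cases ws) auto
next
  case (Cons v vs)
  then show ?case by (cases ws) auto
qed

lemma bin_inject: "bin m = bin n \<Longrightarrow> m = n"
proof (induction m arbitrary: n rule: bin.induct)
  case (1 m)
  show ?case
  proof (cases "m = 0 \<or> n = 0")
    case True
    then show ?thesis using "1.prems" by (auto simp: bin.simps[of m] bin.simps[of n] split: if_splits)
  next
    case False
    then have "odd m = odd n" "bin (m div 2) = bin (n div 2)"
      using "1.prems" by (auto simp: bin.simps[of m] bin.simps[of n])
    then have "odd m = odd n" "m div 2 = n div 2"
      using "1.IH" False by auto
    then show ?thesis by presburger
  qed
qed


section \<open>Decision problems, NP-hardness\<close>

text \<open>
  A problem consists of its instances and its yes-instances among them, so that restrictions of a
  problem to special instances are problems, too. Reductions must produce instances.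
\<close>

record 'a problem =
  instances :: "'a set"
  yes_instances :: "'a set"

definition class_P :: "bool list set set" where
  "class_P = {L. polytime (\<lambda>x. [x \<in> L])}"

definition class_NP :: "bool list set set" where
  "class_NP = {L. \<exists>R \<in> class_P. \<exists>p :: nat poly.
     \<forall>x. x \<in> L \<longleftrightarrow> (\<exists>w. length w \<le> poly p (length x) \<and> sd x @ w \<in> R)}"

definition poly_reducible :: "bool list set \<Rightarrow> bool list problem \<Rightarrow> bool" where
  "poly_reducible L Q \<longleftrightarrow> (\<exists>f. polytime f \<and>
     (\<forall>x. f x \<in> instances Q \<and> (x \<in> L \<longleftrightarrow> f x \<in> yes_instances Q)))"

definition NP_hard :: "bool list problem \<Rightarrow> bool" where
  "NP_hard Q \<longleftrightarrow> (\<forall>L \<in> class_NP. poly_reducible L Q)"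


section \<open>Parameterized problems, the W-hierarchy\<close>

text \<open>As usual, the size of \<open>(x, k)\<close> is that of \<open>x\<close> together with \<open>k\<close> in unary.\<close>

fun enc_par :: "bool list \<times> nat \<Rightarrow> bool list" where
  "enc_par (x, k) = replicate k True @ False # x"

definition fpt_reducible :: "(bool list \<times> nat) set \<Rightarrow> (bool list \<times> nat) problem \<Rightarrow> bool" where
  "fpt_reducible A Q \<longleftrightarrow> (\<exists>f M g h c. tm_wf M \<and> computable g \<and> computable h \<and>
     (\<forall>x k.
        computes_within M (enc_par (x, k)) (enc_par (f (x, k)))
          (g k * length (enc_par (x, k)) ^ c) \<and>
        snd (f (x, k)) \<le> h k \<and>
        f (x, k) \<in> instances Q \<and>
        ((x, k) \<in> A \<longleftrightarrow> f (x, k) \<in> yes_instances Q)))"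

text \<open>
  A circuit is a topologically sorted list of its nodes, each with its label and its set of
  in-neighbours; the last node is the output node. Every input node is a variable.
\<close>

datatype label = Input | Not | And | Or

type_synonym circuit = "(label \<times> nat set) list"

definition circuit_wf :: "circuit \<Rightarrow> bool" where
  "circuit_wf C \<longleftrightarrow> C \<noteq> [] \<and> (\<forall>i < length C. case C ! i of (l, S) \<Rightarrow>
     S \<subseteq> {..<i} \<and>
     (case l of Input \<Rightarrow> S = {} | Not \<Rightarrow> card S = 1 | And \<Rightarrow> card S \<ge> 2 | Or \<Rightarrow> card S \<ge> 2))"

text \<open>The intersection with \<open>{..<i}\<close> is redundant for well-formed circuits and only ensures termination.\<close>

function node_val :: "circuit \<Rightarrow> (nat \<Rightarrow> bool) \<Rightarrow> nat \<Rightarrow> bool" where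
  "node_val C v i = (case fst (C ! i) of
       Input \<Rightarrow> v i
     | Not \<Rightarrow> (\<forall>j \<in> snd (C ! i) \<inter> {..<i}. \<not> node_val C v j)
     | And \<Rightarrow> (\<forall>j \<in> snd (C ! i) \<inter> {..<i}. node_val C v j)
     | Or \<Rightarrow> (\<exists>j \<in> snd (C ! i) \<inter> {..<i}. node_val C v j))"
  by pat_completeness auto
termination by (relation "measure (\<lambda>(C, v, i). i)") auto

declare node_val.simps [simp del]

definition input_nodes :: "circuit \<Rightarrow> nat set" where
  "input_nodes C = {i. i < length C \<and> fst (C ! i) = Input}"

definition weighted_sat :: "circuit \<Rightarrow> nat \<Rightarrow> bool" where
  "weighted_sat C k \<longleftrightarrow> (\<exists>v. card {i \<in> input_nodes C. v i} = k \<and> node_val C v (length C - 1))"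

definition input_output_path :: "circuit \<Rightarrow> nat list \<Rightarrow> bool" where
  "input_output_path C p \<longleftrightarrow> p \<noteq> [] \<and> hd p \<in> input_nodes C \<and> last p = length C - 1 \<and>
     (\<forall>j. Suc j < length p \<longrightarrow> p ! Suc j < length C \<and> p ! j \<in> snd (C ! (p ! Suc j)))"

definition depth_at_most :: "circuit \<Rightarrow> nat \<Rightarrow> bool" where
  "depth_at_most C d \<longleftrightarrow> (\<forall>p. input_output_path C p \<longrightarrow> length p - 1 \<le> d)"

definition weft_at_most :: "circuit \<Rightarrow> nat \<Rightarrow> bool" where
  "weft_at_most C t \<longleftrightarrow>
     (\<forall>p. input_output_path C p \<longrightarrow> length (filter (\<lambda>i. card (snd (C ! i)) > 2) p) \<le> t)"

fun enc_label :: "label \<Rightarrow> bool list" where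
  "enc_label Input = [False, False]"
| "enc_label Not = [False, True]"
| "enc_label And = [True, False]"
| "enc_label Or = [True, True]"

definition enc_circuit :: "circuit \<Rightarrow> bool list" where
  "enc_circuit C =
     concat (map (\<lambda>(l, S). sd (enc_label l @ map (\<lambda>j. j \<in> S) [0..<length C])) C)"

lemma enc_circuit_inject:
  assumes "circuit_wf C" "circuit_wf D" "enc_circuit C = enc_circuit D"
  shows "C = D"
proof -
  define r where "r C = (\<lambda>(l, S). enc_label l @ map (\<lambda>j. j \<in> S) [0..<length C])"
    for C :: circuit
  have "concat (map sd (map (r C) C)) = concat (map sd (map (r D) D))"
    using assms(3) by (simp add: enc_circuit_def r_def o_def case_prod_unfold)
  then have eq: "map (r C) C = map (r D) D"
    by (rule concat_sd_inject)
  then have len: "length C = length D"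
    by (metis length_map)
  show ?thesis
  proof (rule nth_equalityI[OF len])
    fix i assume i: "i < length C"
    obtain l S where C: "C ! i = (l, S)" by fastforce
    obtain m T where D: "D ! i = (m, T)" by fastforce
    have sub: "S \<subseteq> {..<length C}" "T \<subseteq> {..<length C}"
      using assms(1,2) i len C D unfolding circuit_wf_def by fastforce+
    have "r C (C ! i) = r D (D ! i)"
      using eq i len by (metis nth_map)
    then have e: "enc_label l @ map (\<lambda>j. j \<in> S) [0..<length C]
        = enc_label m @ map (\<lambda>j. j \<in> T) [0..<length C]"
      by (simp add: r_def C D len)
    then have "l = m" by (cases l; cases m) auto
    moreover from this e have "\<forall>j < length C. j \<in> S \<longleftrightarrow> j \<in> T" by auto
    with sub have "S = T" by blast
    ultimately show "C ! i = D ! i" by (simp add: C D)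
  qed
qed

definition WCS :: "nat \<Rightarrow> nat \<Rightarrow> (bool list \<times> nat) problem" where
  "WCS t d =
     \<lparr>instances = {(enc_circuit C, k) | C k.
        circuit_wf C \<and> weft_at_most C t \<and> depth_at_most C d},
      yes_instances = {(enc_circuit C, k) | C k.
        circuit_wf C \<and> weft_at_most C t \<and> depth_at_most C d \<and> weighted_sat C k}\<rparr>"

definition class_W :: "nat \<Rightarrow> (bool list \<times> nat) set set" where
  "class_W t = {A. \<exists>d \<ge> 1. fpt_reducible A (WCS t d)}"

definition W_hard :: "nat \<Rightarrow> (bool list \<times> nat) problem \<Rightarrow> bool" where
  "W_hard t Q \<longleftrightarrow> (\<forall>A \<in> class_W t. fpt_reducible A Q)"


section \<open>Closeness Ratio Improvement\<close>

definition vertex_pairs :: "'v set \<Rightarrow> 'v set set" where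
  "vertex_pairs V = {e. e \<subseteq> V \<and> card e = 2}"

definition adj :: "'v set set \<Rightarrow> ('v \<times> 'v) set" where
  "adj E = {(u, v). {u, v} \<in> E}"

definition connected_graph :: "'v set \<Rightarrow> 'v set set \<Rightarrow> bool" where
  "connected_graph V E \<longleftrightarrow> finite V \<and> V \<noteq> {} \<and> E \<subseteq> vertex_pairs V \<and>
     (\<forall>u \<in> V. \<forall>v \<in> V. (u, v) \<in> (adj E)\<^sup>*)"

definition graph_dist :: "'v set set \<Rightarrow> 'v \<Rightarrow> 'v \<Rightarrow> nat" where
  "graph_dist E u v = (LEAST m. (u, v) \<in> adj E ^^ m)"

definition closeness :: "'v set \<Rightarrow> 'v set set \<Rightarrow> 'v \<Rightarrow> nat" where
  "closeness V E v = (\<Sum>u \<in> V. graph_dist E u v)"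

definition closeness_ratio :: "'v set \<Rightarrow> 'v set set \<Rightarrow> 'v \<Rightarrow> 'v \<Rightarrow> rat" where
  "closeness_ratio V E a b =
     of_nat (min (closeness V E a) (closeness V E b)) /
     of_nat (max (closeness V E a) (closeness V E b))"

text \<open>
  The vertices are numbered \<open>0, \<dots>, nverts - 1\<close>. The target ratio is rational, as it has to be
  written down as a part of the input.
\<close>

record cri_instance =
  nverts :: nat
  edges :: "nat set set"
  vertex_a :: nat
  vertex_b :: nat
  budget :: nat
  target :: rat

definition cri_valid :: "cri_instance \<Rightarrow> bool" where
  "cri_valid I \<longleftrightarrow> connected_graph {..<nverts I} (edges I) \<and>
     vertex_a I < nverts I \<and> vertex_b I < nverts I \<and> 0 < target I \<and> target I \<le> 1"

definition cri_yes :: "cri_instance \<Rightarrow> bool" where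
  "cri_yes I \<longleftrightarrow> (\<exists>T \<subseteq> vertex_pairs {..<nverts I} - edges I. card T \<le> budget I \<and>
     closeness_ratio {..<nverts I} (edges I \<union> T) (vertex_a I) (vertex_b I) \<ge> target I)"

text \<open>
  The graph is given by its adjacency matrix, numbers in binary, and the target ratio by the
  numerator and denominator of its reduced fraction.
\<close>

definition enc_graph :: "nat \<Rightarrow> nat set set \<Rightarrow> bool list" where
  "enc_graph n E = concat (map (\<lambda>u. map (\<lambda>v. {u, v} \<in> E) [0..<n]) [0..<n])"

definition enc_cri :: "cri_instance \<Rightarrow> bool list" where
  "enc_cri I = concat (map sd
     [enc_graph (nverts I) (edges I), bin (vertex_a I), bin (vertex_b I), bin (budget I),
      bin (nat (fst (quotient_of (target I)))), bin (nat (snd (quotient_of (target I))))])"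

lemma enc_graph_inject:
  assumes "E \<subseteq> vertex_pairs {..<n}" "F \<subseteq> vertex_pairs {..<m}" "enc_graph n E = enc_graph m F"
  shows "n = m \<and> E = F"
proof
  have len: "length (enc_graph n E) = n * n" for n E
    by (simp add: enc_graph_def length_concat o_def sum_list_triv)
  have "n * n = m * m" using assms(3) len by metis
  then show nm: "n = m" by (simp add: power2_eq_square[symmetric])
  have "map (\<lambda>u. map (\<lambda>v. {u, v} \<in> E) [0..<n]) [0..<n]
      = map (\<lambda>u. map (\<lambda>v. {u, v} \<in> F) [0..<n]) [0..<n]"
    using assms(3) unfolding enc_graph_def nm
    by (rule concat_injective) (auto simp: set_zip)
  then have *: "{u, v} \<in> E \<longleftrightarrow> {u, v} \<in> F" if "u < n" "v < n" for u v
    using that by auto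
  have "e \<in> E \<longleftrightarrow> e \<in> F" if "e \<in> vertex_pairs {..<n}" for e
    using that * by (auto simp: vertex_pairs_def card_2_iff)
  then show "E = F" using assms(1,2) nm by blast
qed

lemma enc_cri_inject:
  assumes "cri_valid I" "cri_valid J" "enc_cri I = enc_cri J"
  shows "I = J"
proof -
  have eq: "enc_graph (nverts I) (edges I) = enc_graph (nverts J) (edges J)"
    "vertex_a I = vertex_a J" "vertex_b I = vertex_b J" "budget I = budget J"
    "nat (fst (quotient_of (target I))) = nat (fst (quotient_of (target J)))"
    "nat (snd (quotient_of (target I))) = nat (snd (quotient_of (target J)))"
    using concat_sd_inject[OF assms(3)[unfolded enc_cri_def]] bin_inject by auto
  have g: "nverts I = nverts J \<and> edges I = edges J"
    using enc_graph_inject[OF _ _ eq(1)] assms(1,2)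
    by (simp add: cri_valid_def connected_graph_def)
  have pos: "fst (quotient_of (target K)) > 0 \<and> snd (quotient_of (target K)) > 0"
    if "cri_valid K" for K :: cri_instance
  proof -
    obtain p q where pq: "quotient_of (target K) = (p, q)" by fastforce
    have "q > 0" using quotient_of_denom_pos[OF pq] .
    moreover have "0 < (of_int p / of_int q :: rat)"
      using quotient_of_div[OF pq] that by (simp add: cri_valid_def)
    ultimately show ?thesis using pq by (simp add: zero_less_divide_iff)
  qed
  have "quotient_of (target I) = quotient_of (target J)"
    using eq(5,6) pos[OF assms(1)] pos[OF assms(2)] by (auto simp: prod_eq_iff)
  then have "target I = target J"
    by (metis quotient_of_div prod.exhaust)
  with g eq show ?thesis by simp
qed

text \<open>The problem restricted to instances with target ratio in \<open>R\<close>.\<close>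

definition CRI :: "rat set \<Rightarrow> bool list problem" where
  "CRI R =
     \<lparr>instances = {enc_cri I | I. cri_valid I \<and> target I \<in> R},
      yes_instances = {enc_cri I | I. cri_valid I \<and> target I \<in> R \<and> cri_yes I}\<rparr>"

definition CRI_par :: "rat set \<Rightarrow> (bool list \<times> nat) problem" where
  "CRI_par R =
     \<lparr>instances = {(enc_cri I, budget I) | I. cri_valid I \<and> target I \<in> R},
      yes_instances = {(enc_cri I, budget I) | I. cri_valid I \<and> target I \<in> R \<and> cri_yes I}\<rparr>"

end

theory Submission
  imports Defs
begin

text \<open>
  Adding \<open>K\<close> edges to a connected graph with \<open>n\<close> vertices leaves a vertex \<open>a\<close> with closeness at least
  \<open>2 (n - 1) - deg a - K\<close>, and equality holds only if all \<open>K\<close> edges are incident to \<open>a\<close> and every vertex ends up within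
  distance two of \<open>a\<close>. If \<open>b\<close> has exactly this closeness from the outset, then \<open>a\<close> can catch up with \<open>b\<close> if and
  only if \<open>K\<close> new neighbours of \<open>a\<close> dominate the graph. This encodes the problem of choosing a value for each of
  \<open>K\<close> slots such that each of polynomially many constraints, which are sets of pairs of slots and values, is hit.

  Acceptance by a nondeterministic machine is such a problem: the slots hold the state, the symbols read and
  the head positions at all times, where the symbol read is the one written at the last visit to that cell.

  For circuits of weft two and bounded depth, the number of slots is bounded in terms of the weight \<open>k\<close>:
  each slot holds a tuple of entries of the increasing sequence \<open>t\<close> of the true inputs, so that the value of an input is known
  from one entry or two consecutive ones, and further slots hold choices for the disjunctions above the first large gate.
  The conjunction at the first or second large gate ranges over the constraints, the disjunction at the second one over the slots.

  The reductions are given by arithmetical terms with bounded sums over the bits of the input. These are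
  evaluated in polynomial time by programs with counters, and counters are head positions of a Turing machine.
\<close>


section \<open>Turing machines with arbitrary state types\<close>

text \<open>A constraint is hit by one slot, so whatever certifies it has to fit into a single
  value. For machines this is harmless: an implication between slots becomes a disjunction once the
  values in its premises are constants over which the constraints range. For circuits, the number of
  slots must not depend on the circuit, so neither gates nor false inputs can have slots of their
  own. Falsity is therefore certified positively, by a gap in the sequence of true inputs, and a
  slot carries \<open>2 ^ (d + 1)\<close> entries: a subcircuit of depth \<open>d\<close> without
  large gates depends on at most \<open>2 ^ d\<close> inputs, each of which takes up to two entries.
  Small disjunctions below the first large gate are reached along too many branches to have slots;
  they are multiplied out by the distributive law. In the graph, the obstacle is that new edges may
  end at any vertex. With \<open>K + 1\<close> copies of the constraints, \<open>K\<close> new edges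
  leave one copy and its helper untouched, and this copy can only be reached through chosen values.
  The class of terms is kept small because each operation must be compiled to a machine; logarithms
  and binary digits are obtained from divisibility instead of exponentiation.\<close>

fun mstep :: "'s set \<Rightarrow> ('s \<Rightarrow> nat list \<Rightarrow> 's \<times> (nat \<times> move) list) \<Rightarrow> 's \<times> tape list \<Rightarrow> 's \<times> tape list" where
  "mstep Q \<delta> (q, ts) =
     (if q \<notin> Q then (q, ts)
      else let (q', as) = \<delta> q (map head_read ts) in (q', map2 head_act as ts))"

definition mwf :: "'s set \<Rightarrow> ('s \<Rightarrow> nat list \<Rightarrow> 's \<times> (nat \<times> move) list) \<Rightarrow> 's \<Rightarrow> nat \<Rightarrow> nat \<Rightarrow> bool" where
  "mwf Q \<delta> h K s \<longleftrightarrow> (\<forall>q \<in> Q. \<forall>ss. length ss = K \<and> (\<forall>a \<in> set ss. a < s) \<longrightarrow>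
     fst (\<delta> q ss) \<in> insert h Q \<and> length (snd (\<delta> q ss)) = K \<and> (\<forall>(a, d) \<in> set (snd (\<delta> q ss)). a < s))"

text \<open>Well-formedness restricts the transition function only on legal symbols, so this
  invariant has to accompany every run.\<close>

definition cells_below :: "nat \<Rightarrow> tape list \<Rightarrow> bool" where
  "cells_below s ts \<longleftrightarrow> (\<forall>t \<in> set ts. \<forall>i. fst t i < s)"

definition init_tapes :: "nat \<Rightarrow> bool list \<Rightarrow> tape list" where
  "init_tapes K x = (tape_of x, 0) # replicate (K - 1) (tape_of [], 0)"

lemma tm_step_eq_mstep: "tm_step M = mstep {..<states M} (delta M)"
  by (rule ext) (auto split: prod.splits)

lemma tm_wf_mwf: "tm_wf M \<Longrightarrow> mwf {..<states M} (delta M) (states M) (tapes M) (symbols M)"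
  unfolding tm_wf_def mwf_def by fastforce

lemma tm_init_eq: "tm_init M x = (0, init_tapes (tapes M) x)"
  by (simp add: tm_init_def init_tapes_def)

lemma fst_head_act: "fst (head_act a t) = (fst t)(snd t := fst a)"
  by (cases a; cases t) simp

lemma snd_head_act:
  "snd (head_act a t) = (case snd a of GoLeft \<Rightarrow> snd t - 1 | Stay \<Rightarrow> snd t | GoRight \<Rightarrow> snd t + 1)"
  by (cases a; cases t) (simp split: move.split)

lemma head_read_eq: "head_read t = fst t (snd t)"
  by (cases t) simp

lemma head_read_below: "cells_below s ts \<Longrightarrow> \<forall>a \<in> set (map head_read ts). a < s"
  by (auto simp: cells_below_def head_read_eq)

lemma mstep_inv:
  assumes "mwf Q \<delta> h K s" "q \<in> insert h Q" "length ts = K" "cells_below s ts" "mstep Q \<delta> (q, ts) = (q', ts')"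
  shows "q' \<in> insert h Q \<and> length ts' = K \<and> cells_below s ts'"
proof (cases "q \<in> Q")
  case True
  obtain as where d: "\<delta> q (map head_read ts) = (q', as)" "ts' = map2 head_act as ts"
    using assms(5) True by (auto split: prod.splits)
  have "\<forall>a \<in> set (map head_read ts). a < s"
    using head_read_below[OF assms(4)] .
  then have w: "q' \<in> insert h Q" "length as = K" "\<forall>(a, d) \<in> set as. a < s"
    using assms(1,3) True d(1) unfolding mwf_def by (metis length_map fst_conv snd_conv)+
  have "fst (head_act a t) i < s" if "(a, t) \<in> set (zip as ts)" for a t i
    using w(3) assms(4) set_zip_leftD[OF that] set_zip_rightD[OF that]
    by (auto simp: fst_head_act cells_below_def)
  then show ?thesis using w assms(3) d(2) by (auto simp: cells_below_def)
qed (use assms in auto)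

lemma tape_of_below: "3 \<le> s \<Longrightarrow> tape_of x i < s"
  by (simp add: tape_of_def)

lemma init_tapes_inv: "2 \<le> K \<Longrightarrow> 3 \<le> s \<Longrightarrow> length (init_tapes K x) = K \<and> cells_below s (init_tapes K x)"
  by (auto simp: init_tapes_def cells_below_def tape_of_below split: if_splits)

lemma msteps_inv:
  assumes "mwf Q \<delta> h K s" "q \<in> insert h Q" "length ts = K" "cells_below s ts"
  shows "(mstep Q \<delta> ^^ t) (q, ts) = (q', ts') \<Longrightarrow> q' \<in> insert h Q \<and> length ts' = K \<and> cells_below s ts'"
proof (induction t arbitrary: q' ts')
  case 0
  then show ?case using assms by simp
next
  case (Suc t)
  obtain q1 ts1 where 1: "(mstep Q \<delta> ^^ t) (q, ts) = (q1, ts1)" by fastforce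
  show ?case using mstep_inv[OF assms(1)] Suc.IH[OF 1] Suc.prems 1 by auto
qed

text \<open>Listing the states with \<open>q0\<close> first and \<open>h\<close> last gives them the
  numbers \<open>0\<close> and \<open>states M\<close>, as the concrete machine model demands; runs
  then correspond step by step. Machines can thus be built with structured states such as
  continuations or tagged pairs.\<close>

lemma machine_exists:
  assumes "finite Q" "q0 \<in> Q" "h \<notin> Q" "2 \<le> K" "3 \<le> s" and wf: "mwf Q \<delta> h K s"
  obtains M where "tm_wf M"
    "\<And>x y t ts. (mstep Q \<delta> ^^ t) (q0, init_tapes K x) = (h, ts) \<Longrightarrow> fst (ts ! 1) = tape_of y \<Longrightarrow>
       computes_within M x y t"
proof -
  obtain xs where xs: "set xs = Q - {q0}" "distinct xs"
    using finite_distinct_list[of "Q - {q0}"] assms(1) by auto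
  define l where "l = q0 # xs @ [h]"
  define n where "n = Suc (length xs)"
  have l: "distinct l" "set l = insert h Q" "length l = Suc n" "l ! 0 = q0" "l ! n = h"
    using xs assms(2,3) by (auto simp: l_def n_def nth_append)
  define num where "num q = (SOME i. i < length l \<and> l ! i = q)" for q
  have num: "num q < length l" "l ! num q = q" if "q \<in> insert h Q" for q
  proof -
    have "\<exists>i. i < length l \<and> l ! i = q" using that l(2) by (metis in_set_conv_nth)
    then have "num q < length l \<and> l ! num q = q" unfolding num_def by (rule someI_ex)
    then show "num q < length l" "l ! num q = q" by auto
  qed
  have num_eqI: "num q = i" if "i < length l" "l ! i = q" for i q
    using num[of q] that l(1,2) by (metis nth_eq_iff_index_eq nth_mem)
  have num0: "num q0 = 0" and numh: "num h = n"
    using l by (auto intro!: num_eqI)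
  have num_less: "num q < n" if "q \<in> Q" for q
    using num[of q] that l(3,5) assms(3) by (metis insertCI less_SucE)
  have nth_Q: "l ! i \<in> Q" if "i < n" for i
  proof -
    have "l ! i \<in> insert h Q" using l(2,3) that by (metis less_SucI nth_mem)
    moreover have "l ! i \<noteq> h"
      using l(1,3,5) that by (metis lessI less_SucI nat_neq_iff nth_eq_iff_index_eq)
    ultimately show ?thesis by simp
  qed
  define M where "M = \<lparr>tapes = K, states = n, symbols = s,
    delta = \<lambda>i ss. (num (fst (\<delta> (l ! i) ss)), snd (\<delta> (l ! i) ss))\<rparr>"
  have "tm_wf M"
    unfolding tm_wf_def
  proof (intro conjI allI impI)
    fix q ss assume q: "q < states M" and ss: "length ss = tapes M \<and> (\<forall>a\<in>set ss. a < symbols M)"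
    have w: "fst (\<delta> (l ! q) ss) \<in> insert h Q" "length (snd (\<delta> (l ! q) ss)) = K"
      "\<forall>(a, d) \<in> set (snd (\<delta> (l ! q) ss)). a < s"
      using wf nth_Q[of q] q ss unfolding mwf_def M_def by simp_all
    show "fst (delta M q ss) \<le> states M" using num(1)[OF w(1)] l(3) by (simp add: M_def)
    show "length (snd (delta M q ss)) = tapes M" "\<forall>(a, d)\<in>set (snd (delta M q ss)). a < symbols M"
      using w by (simp_all add: M_def)
  qed (use assms(4,5) in \<open>simp_all add: M_def n_def\<close>)
  moreover have "computes_within M x y t"
    if run: "(mstep Q \<delta> ^^ t) (q0, init_tapes K x) = (h, ts)" "fst (ts ! 1) = tape_of y" for x y t ts
  proof -
    have "(tm_step M ^^ t) (tm_init M x) =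
      (case (mstep Q \<delta> ^^ t) (q0, init_tapes K x) of (q, ts) \<Rightarrow> (num q, ts))" for t
    proof (induction t)
      case 0
      then show ?case by (simp add: tm_init_eq num0 M_def)
    next
      case (Suc t)
      obtain q ts where 1: "(mstep Q \<delta> ^^ t) (q0, init_tapes K x) = (q, ts)" by fastforce
      have q: "q \<in> insert h Q"
        using msteps_inv[OF wf _ _ _ 1] init_tapes_inv[OF assms(4,5), of x] assms(2) by auto
      have "tm_step M (num q, ts) = (case mstep Q \<delta> (q, ts) of (q, ts) \<Rightarrow> (num q, ts))"
      proof (cases "q = h")
        case True
        then show ?thesis using numh assms(3) by (simp add: M_def)
      next
        case False
        then have "q \<in> Q" using q by simp
        then show ?thesis using num_less[of q] num(2)[OF q] by (simp add: M_def case_prod_unfold Let_def)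
      qed
      then show ?case using 1 Suc by simp
    qed
    then show ?thesis using run numh by (simp add: computes_within_def M_def)
  qed
  ultimately show ?thesis by (rule that)
qed

lemma tm_step_halted: "(tm_step M ^^ t) (states M, ts) = (states M, ts)"
  by (induction t) auto

lemma computes_within_mono:
  assumes "computes_within M x y t" "t \<le> t'"
  shows "computes_within M x y t'"
proof -
  obtain d where d: "t' = d + t" using assms(2) by (metis add.commute le_Suc_ex)
  show ?thesis
    using assms(1) by (auto simp: computes_within_def d funpow_add tm_step_halted split: prod.splits)
qed

lemma tape_of_support: "{i. tape_of y i \<noteq> 0} = {0..<int (length y)}"
  by (auto simp: tape_of_def)

text \<open>A step changes only one cell of the output tape, so at most \<open>t\<close> cells are
  nonblank after \<open>t\<close> steps. This bounds the input of the second machine in a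
  composition.\<close>

lemma length_output_le:
  assumes "tm_wf M" "computes_within M x y t"
  shows "length y \<le> t"
proof -
  let ?S = "\<lambda>ts. {i. fst (ts ! 1 :: tape) i \<noteq> 0}"
  note wf = tm_wf_mwf[OF assms(1)]
  have K: "2 \<le> tapes M" "3 \<le> symbols M" "0 < states M" using assms(1) by (auto simp: tm_wf_def)
  have *: "\<forall>q ts. (tm_step M ^^ t) (tm_init M x) = (q, ts) \<longrightarrow> finite (?S ts) \<and> card (?S ts) \<le> t" for t
  proof (induction t)
    case 0
    then show ?case using K by (auto simp: tm_init_def nth_Cons' tape_of_def)
  next
    case (Suc t)
    obtain q ts where 1: "(tm_step M ^^ t) (tm_init M x) = (q, ts)" by fastforce
    have fin: "finite (?S ts)" "card (?S ts) \<le> t" using Suc 1 by auto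
    have inv: "length ts = tapes M" "cells_below (symbols M) ts" "q \<in> insert (states M) {..<states M}"
      using msteps_inv[OF wf, of 0 "init_tapes (tapes M) x" t q ts] init_tapes_inv[of "tapes M" "symbols M" x] K 1
      by (auto simp: tm_init_eq tm_step_eq_mstep)
    show ?case
    proof (intro allI impI)
      fix q' ts' assume 2: "(tm_step M ^^ Suc t) (tm_init M x) = (q', ts')"
      show "finite (?S ts') \<and> card (?S ts') \<le> Suc t"
      proof (cases "q < states M")
        case True
        obtain as where as: "delta M q (map head_read ts) = (q', as)" "ts' = map2 head_act as ts"
          using 1 2 True by (auto split: prod.splits)
        have "length as = tapes M"
          using wf inv(1) head_read_below[OF inv(2)] True as(1) unfolding mwf_def by (metis length_map lessThan_iff snd_conv)
        then have "fst (ts' ! 1) = (fst (ts ! 1))(snd (ts ! 1) := fst (as ! 1))"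
          using inv K as(2) by (simp add: fst_head_act)
        then have "?S ts' \<subseteq> insert (snd (ts ! 1)) (?S ts)" by auto
        moreover have "finite (insert (snd (ts ! 1)) (?S ts))" "card (insert (snd (ts ! 1)) (?S ts)) \<le> Suc t"
          using fin by (auto simp: card_insert_if)
        ultimately show ?thesis by (meson card_mono finite_subset le_trans)
      next
        case False
        then show ?thesis using 1 2 fin by auto
      qed
    qed
  qed
  obtain q ts where r: "(tm_step M ^^ t) (tm_init M x) = (q, ts)" "fst (ts ! 1) = tape_of y"
    using assms(2) by (auto simp: computes_within_def split: prod.splits)
  then have "card (?S ts) \<le> t" using * by blast
  then show ?thesis unfolding r(2) tape_of_support by simp
qed


section \<open>Composition of Turing machines\<close>

text \<open>
  Tape \<open>0\<close> is the input tape of \<open>M1\<close>, tape \<open>1\<close> the output tape of \<open>M2\<close>, tape \<open>3\<close> the output tape of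
  \<open>M1\<close> and the input tape of \<open>M2\<close>. The head of tape \<open>2\<close>, whose cell \<open>0\<close> is marked, moves in parallel
  to that of tape \<open>3\<close>, and a nonzero head position is right or left of \<open>0\<close> according to the
  move in the state; this allows for returning to cell \<open>0\<close> before \<open>M2\<close> is started.
\<close>

datatype comp_state = Start | First nat move | Second nat

fun opposite :: "move \<Rightarrow> move" where
  "opposite GoLeft = GoRight"
| "opposite Stay = Stay"
| "opposite GoRight = GoLeft"

definition keep :: "nat list \<Rightarrow> (nat \<times> move) list" where
  "keep ss = map (\<lambda>s. (s, Stay)) ss"

text \<open>Behind tape \<open>3\<close> come the other tapes of \<open>M1\<close>, then those of
  \<open>M2\<close>. The two alphabets may differ; a symbol illegal for the simulated machine leads
  to the halting state, which keeps the composite well-formed over the larger alphabet. The recorded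
  direction changes only when the tracking head stands on the mark, since only there can the head
  leave for another side.\<close>

fun comp_delta :: "tm \<Rightarrow> tm \<Rightarrow> comp_state \<Rightarrow> nat list \<Rightarrow> comp_state \<times> (nat \<times> move) list" where
  "comp_delta M1 M2 Start ss = (First 0 Stay, (keep ss)[2 := (1, Stay)])"
| "comp_delta M1 M2 (First q g) ss =
    (if q < states M1 then
      (let rs = ss ! 0 # take (tapes M1 - 1) (drop 3 ss) in
       if \<forall>s \<in> set rs. s < symbols M1 then
         (let (q', as) = delta M1 q rs; mv = snd (as ! 1) in
          (First q' (if ss ! 2 = 1 then mv else g),
           as ! 0 # (ss ! 1, Stay) # (ss ! 2, mv) # tl as @ keep (drop (tapes M1 + 2) ss)))
       else (Second (states M2), keep ss))
     else if ss ! 2 = 1 then (Second 0, keep ss)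
     else (First q g, (keep ss)[2 := (ss ! 2, opposite g), 3 := (ss ! 3, opposite g)]))"
| "comp_delta M1 M2 (Second q) ss =
    (let rs = ss ! 3 # ss ! 1 # drop (tapes M1 + 2) ss in
     if \<forall>s \<in> set rs. s < symbols M2 then
       (let (q', as) = delta M2 q rs in
        (Second q', (ss ! 0, Stay) # as ! 1 # (ss ! 2, Stay) # as ! 0 #
          keep (take (tapes M1 - 2) (drop 4 ss)) @ drop 2 as))
     else (Second (states M2), keep ss))"

definition comp_states :: "tm \<Rightarrow> tm \<Rightarrow> comp_state set" where
  "comp_states M1 M2 = insert Start ({First q g | q g. q \<le> states M1} \<union> {Second q | q. q < states M2})"

lemma length_keep [simp]: "length (keep ss) = length ss"
  by (simp add: keep_def)

lemma map2_keep [simp]: "map2 head_act (keep (map head_read ts)) ts = ts"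
  by (rule nth_equalityI) (auto simp: keep_def head_read_eq prod_eq_iff fst_head_act snd_head_act)

lemma head_act_keep [simp]: "head_act (head_read t, Stay) t = t"
  by (cases t) simp

lemma finite_comp_states: "finite (comp_states M1 M2)"
proof -
  have "{First q g | q g. q \<le> states M1} = (\<lambda>(q, g). First q g) ` ({..states M1} \<times> {GoLeft, Stay, GoRight})"
    by (auto simp: image_iff) (metis move.exhaust)
  moreover have "{Second q | q. q < states M2} = Second ` {..<states M2}" by auto
  ultimately show ?thesis by (simp add: comp_states_def)
qed

lemma comp_mwf:
  assumes "tm_wf M1" "tm_wf M2" and s: "symbols M1 \<le> s" "symbols M2 \<le> s"
  shows "mwf (comp_states M1 M2) (comp_delta M1 M2) (Second (states M2)) (tapes M1 + tapes M2) s"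
  unfolding mwf_def
proof (intro ballI allI impI)
  fix Q ss
  assume Q: "Q \<in> comp_states M1 M2" and ss: "length ss = tapes M1 + tapes M2 \<and> (\<forall>a\<in>set ss. a < s)"
  have K: "2 \<le> tapes M1" "2 \<le> tapes M2" "3 \<le> symbols M1" "0 < states M1" "0 < states M2"
    using assms by (simp_all add: tm_wf_def)
  have s3: "3 \<le> s" using K s by simp
  have nth: "ss ! i < s" if "i < tapes M1 + tapes M2" for i
    using ss that by (metis nth_mem)
  have keep: "\<forall>(a, d) \<in> set (keep xs). a < s" if "set xs \<subseteq> set ss" for xs
    using ss that by (auto simp: keep_def)
  have upd: "\<forall>(a, d) \<in> set (xs[i := (b, e)]). a < s"
    if "\<forall>(a, d) \<in> set xs. a < s" "b < s" for xs :: "(nat \<times> move) list" and i b e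
    using that set_update_subset_insert[of xs i "(b, e)"] by blast
  show "fst (comp_delta M1 M2 Q ss) \<in> insert (Second (states M2)) (comp_states M1 M2) \<and>
    length (snd (comp_delta M1 M2 Q ss)) = tapes M1 + tapes M2 \<and>
    (\<forall>(a, d) \<in> set (snd (comp_delta M1 M2 Q ss)). a < s)"
  proof (cases Q)
    case Start
    then show ?thesis using ss K keep[of ss] upd[of "keep ss" 1 2 Stay] s3 by (simp add: comp_states_def)
  next
    case (First q g)
    show ?thesis
    proof (cases "q < states M1")
      case True
      define rs where "rs = ss ! 0 # take (tapes M1 - 1) (drop 3 ss)"
      show ?thesis
      proof (cases "\<forall>s \<in> set rs. s < symbols M1")
        case rs: True
        obtain q' as where d: "delta M1 q rs = (q', as)" by fastforce
        have "length rs = tapes M1" using ss K by (simp add: rs_def)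
        then have w: "q' \<le> states M1" "length as = tapes M1" "\<forall>(a, d) \<in> set as. a < symbols M1"
          using assms(1) True rs d unfolding tm_wf_def by (metis fst_conv snd_conv)+
        have as: "\<forall>p \<in> set as. fst p < s" using w(3) s by (fastforce simp: case_prod_unfold)
        have "as ! 0 \<in> set as" using w(2) K by simp
        then have "fst (as ! 0) < s" "\<forall>p \<in> set (tl as). fst p < s"
          using as by (auto dest: in_set_dropD[where n = 1, simplified drop_Suc drop_0 One_nat_def])
        then show ?thesis
          using True rs d w(1,2) ss K nth[of 1] nth[of 2] keep[of "drop (tapes M1 + 2) ss"] set_drop_subset[of "tapes M1 + 2" ss]
          unfolding First comp_delta.simps rs_def[symmetric]
          by (simp add: comp_states_def Let_def case_prod_unfold ball_Un)
      next
        case False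
        then show ?thesis using True ss keep[of ss]
          unfolding First comp_delta.simps rs_def[symmetric] by (auto simp: Let_def)
      qed
    next
      case False
      have "q \<le> states M1" using Q First by (simp add: comp_states_def)
      moreover have "\<forall>(a, d) \<in> set ((keep ss)[2 := (ss ! 2, opposite g), 3 := (ss ! 3, opposite g)]). a < s"
        using K nth[of 2] nth[of 3] keep[of ss] by (intro upd) auto
      ultimately show ?thesis
        using False First K ss keep[of ss] by (cases "ss ! 2 = 1") (simp_all add: comp_states_def)
    qed
  next
    case (Second q)
    then have q: "q < states M2" using Q by (auto simp: comp_states_def)
    define rs where "rs = ss ! 3 # ss ! 1 # drop (tapes M1 + 2) ss"
    show ?thesis
    proof (cases "\<forall>s \<in> set rs. s < symbols M2")
      case rs: True
      obtain q' as where d: "delta M2 q rs = (q', as)" by fastforce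
      have "length rs = tapes M2" using ss K by (simp add: rs_def)
      then have w: "q' \<le> states M2" "length as = tapes M2" "\<forall>(a, d) \<in> set as. a < symbols M2"
        using assms(2) q rs d unfolding tm_wf_def by (metis fst_conv snd_conv)+
      have as: "\<forall>p \<in> set as. fst p < s" using w(3) s by (fastforce simp: case_prod_unfold)
      have "as ! 0 \<in> set as" "as ! 1 \<in> set as" using w(2) K by simp_all
      then have "fst (as ! 0) < s" "fst (as ! 1) < s" "\<forall>p \<in> set (drop 2 as). fst p < s"
        using as by (auto dest: in_set_dropD)
      moreover have "set (take (tapes M1 - 2) (drop 4 ss)) \<subseteq> set ss"
        by (meson set_drop_subset set_take_subset subset_trans)
      moreover have "ss ! 0 < s" "ss ! 2 < s" using nth K by simp_all
      moreover have "q' = states M2 \<or> q' < states M2" using w(1) by auto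
      ultimately show ?thesis
        using rs d w(2) ss K keep[of "take (tapes M1 - 2) (drop 4 ss)"]
        unfolding Second comp_delta.simps rs_def[symmetric]
        by (simp add: comp_states_def Let_def case_prod_unfold ball_Un min_def) linarith
    next
      case False
      then show ?thesis using ss keep[of ss]
        unfolding Second comp_delta.simps rs_def[symmetric] by (auto simp: Let_def)
    qed
  qed
qed

definition marked :: "int \<Rightarrow> nat" where
  "marked i = (if i = 0 then 1 else 0)"

definition side :: "move \<Rightarrow> int \<Rightarrow> bool" where
  "side g p \<longleftrightarrow> (p > 0 \<longrightarrow> g = GoRight) \<and> (p < 0 \<longrightarrow> g = GoLeft)"

lemma comp_first_step:
  assumes wf: "tm_wf M1" and q: "q < states M1"
    and st: "tm_step M1 (q, a # d # r1) = (q1, a1 # d1 # r1')"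
    and len: "length r1 = tapes M1 - 2" "length r2 = tapes M2 - 2"
    and below: "cells_below (symbols M1) (a # d # r1)" and g: "side g (snd d)"
  shows "\<exists>g1. mstep (comp_states M1 M2) (comp_delta M1 M2) (First q g, a # b # (marked, snd d) # d # r1 @ r2)
     = (First q1 g1, a1 # b # (marked, snd d1) # d1 # r1' @ r2) \<and> side g1 (snd d1)"
proof -
  let ?rs = "map head_read (a # d # r1)"
  have K: "2 \<le> tapes M1" using wf by (simp add: tm_wf_def)
  obtain as where as: "delta M1 q ?rs = (q1, as)" "map2 head_act as (a # d # r1) = a1 # d1 # r1'"
    using st q by (auto split: prod.splits)
  have "length ?rs = tapes M1" using len K by simp
  moreover have rs: "\<forall>s \<in> set ?rs. s < symbols M1" by (rule head_read_below[OF below])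
  ultimately have "length as = tapes M1"
    using wf q as(1) unfolding tm_wf_def by (metis snd_conv)
  then obtain x0 x1 xs where x: "as = x0 # x1 # xs" "length xs = length r1"
    using K len(1) by (cases as; cases "tl as") auto
  have eq: "a1 = head_act x0 a" "d1 = head_act x1 d" "r1' = map2 head_act xs r1"
    using as(2) x by auto
  let ?ts = "a # b # (marked, snd d) # d # r1 @ r2"
  have tk: "map head_read ?ts ! 0 # take (tapes M1 - 1) (drop 3 (map head_read ?ts)) = ?rs"
    using len K by (cases "tapes M1") (auto simp: numeral_3_eq_3 take_Cons' )
  have dr: "drop (tapes M1 + 2) (map head_read ?ts) = map head_read r2"
    using len K by (auto simp: drop_Cons' numeral_3_eq_3)
  have "mstep (comp_states M1 M2) (comp_delta M1 M2) (First q g, ?ts)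
     = (First q1 (if snd d = 0 then snd x1 else g), a1 # b # (marked, snd d1) # d1 # r1' @ r2)"
  proof -
    have m: "head_read (marked, snd d) = (if snd d = 0 then 1 else 0)"
      "head_act (if snd d = 0 then 1 else 0, snd x1) (marked, snd d) = (marked, snd d1)"
      by (auto simp: marked_def eq snd_head_act fun_eq_iff)
    have z: "zip (xs @ keep (map head_read r2)) (r1 @ r2) = zip xs r1 @ zip (keep (map head_read r2)) r2"
      using x(2) by simp
    have "comp_delta M1 M2 (First q g) (map head_read ?ts) = (First q1 (if snd d = 0 then snd x1 else g),
      x0 # (head_read b, Stay) # (head_read (marked, snd d), snd x1) # x1 # xs @ keep (map head_read r2))"
      unfolding comp_delta.simps tk dr using q rs as(1) x(1) m(1) by (simp add: Let_def)
    moreover have "First q g \<in> comp_states M1 M2" using q by (simp add: comp_states_def)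
    ultimately show ?thesis by (simp add: m z eq snd_head_act)
  qed
  moreover have "side (if snd d = 0 then snd x1 else g) (snd d1)"
    using g eq by (auto simp: side_def snd_head_act split: move.splits if_splits)
  ultimately show ?thesis by blast
qed

text \<open>One step per cell back to the mark, and one more to start \<open>M2\<close> after the
  mark has been seen.\<close>

lemma comp_rewind:
  assumes wf: "tm_wf M2" and "length ts = tapes M1 + tapes M2 - 4" "q = states M1" "side g p"
  shows "(mstep (comp_states M1 M2) (comp_delta M1 M2) ^^ Suc (nat \<bar>p\<bar>)) (First q g, a # b # (marked, p) # (c, p) # ts)
     = (Second 0, a # b # (marked, 0) # (c, 0) # ts)"
  using assms(4)
proof (induction "nat \<bar>p\<bar>" arbitrary: p)
  have q: "First q g \<in> comp_states M1 M2" using assms(3) by (simp add: comp_states_def)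
  {
    case 0
    then have "p = 0" by simp
    have "comp_delta M1 M2 (First q g) (map head_read (a # b # (marked, 0) # (c, 0) # ts))
      = (Second 0, keep (map head_read (a # b # (marked, 0) # (c, 0) # ts)))"
      unfolding comp_delta.simps using assms(3) by (simp add: marked_def)
    then show ?case using q \<open>p = 0\<close> map2_keep[of "a # b # (marked, 0) # (c, 0) # ts"]
      by (simp del: comp_delta.simps list.map)
  next
    case (Suc n)
    define p' where "p' = (if p > 0 then p - 1 else p + 1)"
    have p: "p \<noteq> 0" "n = nat \<bar>p'\<bar>" "side g p'" using Suc by (auto simp: p'_def side_def)
    have g: "(case opposite g of GoLeft \<Rightarrow> p - 1 | Stay \<Rightarrow> p | GoRight \<Rightarrow> p + 1) = p'"
      using Suc.prems p(1) by (auto simp: side_def p'_def)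
    have "mstep (comp_states M1 M2) (comp_delta M1 M2) (First q g, a # b # (marked, p) # (c, p) # ts)
      = (First q g, a # b # (marked, p') # (c, p') # ts)"
      using q p(1) assms(3) g map2_keep[of ts]
      by (simp add: marked_def fun_eq_iff keep_def numeral_3_eq_3 numeral_2_eq_2)
    then show ?case
      using Suc.hyps(1)[OF p(2,3)] p(2) Suc.hyps(2)[symmetric]
      by (simp only: funpow_Suc_right o_apply)
  }
qed

lemma comp_second_step:
  assumes wf: "tm_wf M1" "tm_wf M2" and st: "tm_step M2 (q, d # b # r2) = (q1, d1 # b1 # r2')"
    and len: "length r1 = tapes M1 - 2" "length r2 = tapes M2 - 2"
    and below: "cells_below (symbols M2) (d # b # r2)" and q: "q \<le> states M2"
  shows "mstep (comp_states M1 M2) (comp_delta M1 M2) (Second q, a # b # tr # d # r1 @ r2)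
     = (Second q1, a # b1 # tr # d1 # r1 @ r2')"
proof (cases "q < states M2")
  case True
  let ?rs = "map head_read (d # b # r2)"
  have K: "2 \<le> tapes M1" "2 \<le> tapes M2" using wf by (simp_all add: tm_wf_def)
  obtain as where as: "delta M2 q ?rs = (q1, as)" "map2 head_act as (d # b # r2) = d1 # b1 # r2'"
    using st True by (auto split: prod.splits)
  have "length ?rs = tapes M2" using len K by simp
  moreover have rs: "\<forall>s \<in> set ?rs. s < symbols M2" by (rule head_read_below[OF below])
  ultimately have "length as = tapes M2"
    using wf True as(1) unfolding tm_wf_def by (metis snd_conv)
  then obtain x0 x1 xs where x: "as = x0 # x1 # xs" "length xs = length r2"
    using K len by (cases as; cases "tl as") auto
  have eq: "d1 = head_act x0 d" "b1 = head_act x1 b" "r2' = map2 head_act xs r2"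
    using as(2) x by auto
  let ?ts = "a # b # tr # d # r1 @ r2"
  have tk: "map head_read ?ts ! 3 # map head_read ?ts ! 1 # drop (tapes M1 + 2) (map head_read ?ts) = ?rs"
    using len K by (auto simp: drop_Cons' numeral_3_eq_3)
  have tk2: "take (tapes M1 - 2) (drop 4 (map head_read ?ts)) = map head_read r1"
    using len K by (simp add: numeral_eq_Suc)
  have z: "zip (keep (map head_read r1) @ xs) (r1 @ r2) = zip (keep (map head_read r1)) r1 @ zip xs r2"
    by simp
  have "comp_delta M1 M2 (Second q) (map head_read ?ts) = (Second q1,
    (head_read a, Stay) # x1 # (head_read tr, Stay) # x0 # keep (map head_read r1) @ xs)"
    unfolding comp_delta.simps tk tk2 using rs as(1) x(1) by (simp add: Let_def numeral_2_eq_2)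
  moreover have "Second q \<in> comp_states M1 M2" using True by (simp add: comp_states_def)
  ultimately show ?thesis by (simp add: z eq)
next
  case False
  then show ?thesis using st by (auto simp: comp_states_def)
qed

lemma list2E:
  assumes "2 \<le> length xs"
  obtains a b r where "xs = a # b # r" "length r = length xs - 2"
  using assms by (cases xs; cases "tl xs") auto

text \<open>One step writes the mark, the simulation of \<open>M1\<close> takes at most
  \<open>t1\<close> steps and moves the head at most that far, so the return takes at most
  \<open>t1 + 1\<close> steps; then \<open>M2\<close> takes \<open>t2\<close>.\<close>

lemma compose_machines:
  assumes wf: "tm_wf M1" "tm_wf M2"
  obtains M where "tm_wf M"
    "\<And>x y z t1 t2. computes_within M1 x y t1 \<Longrightarrow> computes_within M2 y z t2 \<Longrightarrow>
       computes_within M x z (2 * t1 + t2 + 2)"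
proof -
  define Q where "Q = comp_states M1 M2"
  define \<delta> where "\<delta> = comp_delta M1 M2"
  define h where "h = Second (states M2)"
  define K where "K = tapes M1 + tapes M2"
  define s where "s = max (symbols M1) (symbols M2)"
  note w1 = tm_wf_mwf[OF wf(1)] and w2 = tm_wf_mwf[OF wf(2)]
  have K1: "2 \<le> tapes M1" "3 \<le> symbols M1" "0 < states M1" using wf(1) by (simp_all add: tm_wf_def)
  have K2: "2 \<le> tapes M2" "3 \<le> symbols M2" "0 < states M2" using wf(2) by (simp_all add: tm_wf_def)
  have mwf: "mwf Q \<delta> h K s"
    unfolding Q_def \<delta>_def h_def K_def by (rule comp_mwf[OF wf]) (simp_all add: s_def)
  have "finite Q" "Start \<in> Q" "h \<notin> Q" "2 \<le> K" "3 \<le> s"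
    using finite_comp_states[of M1 M2] K1 K2 by (simp_all add: Q_def h_def K_def s_def comp_states_def)
  from machine_exists[OF this mwf] obtain M where M: "tm_wf M"
    "\<And>x y t ts. (mstep Q \<delta> ^^ t) (Start, init_tapes K x) = (h, ts) \<Longrightarrow> fst (ts ! 1) = tape_of y \<Longrightarrow>
       computes_within M x y t"
    by blast
  have "computes_within M x z (2 * t1 + t2 + 2)"
    if c: "computes_within M1 x y t1" "computes_within M2 y z t2" for x y z t1 t2
  proof -
    let ?B = "(tape_of [], 0 :: int)"
    let ?R2 = "replicate (tapes M2 - 2) ?B"
    define c1 where "c1 t = (tm_step M1 ^^ t) (tm_init M1 x)" for t
    have "fst (c1 t1) = states M1" using c(1) by (auto simp: computes_within_def c1_def split: prod.splits)
    then have ex: "\<exists>t. fst (c1 t) = states M1" by blast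
    \<comment> \<open>The composite leaves its first phase as soon as \<open>M1\<close> halts, hence
      the simulation runs up to the first halting time rather than \<open>t1\<close>.\<close>
    define u where "u = (LEAST t. fst (c1 t) = states M1)"
    have u: "fst (c1 u) = states M1" "u \<le> t1" "\<And>t. t < u \<Longrightarrow> fst (c1 t) \<noteq> states M1"
      unfolding u_def using LeastI_ex[OF ex] by (auto dest: not_less_Least intro: Least_le \<open>fst (c1 t1) = states M1\<close>)
    have inv1: "fst (c1 t) \<le> states M1 \<and> length (snd (c1 t)) = tapes M1 \<and> cells_below (symbols M1) (snd (c1 t))" for t
      using msteps_inv[OF w1, of 0 "init_tapes (tapes M1) x" t "fst (c1 t)" "snd (c1 t)"] init_tapes_inv[OF K1(1,2), of x] K1(3)
      by (auto simp: c1_def tm_init_eq tm_step_eq_mstep)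
    have first: "\<exists>g a d r1. c1 t = (fst (c1 t), a # d # r1) \<and> length r1 = tapes M1 - 2 \<and> side g (snd d) \<and> \<bar>snd d\<bar> \<le> int t \<and>
       (mstep Q \<delta> ^^ Suc t) (Start, init_tapes K x) = (First (fst (c1 t)) g, a # ?B # (marked, snd d) # d # r1 @ ?R2)"
      if "t \<le> u" for t
      using that
    proof (induction t)
      case 0
      have r: "replicate (K - Suc 0) ?B = ?B # ?B # ?B # replicate (tapes M1 - 2) ?B @ ?R2"
        "replicate (tapes M1 - Suc 0) ?B = ?B # replicate (tapes M1 - 2) ?B"
        using K1 K2 by (simp_all add: K_def replicate_add[symmetric] replicate_Suc[symmetric] del: replicate_Suc)
      have m: "(tape_of [])(0 := Suc 0) = marked" by (auto simp: marked_def tape_of_def)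
      have "(mstep Q \<delta> ^^ Suc 0) (Start, init_tapes K x) = (First 0 Stay,
        (tape_of x, 0) # ?B # (marked, 0) # ?B # replicate (tapes M1 - 2) ?B @ ?R2)"
        using map2_keep[of "replicate (tapes M1 - 2) ?B @ ?R2"]
        by (simp add: init_tapes_def r Q_def \<delta>_def comp_states_def keep_def numeral_2_eq_2 m del: map_append map_replicate zip_replicate)
      then show ?case by (auto simp: c1_def tm_init_def r side_def)
    next
      case (Suc t)
      then obtain g a d r1 where IH: "c1 t = (fst (c1 t), a # d # r1)" "length r1 = tapes M1 - 2" "side g (snd d)" "\<bar>snd d\<bar> \<le> int t"
        "(mstep Q \<delta> ^^ Suc t) (Start, init_tapes K x) = (First (fst (c1 t)) g, a # ?B # (marked, snd d) # d # r1 @ ?R2)"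
        by auto
      have q: "fst (c1 t) < states M1" using u(3)[of t] Suc.prems inv1[of t] by simp
      have "2 \<le> length (snd (c1 (Suc t)))" using inv1[of "Suc t"] K1 by simp
      then obtain a1 d1 r1' where n: "snd (c1 (Suc t)) = a1 # d1 # r1'" "length r1' = length (snd (c1 (Suc t))) - 2"
        by (rule list2E)
      have st: "tm_step M1 (fst (c1 t), a # d # r1) = (fst (c1 (Suc t)), a1 # d1 # r1')"
        using IH(1) n(1) by (metis c1_def funpow.simps(2) o_apply prod.collapse)
      have dd: "\<bar>snd d1\<bar> \<le> int (Suc t)"
      proof -
        have "\<exists>x1. d1 = head_act x1 d"
          using st q by (cases "snd (delta M1 (fst (c1 t)) (map head_read (a # d # r1)))";
              cases "tl (snd (delta M1 (fst (c1 t)) (map head_read (a # d # r1))))") (auto split: prod.splits)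
        then show ?thesis using IH(4) by (auto simp: snd_head_act split: move.splits)
      qed
      have "cells_below (symbols M1) (a # d # r1)" using inv1[of t] IH(1) by (metis snd_conv)
      from comp_first_step[OF wf(1) q st IH(2) _ this IH(3), of ?R2 M2 ?B] obtain g1 where
        "mstep Q \<delta> (First (fst (c1 t)) g, a # ?B # (marked, snd d) # d # r1 @ ?R2)
         = (First (fst (c1 (Suc t))) g1, a1 # ?B # (marked, snd d1) # d1 # r1' @ ?R2)" "side g1 (snd d1)"
        by (auto simp: Q_def \<delta>_def)
      then have "(mstep Q \<delta> ^^ Suc (Suc t)) (Start, init_tapes K x)
         = (First (fst (c1 (Suc t))) g1, a1 # ?B # (marked, snd d1) # d1 # r1' @ ?R2)"
        unfolding funpow.simps(2)[of "Suc t"] o_apply IH(5) by simp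
      moreover have "c1 (Suc t) = (fst (c1 (Suc t)), a1 # d1 # r1')" using n(1) by (metis prod.collapse)
      moreover have "length r1' = tapes M1 - 2" using n(2) inv1[of "Suc t"] by presburger
      ultimately show ?case using dd \<open>side g1 (snd d1)\<close> by blast
    qed
    obtain g a d r1 where 1: "c1 u = (states M1, a # d # r1)" "length r1 = tapes M1 - 2" "side g (snd d)" "\<bar>snd d\<bar> \<le> int u"
       "(mstep Q \<delta> ^^ Suc u) (Start, init_tapes K x) = (First (states M1) g, a # ?B # (marked, snd d) # d # r1 @ ?R2)"
      using first[of u] u(1) by auto
    have "c1 t1 = c1 u"
    proof -
      obtain e where "t1 = e + u" using u(2) by (metis add.commute le_Suc_ex)
      then show ?thesis using 1(1) tm_step_halted[of e M1 "a # d # r1"] by (simp add: c1_def funpow_add)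
    qed
    then have d: "fst d = tape_of y"
      using c(1) 1(1) by (auto simp: computes_within_def c1_def)
    define v where "v = Suc (nat \<bar>snd d\<bar>)"
    have v: "v \<le> Suc u" using 1(4) by (simp add: v_def)
    have d': "d = (tape_of y, snd d)" using d by (metis prod.collapse)
    have 2: "(mstep Q \<delta> ^^ v) (First (states M1) g, a # ?B # (marked, snd d) # d # r1 @ ?R2) =
       (Second 0, a # ?B # (marked, 0) # (tape_of y, 0) # r1 @ ?R2)"
      unfolding Q_def \<delta>_def v_def by (subst (2) d', rule comp_rewind[OF wf(2)]) (use 1(2,3) K1 K2 in auto)
    define c2 where "c2 t = (tm_step M2 ^^ t) (tm_init M2 y)" for t
    have inv2: "fst (c2 t) \<le> states M2 \<and> length (snd (c2 t)) = tapes M2 \<and> cells_below (symbols M2) (snd (c2 t))" for t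
      using msteps_inv[OF w2, of 0 "init_tapes (tapes M2) y" t "fst (c2 t)" "snd (c2 t)"] init_tapes_inv[OF K2(1,2), of y] K2(3)
      by (auto simp: c2_def tm_init_eq tm_step_eq_mstep)
    have second: "\<exists>e b r2. c2 t = (fst (c2 t), e # b # r2) \<and> length r2 = tapes M2 - 2 \<and>
       (mstep Q \<delta> ^^ t) (Second 0, a # ?B # (marked, 0) # (tape_of y, 0) # r1 @ ?R2)
       = (Second (fst (c2 t)), a # b # (marked, 0) # e # r1 @ r2)" for t
    proof (induction t)
      case 0
      have "replicate (tapes M2 - Suc 0) ?B = ?B # ?R2"
        using K2 by (simp add: replicate_Suc[symmetric] del: replicate_Suc)
      then show ?case by (auto simp: c2_def tm_init_def)
    next
      case (Suc t)
      then obtain e b r2 where IH: "c2 t = (fst (c2 t), e # b # r2)" "length r2 = tapes M2 - 2"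
        "(mstep Q \<delta> ^^ t) (Second 0, a # ?B # (marked, 0) # (tape_of y, 0) # r1 @ ?R2)
         = (Second (fst (c2 t)), a # b # (marked, 0) # e # r1 @ r2)"
        by auto
      have "2 \<le> length (snd (c2 (Suc t)))" using inv2[of "Suc t"] K2 by simp
      then obtain e1 b1 r2' where n: "snd (c2 (Suc t)) = e1 # b1 # r2'" "length r2' = length (snd (c2 (Suc t))) - 2"
        by (rule list2E)
      have st: "tm_step M2 (fst (c2 t), e # b # r2) = (fst (c2 (Suc t)), e1 # b1 # r2')"
        using IH(1) n(1) by (metis c2_def funpow.simps(2) o_apply prod.collapse)
      have "cells_below (symbols M2) (e # b # r2)" using inv2[of t] IH(1) by (metis snd_conv)
      from comp_second_step[OF wf st 1(2) IH(2) this] inv2[of t]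
      have "mstep Q \<delta> (Second (fst (c2 t)), a # b # (marked, 0) # e # r1 @ r2) =
        (Second (fst (c2 (Suc t))), a # b1 # (marked, 0) # e1 # r1 @ r2')"
        by (simp add: Q_def \<delta>_def)
      then have "(mstep Q \<delta> ^^ Suc t) (Second 0, a # ?B # (marked, 0) # (tape_of y, 0) # r1 @ ?R2)
         = (Second (fst (c2 (Suc t))), a # b1 # (marked, 0) # e1 # r1 @ r2')"
        unfolding funpow.simps(2) o_apply IH(3) by simp
      moreover have "c2 (Suc t) = (fst (c2 (Suc t)), e1 # b1 # r2')" using n(1) by (metis prod.collapse)
      moreover have "length r2' = tapes M2 - 2" using n(2) inv2[of "Suc t"] by presburger
      ultimately show ?case by blast
    qed
    obtain e b r2 where 3: "c2 t2 = (fst (c2 t2), e # b # r2)"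
       "(mstep Q \<delta> ^^ t2) (Second 0, a # ?B # (marked, 0) # (tape_of y, 0) # r1 @ ?R2)
       = (Second (fst (c2 t2)), a # b # (marked, 0) # e # r1 @ r2)"
      using second by blast
    have b: "fst (c2 t2) = states M2" "fst b = tape_of z"
      using c(2) 3(1) by (auto simp: computes_within_def c2_def split: prod.splits)
    have "(mstep Q \<delta> ^^ (t2 + (v + Suc u))) (Start, init_tapes K x) = (h, a # b # (marked, 0) # e # r1 @ r2)"
      using 1(5) 2 3(2) b(1) by (simp only: funpow_add o_apply h_def)
    then have "computes_within M x z (t2 + (v + Suc u))" by (rule M(2)) (simp add: b)
    then show ?thesis by (rule computes_within_mono) (use v u(2) in simp)
  qed
  with M(1) show ?thesis by (rule that)
qed

section \<open>Counter programs\<close>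

text \<open>
  A counter is kept as the head position of a tape whose cell \<open>0\<close> is marked. A program state consists
  of the counters, the head position on the input tape, and the output.
\<close>

datatype com = Inc nat | Dec nat | InRight | InLeft | AddIn bool nat | Emit nat | Seq com com | While nat com

type_synonym cstate = "(nat \<Rightarrow> nat) \<times> int \<times> bool list"

text \<open>\<open>True\<close> asks for a one, \<open>False\<close> for a cell inside the input;
  the latter serves to measure the length of the input.\<close>

definition in_test :: "bool \<Rightarrow> nat \<Rightarrow> bool" where
  "in_test b s \<longleftrightarrow> (if b then s = 2 else s \<noteq> 0)"

fun cstep :: "bool list \<Rightarrow> com list \<times> cstate \<Rightarrow> com list \<times> cstate" where
  "cstep x ([], s) = ([], s)"
| "cstep x (Inc v # K, (\<sigma>, p, w)) = (K, (\<sigma>(v := Suc (\<sigma> v)), p, w))"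
| "cstep x (Dec v # K, (\<sigma>, p, w)) = (K, (\<sigma>(v := \<sigma> v - 1), p, w))"
| "cstep x (InRight # K, (\<sigma>, p, w)) = (K, (\<sigma>, p + 1, w))"
| "cstep x (InLeft # K, (\<sigma>, p, w)) = (K, (\<sigma>, p - 1, w))"
| "cstep x (AddIn b v # K, (\<sigma>, p, w)) =
     (K, (\<sigma>(v := \<sigma> v + of_bool (in_test b (tape_of x p))), p, w))"
| "cstep x (Emit v # K, (\<sigma>, p, w)) = (K, (\<sigma>, p, w @ [\<sigma> v > 0]))"
| "cstep x (Seq c d # K, s) = (c # d # K, s)"
| "cstep x (While v c # K, (\<sigma>, p, w)) =
     (if \<sigma> v = 0 then (K, (\<sigma>, p, w)) else (c # While v c # K, (\<sigma>, p, w)))"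

fun com_vars :: "com \<Rightarrow> nat set" where
  "com_vars (Inc v) = {v}"
| "com_vars (Dec v) = {v}"
| "com_vars InRight = {}"
| "com_vars InLeft = {}"
| "com_vars (AddIn b v) = {v}"
| "com_vars (Emit v) = {v}"
| "com_vars (Seq c d) = com_vars c \<union> com_vars d"
| "com_vars (While v c) = insert v (com_vars c)"

lemma finite_com_vars: "finite (com_vars c)"
  by (induction c) auto

text \<open>The continuations that can occur while \<open>c\<close> is executed in front of \<open>K\<close>.\<close>

fun residuals :: "com \<Rightarrow> com list \<Rightarrow> com list set" where
  "residuals (Seq c d) K = insert (Seq c d # K) (residuals c (d # K) \<union> residuals d K)"
| "residuals (While v c) K = insert (While v c # K) (residuals c (While v c # K))"
| "residuals c K = {c # K}"

lemma finite_residuals: "finite (residuals c K)"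
  by (induction c K rule: residuals.induct) auto

lemma self_residual: "c # K \<in> residuals c K"
  by (cases c) auto

lemma residual_nonempty: "L \<in> residuals c K \<Longrightarrow> L \<noteq> []"
  by (induction c K rule: residuals.induct) auto

lemma residual_step:
  "L \<in> residuals c K \<Longrightarrow> fst (cstep x (L, s)) \<in> insert K (residuals c K)"
proof (induction c K rule: residuals.induct)
  case (1 c d K)
  then show ?case using self_residual[of c "d # K"] self_residual[of d K] by auto
next
  case (2 v c K)
  then show ?case using self_residual[of c "While v c # K"] by (cases s) (auto split: if_splits)
qed (cases s; simp)+

lemma residual_vars:
  "L \<in> residuals c K \<Longrightarrow> (\<Union>d \<in> set L. com_vars d) \<subseteq> com_vars c \<union> (\<Union>d \<in> set K. com_vars d)"
  by (induction c K rule: residuals.induct) fastforce+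

text \<open>\<open>None\<close> is an additional initial state whose only step marks cell
  \<open>0\<close> of all counter tapes; \<open>Some []\<close> is the halting state. A counter is
  zero if and only if its head reads the mark.\<close>

fun com_delta :: "com \<Rightarrow> com list option \<Rightarrow> nat list \<Rightarrow> com list option \<times> (nat \<times> move) list" where
  "com_delta c None ss = (Some [c], (ss ! 0, Stay) # (ss ! 1, Stay) # map (\<lambda>_. (1, Stay)) (drop 2 ss))"
| "com_delta c (Some []) ss = (Some [], keep ss)"
| "com_delta c (Some (Inc v # K)) ss = (Some K, (keep ss)[v + 2 := (ss ! (v + 2), GoRight)])"
| "com_delta c (Some (Dec v # K)) ss =
     (Some K, (keep ss)[v + 2 := (ss ! (v + 2), if ss ! (v + 2) = 1 then Stay else GoLeft)])"
| "com_delta c (Some (InRight # K)) ss = (Some K, (keep ss)[0 := (ss ! 0, GoRight)])"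
| "com_delta c (Some (InLeft # K)) ss = (Some K, (keep ss)[0 := (ss ! 0, GoLeft)])"
| "com_delta c (Some (AddIn b v # K)) ss =
     (Some K, (keep ss)[v + 2 := (ss ! (v + 2), if in_test b (ss ! 0) then GoRight else Stay)])"
| "com_delta c (Some (Emit v # K)) ss =
     (Some K, (keep ss)[1 := (if ss ! (v + 2) = 1 then 1 else 2, GoRight)])"
| "com_delta c (Some (Seq c1 c2 # K)) ss = (Some (c1 # c2 # K), keep ss)"
| "com_delta c (Some (While v d # K)) ss =
     (Some (if ss ! (v + 2) = 1 then K else d # While v d # K), keep ss)"

definition state_tapes :: "bool list \<Rightarrow> nat \<Rightarrow> cstate \<Rightarrow> tape list" where
  "state_tapes x n s = (case s of (\<sigma>, p, w) \<Rightarrow>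
     (tape_of x, p) # (tape_of w, int (length w)) # map (\<lambda>v. (marked, int (\<sigma> v))) [0..<n])"

lemma map2_keep_update:
  assumes "i < length ts"
  shows "map2 head_act ((keep (map head_read ts))[i := a]) ts = ts[i := head_act a (ts ! i)]"
  by (rule nth_equalityI) (use assms in \<open>auto simp: keep_def nth_list_update\<close>)

lemma marked_update [simp]: "marked(p := marked p) = marked"
  by auto

lemma com_delta_step:
  assumes "com_vars c \<subseteq> {..<n}"
  shows "(case com_delta c0 (Some (c # K)) (map head_read (state_tapes x n s)) of
       (q, as) \<Rightarrow> (q, map2 head_act as (state_tapes x n s)))
     = (case cstep x (c # K, s) of (L, s') \<Rightarrow> (Some L, state_tapes x n s'))"
proof -
  obtain \<sigma> p w where s: "s = (\<sigma>, p, w)" by (cases s)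
  let ?ts = "state_tapes x n s"
  have len: "length ?ts = n + 2" by (simp add: s state_tapes_def)
  have t0: "?ts ! 0 = (tape_of x, p)" and t1: "?ts ! 1 = (tape_of w, int (length w))"
    by (simp_all add: s state_tapes_def)
  have tv: "?ts ! (v + 2) = (marked, int (\<sigma> v))" if "v < n" for v
    using that by (simp add: s state_tapes_def)
  have r0: "map head_read ?ts ! 0 = tape_of x p" using t0 len by simp
  have rv: "map head_read ?ts ! (v + 2) = marked (int (\<sigma> v))" if "v < n" for v
    using tv[OF that] that len by simp
  have u0: "?ts[0 := (tape_of x, p')] = state_tapes x n (\<sigma>, p', w)" for p'
    by (simp add: s state_tapes_def)
  have u1: "?ts[1 := (tape_of w', int (length w'))] = state_tapes x n (\<sigma>, p, w')" for w'
    by (simp add: s state_tapes_def)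
  have uv: "?ts[v + 2 := (marked, int k)] = state_tapes x n (\<sigma>(v := k), p, w)" if "v < n" for v k
  proof (rule nth_equalityI)
    show "length (?ts[v + 2 := (marked, int k)]) = length (state_tapes x n (\<sigma>(v := k), p, w))"
      by (simp add: state_tapes_def s)
    show "?ts[v + 2 := (marked, int k)] ! i = state_tapes x n (\<sigma>(v := k), p, w) ! i"
      if "i < length (?ts[v + 2 := (marked, int k)])" for i
      using that \<open>v < n\<close> by (auto simp: state_tapes_def s nth_list_update nth_Cons split: nat.splits)
  qed
  note upd = map2_keep_update[of _ ?ts]
  show ?thesis
  proof (cases c)
    case (Inc v)
    then have "v < n" using assms by auto
    then show ?thesis using Inc uv[of v "Suc (\<sigma> v)"] tv[of v] rv[of v] len
      by (simp add: s[symmetric] upd del: map2_map_map) (simp add: s add.commute)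
  next
    case (Dec v)
    then have v: "v < n" using assms by auto
    show ?thesis
    proof (cases "\<sigma> v = 0")
      case True
      then show ?thesis using Dec v uv[of v 0] tv[of v] rv[of v] len
        by (simp add: upd) (simp add: s marked_def)
    next
      case False
      then have "int (\<sigma> v) - 1 = int (\<sigma> v - 1)" by simp
      then show ?thesis using False Dec v uv[of v "\<sigma> v - 1"] tv[of v] rv[of v] len
        by (simp add: upd) (simp add: s marked_def)
    qed
  next
    case InRight
    then show ?thesis using u0[of "p + 1"] t0 r0 len by (simp add: upd) (simp add: s)
  next
    case InLeft
    then show ?thesis using u0[of "p - 1"] t0 r0 len by (simp add: upd) (simp add: s)
  next
    case (AddIn b v)
    then have v: "v < n" using assms by auto
    show ?thesis
    proof (cases "in_test b (tape_of x p)")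
      case True
      then show ?thesis using AddIn v uv[of v "Suc (\<sigma> v)"] tv[of v] rv[of v] r0 len
        by (simp add: upd) (simp add: s add.commute)
    next
      case False
      then show ?thesis using AddIn v uv[of v "\<sigma> v"] tv[of v] rv[of v] r0 len
        by (simp add: upd) (simp add: s)
    qed
  next
    case (Emit v)
    then have v: "v < n" using assms by auto
    have "(tape_of w)(int (length w) := if 0 < \<sigma> v then 2 else 1) = tape_of (w @ [0 < \<sigma> v])"
      by (auto simp: tape_of_def fun_eq_iff nth_append)
    then show ?thesis using Emit v u1[of "w @ [0 < \<sigma> v]"] t1 rv[of v] len
      by (cases "\<sigma> v = 0"; simp add: upd marked_def; simp add: s add.commute)
  next
    case (Seq c1 c2)
    then show ?thesis by (simp add: s)
  next
    case (While v d)
    then have v: "v < n" using assms by auto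
    then show ?thesis using While rv[of v] by (simp add: marked_def) (simp add: s)
  qed
qed

text \<open>The control state is the remaining continuation, which ranges over the finite set of
  residuals. The extra step in the bound is the one that marks the counter tapes.\<close>

lemma com_machine:
  obtains M where "tm_wf M"
    "\<And>x t \<sigma> p w. (cstep x ^^ t) ([c], (\<lambda>_. 0, 0, [])) = ([], (\<sigma>, p, w)) \<Longrightarrow> computes_within M x w (Suc t)"
proof -
  obtain n where n: "com_vars c \<subseteq> {..<n}"
    using finite_nat_bounded[OF finite_com_vars] by blast
  define Q where "Q = insert None (Some ` residuals c [])"
  have upd: "\<forall>(a, d) \<in> set (xs[i := (b, e)]). a < 3"
    if "\<forall>(a, d) \<in> set xs. a < 3" "b < 3" for xs :: "(nat \<times> move) list" and i b e
    using that set_update_subset_insert[of xs i "(b, e)"] by blast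
  have step_delta: "fst (com_delta c (Some L) ss) \<in> insert (Some []) Q" if res: "L \<in> residuals c []" for L ss
  proof -
    obtain d K where L: "L = d # K" using residual_nonempty[OF res] by (cases L) auto
    have "\<exists>x s. fst (com_delta c (Some L) ss) = Some (fst (cstep x (L, s)))"
    proof (cases d)
      case (While v e)
      have "fst (com_delta c (Some L) ss)
        = Some (fst (cstep [] (L, (\<lambda>_. if ss ! (v + 2) = 1 then 0 else 1, 0, []))))"
        using L While by simp
      then show ?thesis by blast
    qed (use L in auto)
    then obtain x s where "fst (com_delta c (Some L) ss) = Some (fst (cstep x (L, s)))" by blast
    then show ?thesis using residual_step[OF res, of x s] unfolding Q_def by auto
  qed
  have "mwf Q (com_delta c) (Some []) (n + 2) 3"
    unfolding mwf_def
  proof (intro ballI allI impI)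
    fix q ss assume q: "q \<in> Q" and ss: "length ss = n + 2 \<and> (\<forall>a\<in>set ss. a < (3 :: nat))"
    have nth: "ss ! i < 3" if "i < n + 2" for i using ss that by (metis nth_mem)
    have k: "\<forall>(a, d) \<in> set (keep ss). a < 3" using ss by (auto simp: keep_def)
    have k': "\<forall>p \<in> set ((keep ss)[i := (b, e)]). fst p < 3" if "b < 3" for i b e
      using upd[OF k that, of i e] by (simp add: case_prod_unfold)
    show "fst (com_delta c q ss) \<in> insert (Some []) Q \<and> length (snd (com_delta c q ss)) = n + 2 \<and>
      (\<forall>(a, d)\<in>set (snd (com_delta c q ss)). a < 3)"
    proof (cases q)
      case None
      have "Some [c] \<in> Q" by (simp add: Q_def self_residual)
      then show ?thesis using None ss nth[of 0] nth[of 1] by auto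
    next
      case (Some L)
      then have L: "L \<in> residuals c []" using q by (auto simp: Q_def)
      then obtain d K where dK: "L = d # K" using residual_nonempty[OF L] by (cases L) auto
      have v: "com_vars d \<subseteq> {..<n}" using residual_vars[OF L] n dK by auto
      have "length (snd (com_delta c q ss)) = n + 2 \<and> (\<forall>(a, d)\<in>set (snd (com_delta c q ss)). a < 3)"
        by (insert Some dK ss k v, cases d; simp add: case_prod_unfold; (intro conjI impI)?; (rule k')?; simp add: nth)
      then show ?thesis using step_delta[OF L] Some by simp
    qed
  qed
  moreover have "finite Q" "None \<in> Q" "Some [] \<notin> Q" "2 \<le> n + 2" "3 \<le> (3 :: nat)"
    using residual_nonempty finite_residuals by (auto simp: Q_def)
  ultimately obtain M where M: "tm_wf M"
    "\<And>x y t ts. (mstep Q (com_delta c) ^^ t) (None, init_tapes (n + 2) x) = (Some [], ts) \<Longrightarrow>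
      fst (ts ! 1) = tape_of y \<Longrightarrow> computes_within M x y t"
    using machine_exists[of Q None "Some []" "n + 2" 3 "com_delta c"] by metis
  have "computes_within M x w (Suc t)"
    if run: "(cstep x ^^ t) ([c], (\<lambda>_. 0, 0, [])) = ([], (\<sigma>, p, w))" for x t \<sigma> p w
  proof -
    have m: "(tape_of [])(0 := 1) = marked" by (auto simp: marked_def tape_of_def)
    have init: "mstep Q (com_delta c) (None, init_tapes (n + 2) x) = (Some [c], state_tapes x n (\<lambda>_. 0, 0, []))"
      by (simp add: Q_def init_tapes_def state_tapes_def m fun_upd_triv map_replicate_const
          zip_replicate del: One_nat_def)
    have sim: "(case (cstep x ^^ t) ([c], (\<lambda>_. 0, 0, [])) of (L, s) \<Rightarrow> L \<in> insert [] (residuals c []) \<and>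
      (mstep Q (com_delta c) ^^ t) (Some [c], state_tapes x n (\<lambda>_. 0, 0, [])) = (Some L, state_tapes x n s))" for t
    proof (induction t)
      case 0
      then show ?case by (simp add: self_residual)
    next
      case (Suc t)
      obtain L s where 1: "(cstep x ^^ t) ([c], (\<lambda>_. 0, 0, [])) = (L, s)" by (metis surj_pair)
      have IH: "L \<in> insert [] (residuals c [])"
        "(mstep Q (com_delta c) ^^ t) (Some [c], state_tapes x n (\<lambda>_. 0, 0, [])) = (Some L, state_tapes x n s)"
        using Suc 1 by auto
      show ?case
      proof (cases L)
        case Nil
        then show ?thesis using 1 IH \<open>Some [] \<notin> Q\<close> by simp
      next
        case (Cons d K)
        then have L: "L \<in> residuals c []" using IH(1) by simp
        have "com_vars d \<subseteq> {..<n}" using residual_vars[OF L] n Cons by auto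
        from com_delta_step[OF this, where ?c0.0 = c and K = K and x = x and s = s] have "mstep Q (com_delta c) (Some L, state_tapes x n s)
          = (case cstep x (L, s) of (L, s') \<Rightarrow> (Some L, state_tapes x n s'))"
          using L Cons by (simp add: Q_def Let_def case_prod_unfold)
        then show ?thesis using 1 IH residual_step[OF L, of x s] by (simp add: case_prod_unfold)
      qed
    qed
    have "(mstep Q (com_delta c) ^^ Suc t) (None, init_tapes (n + 2) x) = (Some [], state_tapes x n (\<sigma>, p, w))"
      using sim[of t] run init by (simp add: funpow_Suc_right del: funpow.simps)
    then show ?thesis by (rule M(2)) (simp add: state_tapes_def)
  qed
  with M(1) show ?thesis by (rule that)
qed

text \<open>The same number of steps works for every continuation \<open>K\<close>, which makes runs
  composable; only an upper bound for it is recorded.\<close>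

definition runs_in :: "bool list \<Rightarrow> com \<Rightarrow> cstate \<Rightarrow> nat \<Rightarrow> cstate \<Rightarrow> bool" where
  "runs_in x c s B s' \<longleftrightarrow> (\<exists>n \<le> B. \<forall>K. (cstep x ^^ n) (c # K, s) = (K, s'))"

lemma runs_in_mono: "runs_in x c s B s' \<Longrightarrow> B \<le> B' \<Longrightarrow> runs_in x c s B' s'"
  unfolding runs_in_def by (meson le_trans)

lemma runs_in_atom: "(\<And>K. cstep x (c # K, s) = (K, s')) \<Longrightarrow> runs_in x c s 1 s'"
  unfolding runs_in_def by (intro exI[of _ 1]) simp

lemma runs_in_Seq:
  assumes "runs_in x c s B s1" "runs_in x d s1 B' s2"
  shows "runs_in x (Seq c d) s (B + B' + 1) s2"
proof -
  obtain n n' where n: "n \<le> B" "\<forall>K. (cstep x ^^ n) (c # K, s) = (K, s1)"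
    "n' \<le> B'" "\<forall>K. (cstep x ^^ n') (d # K, s1) = (K, s2)"
    using assms unfolding runs_in_def by auto
  then have "(cstep x ^^ (n' + n + 1)) (Seq c d # K, s) = (K, s2)" for K
    by (simp add: funpow_add funpow_Suc_right del: funpow.simps)
  then show ?thesis unfolding runs_in_def using n by (intro exI[of _ "n' + n + 1"]) auto
qed

lemma runs_in_While_0: "fst s v = 0 \<Longrightarrow> runs_in x (While v c) s 1 s"
  by (cases s, rule runs_in_atom) simp

lemma runs_in_While_Suc:
  assumes "fst s v > 0" "runs_in x c s B s1" "runs_in x (While v c) s1 B' s2"
  shows "runs_in x (While v c) s (B + B' + 1) s2"
proof -
  obtain n n' where n: "n \<le> B" "\<forall>K. (cstep x ^^ n) (c # K, s) = (K, s1)"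
    "n' \<le> B'" "\<forall>K. (cstep x ^^ n') (While v c # K, s1) = (K, s2)"
    using assms unfolding runs_in_def by auto
  then have "(cstep x ^^ (n' + n + 1)) (While v c # K, s) = (K, s2)" for K
    using assms(1) by (cases s) (simp add: funpow_add funpow_Suc_right del: funpow.simps)
  then show ?thesis unfolding runs_in_def using n by (intro exI[of _ "n' + n + 1"]) auto
qed

text \<open>\<open>S j\<close> is the state after \<open>j\<close> iterations, so a loop is verified
  by giving its trajectory in closed form.\<close>

lemma runs_in_loop:
  assumes "\<And>j. j < N \<Longrightarrow> fst (S j) v > 0 \<and> runs_in x c (S j) B (S (Suc j))" "fst (S N) v = 0"
    "s0 = S 0" "s1 = S N"
  shows "runs_in x (While v c) s0 (N * (B + 1) + 1) s1"
proof -
  have "k \<le> N \<Longrightarrow> runs_in x (While v c) (S (N - k)) (k * (B + 1) + 1) (S N)" for k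
  proof (induction k)
    case 0
    then show ?case using runs_in_While_0[of "S N" v x c] assms(2) by simp
  next
    case (Suc k)
    then have "runs_in x c (S (N - Suc k)) B (S (N - k))" "fst (S (N - Suc k)) v > 0"
      using assms(1)[of "N - Suc k"] by (auto simp: Suc_diff_Suc)
    from runs_in_While_Suc[OF this(2,1) Suc.IH] Suc.prems show ?case
      by (auto elim: runs_in_mono)
  qed
  from this[of N] show ?thesis using assms by simp
qed

lemma runs_in_Inc: "runs_in x (Inc v) (\<sigma>, p, w) 1 (\<sigma>(v := Suc (\<sigma> v)), p, w)"
  and runs_in_Dec: "runs_in x (Dec v) (\<sigma>, p, w) 1 (\<sigma>(v := \<sigma> v - 1), p, w)"
  and runs_in_InRight: "runs_in x InRight (\<sigma>, p, w) 1 (\<sigma>, p + 1, w)"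
  and runs_in_InLeft: "runs_in x InLeft (\<sigma>, p, w) 1 (\<sigma>, p - 1, w)"
  and runs_in_AddIn: "runs_in x (AddIn b v) (\<sigma>, p, w) 1
    (\<sigma>(v := \<sigma> v + of_bool (in_test b (tape_of x p))), p, w)"
  and runs_in_Emit: "runs_in x (Emit v) (\<sigma>, p, w) 1 (\<sigma>, p, w @ [\<sigma> v > 0])"
  by (rule runs_in_atom; simp)+

lemma runs_in_conv:
  "runs_in x c s B s' \<Longrightarrow> s = s0 \<Longrightarrow> s' = s1 \<Longrightarrow> B \<le> B' \<Longrightarrow> runs_in x c s0 B' s1"
  using runs_in_mono by blast

definition polyb :: "(nat \<Rightarrow> nat) \<Rightarrow> bool" where
  "polyb f \<longleftrightarrow> (\<exists>c. \<forall>m. f m \<le> (m + 2) ^ c)"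

text \<open>The base \<open>m + 2\<close> rather than \<open>m\<close> makes powers grow for every
  \<open>m\<close>, so that a single exponent can also absorb constants and factors.\<close>

lemma le_two_power: "(n :: nat) \<le> (m + 2) ^ n"
proof -
  have "n \<le> 2 ^ n" by (simp add: less_imp_le)
  also have "\<dots> \<le> (m + 2) ^ n" by (intro power_mono) auto
  finally show ?thesis .
qed

lemma polyb_const: "polyb (\<lambda>_. n)"
  unfolding polyb_def using le_two_power by blast

lemma polyb_id: "polyb (\<lambda>m. m)"
  unfolding polyb_def by (intro exI[of _ 1]) simp

lemma polyb_mult:
  assumes "polyb f" "polyb g" shows "polyb (\<lambda>m. f m * g m)"
proof -
  obtain a b where "\<forall>m. f m \<le> (m + 2) ^ a" "\<forall>m. g m \<le> (m + 2) ^ b"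
    using assms unfolding polyb_def by blast
  then have "f m * g m \<le> (m + 2) ^ (a + b)" for m
    by (simp add: power_add mult_mono)
  then show ?thesis unfolding polyb_def by blast
qed

lemma polyb_add:
  assumes "polyb f" "polyb g" shows "polyb (\<lambda>m. f m + g m)"
proof -
  obtain a b where ab: "\<forall>m. f m \<le> (m + 2) ^ a" "\<forall>m. g m \<le> (m + 2) ^ b"
    using assms unfolding polyb_def by blast
  have "f m + g m \<le> (m + 2) ^ (a + b + 1)" for m
  proof -
    have "(m + 2) ^ a \<le> (m + 2) ^ (a + b)" "(m + 2) ^ b \<le> (m + 2) ^ (a + b)"
      by (intro power_increasing; simp)+
    then have "f m + g m \<le> 2 * (m + 2) ^ (a + b)"
      using ab(1)[rule_format, of m] ab(2)[rule_format, of m] by linarith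
    also have "\<dots> \<le> (m + 2) * (m + 2) ^ (a + b)" by (intro mult_right_mono) auto
    finally show ?thesis by simp
  qed
  then show ?thesis unfolding polyb_def by blast
qed

lemma polyb_comp:
  assumes "polyb f" "polyb g" shows "polyb (\<lambda>m. f (g m))"
proof -
  obtain a b where ab: "\<forall>m. f m \<le> (m + 2) ^ a" "\<forall>m. g m \<le> (m + 2) ^ b"
    using assms unfolding polyb_def by blast
  have "polyb (\<lambda>m. g m + 2)" by (intro polyb_add polyb_const assms)
  then obtain c where c: "\<forall>m. g m + 2 \<le> (m + 2) ^ c" unfolding polyb_def by blast
  have "f (g m) \<le> (m + 2) ^ (c * a)" for m
    using ab(1)[rule_format, of "g m"] power_mono[OF c[rule_format, of m], of a]
    by (simp add: power_mult)
  then show ?thesis unfolding polyb_def by blast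
qed

lemmas polyb_intros = polyb_const polyb_id polyb_mult polyb_add

section \<open>Arithmetical terms with bounded sums\<close>

text \<open>Variables are de Bruijn indices: \<open>TSum a b\<close> is the sum of \<open>b\<close> over all values of variable \<open>0\<close> below \<open>a\<close>.\<close>

datatype trm = TConst nat | TVar nat | TAdd trm trm | TMul trm trm | TMon trm trm | TSum trm trm
  | TBit trm | TLen

fun eval :: "bool list \<Rightarrow> (nat \<Rightarrow> nat) \<Rightarrow> trm \<Rightarrow> nat" where
  "eval x e (TConst n) = n"
| "eval x e (TVar i) = e i"
| "eval x e (TAdd a b) = eval x e a + eval x e b"
| "eval x e (TMul a b) = eval x e a * eval x e b"
| "eval x e (TMon a b) = eval x e a - eval x e b"
| "eval x e (TSum a b) = (\<Sum>i < eval x e a. eval x (case_nat i e) b)"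
| "eval x e (TBit a) = of_bool (eval x e a < length x \<and> x ! eval x e a)"
| "eval x e TLen = length x"

text \<open>\<open>Dec f\<close> acts as a skip command, as counter \<open>f\<close> is zero and
  decrementing truncates.\<close>

fun incs :: "nat \<Rightarrow> nat \<Rightarrow> nat \<Rightarrow> com" where
  "incs f t 0 = Dec f"
| "incs f t (Suc n) = Seq (Inc t) (incs f t n)"

text \<open>
  \<open>term_code \<rho> f a t\<close> adds the value of \<open>a\<close> to counter \<open>t\<close>, where variable \<open>i\<close> is kept in counter \<open>\<rho> i\<close>
  and the counters from \<open>f\<close> on are zero before and afterwards.
\<close>

fun term_code :: "(nat \<Rightarrow> nat) \<Rightarrow> nat \<Rightarrow> trm \<Rightarrow> nat \<Rightarrow> com" where
  "term_code \<rho> f (TConst n) t = incs f t n"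
| "term_code \<rho> f (TVar i) t =
     Seq (While (\<rho> i) (Seq (Dec (\<rho> i)) (Seq (Inc t) (Inc f)))) (While f (Seq (Dec f) (Inc (\<rho> i))))"
| "term_code \<rho> f (TAdd a b) t = Seq (term_code \<rho> f a t) (term_code \<rho> f b t)"
| "term_code \<rho> f (TMul a b) t =
     Seq (term_code \<rho> (f + 1) a f) (While f (Seq (Dec f) (term_code \<rho> (f + 1) b t)))"
| "term_code \<rho> f (TMon a b) t =
     Seq (term_code \<rho> (f + 2) a f) (Seq (term_code \<rho> (f + 2) b (f + 1))
       (Seq (While (f + 1) (Seq (Dec (f + 1)) (Dec f))) (While f (Seq (Dec f) (Inc t)))))"
| "term_code \<rho> f (TSum a b) t =
     Seq (term_code \<rho> (f + 2) a f)
       (Seq (While f (Seq (Dec f) (Seq (term_code (case_nat (f + 1) \<rho>) (f + 2) b t) (Inc (f + 1)))))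
         (While (f + 1) (Dec (f + 1))))"
| "term_code \<rho> f (TBit a) t =
     Seq (term_code \<rho> (f + 2) a f)
       (Seq (While f (Seq (Dec f) (Seq InRight (Inc (f + 1)))))
         (Seq (AddIn True t) (While (f + 1) (Seq (Dec (f + 1)) InLeft))))"
| "term_code \<rho> f TLen t =
     Seq (AddIn False f)
       (Seq (While f (Seq (Dec f) (Seq InRight (Seq (Inc t) (Seq (Inc (f + 1)) (AddIn False f))))))
         (While (f + 1) (Seq (Dec (f + 1)) InLeft)))"

text \<open>Inside a sum the index joins the environment, so the bound \<open>m\<close> grows to
  \<open>m + A m\<close>. The nesting depth is fixed by the term, hence finitely many polynomial
  bounds are composed.\<close>

lemma eval_polyb:
  "\<exists>B. polyb B \<and> (\<forall>x e m. length x \<le> m \<longrightarrow> (\<forall>i. e i \<le> m) \<longrightarrow> eval x e u \<le> B m)"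
proof (induction u)
  case (TConst n)
  then show ?case by (intro exI[of _ "\<lambda>_. n"]) (simp add: polyb_intros)
next
  case (TVar i)
  then show ?case by (intro exI[of _ "\<lambda>m. m"]) (simp add: polyb_intros)
next
  case (TAdd a b)
  then obtain A B where A: "polyb A" "\<And>x e m. length x \<le> m \<Longrightarrow> (\<forall>i. e i \<le> m) \<Longrightarrow> eval x e a \<le> A m"
    and B: "polyb B" "\<And>x e m. length x \<le> m \<Longrightarrow> (\<forall>i. e i \<le> m) \<Longrightarrow> eval x e b \<le> B m" by blast
  show ?case
    by (intro exI[of _ "\<lambda>m. A m + B m"]) (auto intro!: polyb_intros add_mono A B)
next
  case (TMul a b)
  then obtain A B where A: "polyb A" "\<And>x e m. length x \<le> m \<Longrightarrow> (\<forall>i. e i \<le> m) \<Longrightarrow> eval x e a \<le> A m"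
    and B: "polyb B" "\<And>x e m. length x \<le> m \<Longrightarrow> (\<forall>i. e i \<le> m) \<Longrightarrow> eval x e b \<le> B m" by blast
  show ?case
    by (intro exI[of _ "\<lambda>m. A m * B m"]) (auto intro!: polyb_intros mult_mono A B)
next
  case (TMon a b)
  then obtain A where A: "polyb A" "\<And>x e m. length x \<le> m \<Longrightarrow> (\<forall>i. e i \<le> m) \<Longrightarrow> eval x e a \<le> A m" by blast
  show ?case
    by (intro exI[of _ A]) (auto intro: A(1) le_trans[OF diff_le_self A(2)])
next
  case (TSum a b)
  then obtain A B where A: "polyb A" "\<And>x e m. length x \<le> m \<Longrightarrow> (\<forall>i. e i \<le> m) \<Longrightarrow> eval x e a \<le> A m"
    and B: "polyb B" "\<And>x e m. length x \<le> m \<Longrightarrow> (\<forall>i. e i \<le> m) \<Longrightarrow> eval x e b \<le> B m" by blast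
  have "eval x e (TSum a b) \<le> A m * B (m + A m)" if x: "length x \<le> m" and e: "\<forall>i. e i \<le> m" for x e m
  proof -
    have "eval x (case_nat i e) b \<le> B (m + A m)" if "i < eval x e a" for i
      using that A(2)[OF x e] x e by (intro B(2)) (auto split: nat.splits intro: trans_le_add1)
    then have "eval x e (TSum a b) \<le> eval x e a * B (m + A m)"
      using sum_bounded_above[of "{..<eval x e a}" "\<lambda>i. eval x (case_nat i e) b" "B (m + A m)"] by simp
    also have "\<dots> \<le> A m * B (m + A m)" using A(2)[OF x e] by simp
    finally show ?thesis .
  qed
  moreover have "polyb (\<lambda>m. A m * B (m + A m))"
    by (intro polyb_intros A polyb_comp[OF B(1)])
  ultimately show ?case by blast
next
  case (TBit a)
  then show ?case by (intro exI[of _ "\<lambda>_. 1"]) (simp add: polyb_intros)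
next
  case TLen
  then show ?case by (intro exI[of _ "\<lambda>m. m"]) (simp add: polyb_intros)
qed

section \<open>Correctness and running time of the code of terms\<close>

lemma fun_upd_comp_other: "(\<And>i. \<rho> i \<noteq> t) \<Longrightarrow> \<sigma>(t := a) \<circ> \<rho> = \<sigma> \<circ> \<rho>"
  by auto

lemma runs_in_incs: "\<sigma> f = 0 \<Longrightarrow> f \<noteq> t \<Longrightarrow> runs_in x (incs f t n) (\<sigma>, p, w) (2 * n + 1) (\<sigma>(t := \<sigma> t + n), p, w)"
proof (induction n arbitrary: \<sigma>)
  case 0
  then show ?case using runs_in_Dec[of x f \<sigma> p w] by (simp add: fun_upd_idem)
next
  case (Suc n)
  show ?case unfolding incs.simps
    by (rule runs_in_conv[OF runs_in_Seq[OF runs_in_Inc Suc.IH[of "\<sigma>(t := Suc (\<sigma> t))"]]])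
      (use Suc.prems in auto)
qed

text \<open>Here \<open>m\<close> bounds both the length of the input and the values of the
  variables, and \<open>T\<close> is the time bound. The input head starts and ends at cell
  \<open>0\<close>, so pieces of code can be put in sequence.\<close>

definition code_ok :: "(nat \<Rightarrow> nat) \<Rightarrow> trm \<Rightarrow> bool" where
  "code_ok T u \<longleftrightarrow> (\<forall>x m \<rho> f t \<sigma> w. length x \<le> m \<longrightarrow> (\<forall>i. \<rho> i < f \<and> \<rho> i \<noteq> t) \<longrightarrow> t < f \<longrightarrow>
     (\<forall>v \<ge> f. \<sigma> v = 0) \<longrightarrow> (\<forall>i. \<sigma> (\<rho> i) \<le> m) \<longrightarrow>
     runs_in x (term_code \<rho> f u t) (\<sigma>, 0, w) (T m) (\<sigma>(t := \<sigma> t + eval x (\<sigma> \<circ> \<rho>) u), 0, w))"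

lemma code_okD:
  assumes "code_ok T u" "length x \<le> m" "\<And>i. \<rho> i < f" "\<And>i. \<rho> i \<noteq> t" "t < f" "\<And>v. v \<ge> f \<Longrightarrow> \<sigma> v = 0"
    "\<And>i. \<sigma> (\<rho> i) \<le> m" "e = \<sigma> \<circ> \<rho>"
  shows "runs_in x (term_code \<rho> f u t) (\<sigma>, 0, w) (T m) (\<sigma>(t := \<sigma> t + eval x e u), 0, w)"
  using assms unfolding code_ok_def by blast

lemma code_okI:
  assumes "\<And>x m \<rho> f t \<sigma> w. length x \<le> m \<Longrightarrow> (\<And>i. \<rho> i < f) \<Longrightarrow> (\<And>i. \<rho> i \<noteq> t) \<Longrightarrow> t < f \<Longrightarrow>
     (\<And>v. v \<ge> f \<Longrightarrow> \<sigma> v = 0) \<Longrightarrow> (\<And>i. \<sigma> (\<rho> i) \<le> m) \<Longrightarrow>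
     runs_in x (term_code \<rho> f u t) (\<sigma>, 0, w) (T m) (\<sigma>(t := \<sigma> t + eval x (\<sigma> \<circ> \<rho>) u), 0, w)"
  shows "code_ok T u"
  using assms unfolding code_ok_def by blast

lemma code_ok_TVar: "code_ok (\<lambda>m. 10 * m + 3) (TVar i)"
proof (rule code_okI)
  fix x w :: "bool list" and m f t :: nat and \<rho> \<sigma> :: "nat \<Rightarrow> nat"
  assume a: "\<And>i. \<rho> i < f" "\<And>i. \<rho> i \<noteq> t" "t < f" "\<And>v. v \<ge> f \<Longrightarrow> \<sigma> v = 0" "\<And>i. \<sigma> (\<rho> i) \<le> (m :: nat)"
  let ?v = "\<rho> i" let ?n = "\<sigma> ?v"
  have ne: "?v \<noteq> f" "?v \<noteq> t" "f \<noteq> t" "f \<noteq> ?v" "t \<noteq> ?v" "t \<noteq> f" "\<sigma> f = 0" using a(1)[of i] a(2)[of i] a(3,4) by auto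
  let ?S = "\<lambda>j. (\<sigma>(?v := ?n - j, t := \<sigma> t + j, f := j), 0 :: int, w)"
  \<comment> \<open>Reading a counter destroys it; therefore its value is also copied to
    \<open>f\<close>, and the second loop restores it from there.\<close>
  let ?S' = "\<lambda>j. (\<sigma>(?v := j, t := \<sigma> t + ?n, f := ?n - j), 0 :: int, w)"
  have 1: "runs_in x (While ?v (Seq (Dec ?v) (Seq (Inc t) (Inc f)))) (\<sigma>, 0, w) (?n * (5 + 1) + 1) (?S ?n)"
  proof (rule runs_in_loop[where S = ?S])
    fix j assume "j < ?n"
    then show "0 < fst (?S j) ?v \<and> runs_in x (Seq (Dec ?v) (Seq (Inc t) (Inc f))) (?S j) 5 (?S (Suc j))"
      by (intro conjI runs_in_conv[OF runs_in_Seq[OF runs_in_Dec runs_in_Seq[OF runs_in_Inc runs_in_Inc]]], simp_all only:)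
        (use ne in \<open>auto simp: fun_eq_iff\<close>)
  qed (use ne in \<open>auto simp: fun_eq_iff\<close>)
  have 2: "runs_in x (While f (Seq (Dec f) (Inc ?v))) (?S ?n) (?n * (3 + 1) + 1) (\<sigma>(t := \<sigma> t + ?n), 0, w)"
  proof (rule runs_in_loop[where S = ?S'])
    fix j assume "j < ?n"
    then show "0 < fst (?S' j) f \<and> runs_in x (Seq (Dec f) (Inc ?v)) (?S' j) 3 (?S' (Suc j))"
      by (intro conjI runs_in_conv[OF runs_in_Seq[OF runs_in_Dec runs_in_Inc]], simp_all only:)
        (use ne in \<open>auto simp: fun_eq_iff\<close>)
  qed (use ne in \<open>auto simp: fun_eq_iff\<close>)
  show "runs_in x (term_code \<rho> f (TVar i) t) (\<sigma>, 0, w) (10 * m + 3) (\<sigma>(t := \<sigma> t + eval x (\<sigma> \<circ> \<rho>) (TVar i)), 0, w)"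
    unfolding term_code.simps
    by (rule runs_in_conv[OF runs_in_Seq[OF 1 2]]) (use a(5)[of i] in auto)
qed

lemma code_ok_TMul:
  assumes A: "code_ok Ta a" and B: "code_ok Tb b"
    and bd: "\<And>x e m. length x \<le> m \<Longrightarrow> (\<forall>i. e i \<le> m) \<Longrightarrow> eval x e a \<le> Ba m"
  shows "code_ok (\<lambda>m. Ta m + (Ba m * (Tb m + 3) + 1) + 1) (TMul a b)"
proof (rule code_okI)
  fix x w :: "bool list" and m f t :: nat and \<rho> \<sigma> :: "nat \<Rightarrow> nat"
  assume h: "length x \<le> m" "\<And>i. \<rho> i < f" "\<And>i. \<rho> i \<noteq> t" "t < f" "\<And>v. v \<ge> f \<Longrightarrow> \<sigma> v = 0" "\<And>i. \<sigma> (\<rho> i) \<le> (m :: nat)"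
  define n k where "n = eval x (\<sigma> \<circ> \<rho>) a" and "k = eval x (\<sigma> \<circ> \<rho>) b"
  have ne: "f \<noteq> t" "t \<noteq> f" "\<sigma> f = 0" "\<And>i. \<rho> i \<noteq> f" using h(2-5) by (auto simp: less_le)
  have n: "n \<le> Ba m" unfolding n_def using h by (intro bd) auto
  have 1: "runs_in x (term_code \<rho> (f + 1) a f) (\<sigma>, 0, w) (Ta m) (\<sigma>(f := n), 0, w)"
    by (rule runs_in_conv[OF code_okD[OF A, of x m \<rho> "f + 1" f \<sigma> "\<sigma> \<circ> \<rho>" w]])
      (use h ne in \<open>auto simp: n_def less_Suc_eq\<close>)
  let ?S = "\<lambda>j. (\<sigma>(f := n - j, t := \<sigma> t + j * k), 0 :: int, w)"
  have 2: "runs_in x (While f (Seq (Dec f) (term_code \<rho> (f + 1) b t))) (\<sigma>(f := n), 0, w)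
    (n * (Tb m + 2 + 1) + 1) (\<sigma>(t := \<sigma> t + n * k), 0, w)"
  proof (rule runs_in_loop[where S = ?S])
    fix j assume j: "j < n"
    let ?\<sigma> = "\<sigma>(f := n - Suc j, t := \<sigma> t + j * k)"
    have "runs_in x (term_code \<rho> (f + 1) b t) (?\<sigma>, 0, w) (Tb m) (?\<sigma>(t := ?\<sigma> t + k), 0, w)"
      unfolding k_def
      by (rule code_okD[OF B]) (use h ne in \<open>auto simp: less_Suc_eq fun_upd_comp_other\<close>)
    from runs_in_Seq[OF runs_in_Dec[of x f "\<sigma>(f := n - j, t := \<sigma> t + j * k)" 0 w]] this
    have "runs_in x (Seq (Dec f) (term_code \<rho> (f + 1) b t)) (?S j) (1 + Tb m + 1) (?\<sigma>(t := ?\<sigma> t + k), 0, w)"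
      using ne by (simp add: fun_upd_twist)
    then show "0 < fst (?S j) f \<and> runs_in x (Seq (Dec f) (term_code \<rho> (f + 1) b t)) (?S j) (Tb m + 2) (?S (Suc j))"
      using j ne by (auto elim!: runs_in_conv simp: fun_eq_iff)
  qed (use ne in \<open>auto simp: fun_eq_iff\<close>)
  have "n * (Tb m + 2 + 1) \<le> Ba m * (Tb m + 3)" using n by (intro mult_mono) auto
  then show "runs_in x (term_code \<rho> f (TMul a b) t) (\<sigma>, 0, w) (Ta m + (Ba m * (Tb m + 3) + 1) + 1)
     (\<sigma>(t := \<sigma> t + eval x (\<sigma> \<circ> \<rho>) (TMul a b)), 0, w)"
    unfolding term_code.simps
    by (intro runs_in_conv[OF runs_in_Seq[OF 1 2]]) (use n in \<open>auto simp: n_def k_def\<close>)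
qed

lemma code_ok_TMon:
  assumes A: "code_ok Ta a" and B: "code_ok Tb b"
    and bd: "\<And>x e m. length x \<le> m \<Longrightarrow> (\<forall>i. e i \<le> m) \<Longrightarrow> eval x e a \<le> Ba m"
    and bd': "\<And>x e m. length x \<le> m \<Longrightarrow> (\<forall>i. e i \<le> m) \<Longrightarrow> eval x e b \<le> Bb m"
  shows "code_ok (\<lambda>m. Ta m + Tb m + 4 * Ba m + 4 * Bb m + 5) (TMon a b)"
proof (rule code_okI)
  fix x w :: "bool list" and m f t :: nat and \<rho> \<sigma> :: "nat \<Rightarrow> nat"
  assume h: "length x \<le> m" "\<And>i. \<rho> i < f" "\<And>i. \<rho> i \<noteq> t" "t < f" "\<And>v. v \<ge> f \<Longrightarrow> \<sigma> v = 0" "\<And>i. \<sigma> (\<rho> i) \<le> m"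
  define n k where "n = eval x (\<sigma> \<circ> \<rho>) a" and "k = eval x (\<sigma> \<circ> \<rho>) b"
  have ne: "f \<noteq> t" "t \<noteq> f" "\<sigma> f = 0" "\<And>i. \<rho> i \<noteq> f" "t \<noteq> Suc f" "Suc f \<noteq> t" "\<sigma> (Suc f) = 0" "\<And>i. \<rho> i \<noteq> Suc f"
    using h(2-5) by (auto simp: less_le) (metis Suc_n_not_le_n less_imp_le_nat less_Suc_eq not_less_eq)+
  have lt: "\<And>i. \<rho> i < Suc (Suc f)" using h(2) less_SucI by blast
  have n: "n \<le> Ba m" "k \<le> Bb m" unfolding n_def k_def using h by (auto intro: bd bd')
  have 1: "runs_in x (term_code \<rho> (f + 2) a f) (\<sigma>, 0, w) (Ta m) (\<sigma>(f := n), 0, w)"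
    by (rule runs_in_conv[OF code_okD[OF A, of x m \<rho> "f + 2" f \<sigma> "\<sigma> \<circ> \<rho>" w]])
      (use h ne lt in \<open>auto simp: n_def\<close>)
  have 2: "runs_in x (term_code \<rho> (f + 2) b (f + 1)) (\<sigma>(f := n), 0, w) (Tb m) (\<sigma>(f := n, f + 1 := k), 0, w)"
    by (rule runs_in_conv[OF code_okD[OF B, of x m \<rho> "f + 2" "f + 1" "\<sigma>(f := n)" "\<sigma> \<circ> \<rho>" w]])
      (use h ne lt in \<open>auto simp: k_def fun_upd_comp_other\<close>)
  let ?S = "\<lambda>j. (\<sigma>(f := n - j, f + 1 := k - j), 0 :: int, w)"
  have 3: "runs_in x (While (f + 1) (Seq (Dec (f + 1)) (Dec f))) (\<sigma>(f := n, f + 1 := k), 0, w)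
    (k * (3 + 1) + 1) (\<sigma>(f := n - k), 0, w)"
  proof (rule runs_in_loop[where S = ?S])
    fix j assume "j < k"
    then show "0 < fst (?S j) (f + 1) \<and> runs_in x (Seq (Dec (f + 1)) (Dec f)) (?S j) 3 (?S (Suc j))"
      by (intro conjI runs_in_conv[OF runs_in_Seq[OF runs_in_Dec runs_in_Dec]], simp_all only:)
        (use ne in \<open>auto simp: fun_eq_iff\<close>)
  qed (use ne in \<open>auto simp: fun_eq_iff\<close>)
  let ?S' = "\<lambda>j. (\<sigma>(f := n - k - j, t := \<sigma> t + j), 0 :: int, w)"
  have 4: "runs_in x (While f (Seq (Dec f) (Inc t))) (\<sigma>(f := n - k), 0, w)
    ((n - k) * (3 + 1) + 1) (\<sigma>(t := \<sigma> t + (n - k)), 0, w)"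
  proof (rule runs_in_loop[where S = ?S'])
    fix j assume "j < n - k"
    then show "0 < fst (?S' j) f \<and> runs_in x (Seq (Dec f) (Inc t)) (?S' j) 3 (?S' (Suc j))"
      by (intro conjI runs_in_conv[OF runs_in_Seq[OF runs_in_Dec runs_in_Inc]], simp_all only:)
        (use ne in \<open>auto simp: fun_eq_iff\<close>)
  qed (use ne in \<open>auto simp: fun_eq_iff\<close>)
  show "runs_in x (term_code \<rho> f (TMon a b) t) (\<sigma>, 0, w) (Ta m + Tb m + 4 * Ba m + 4 * Bb m + 5)
     (\<sigma>(t := \<sigma> t + eval x (\<sigma> \<circ> \<rho>) (TMon a b)), 0, w)"
    unfolding term_code.simps
    by (rule runs_in_conv[OF runs_in_Seq[OF 1 runs_in_Seq[OF 2 runs_in_Seq[OF 3 4]]]])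
      (use n in \<open>auto simp: n_def k_def\<close>)
qed

lemma code_ok_TSum:
  assumes A: "code_ok Ta a" and B: "code_ok Tb b"
    and bd: "\<And>x e m. length x \<le> m \<Longrightarrow> (\<forall>i. e i \<le> m) \<Longrightarrow> eval x e a \<le> Ba m"
  shows "code_ok (\<lambda>m. Ta m + Ba m * (Tb (m + Ba m) + 5) + 2 * Ba m + 4) (TSum a b)"
proof (rule code_okI)
  fix x w :: "bool list" and m f t :: nat and \<rho> \<sigma> :: "nat \<Rightarrow> nat"
  assume h: "length x \<le> m" "\<And>i. \<rho> i < f" "\<And>i. \<rho> i \<noteq> t" "t < f" "\<And>v. v \<ge> f \<Longrightarrow> \<sigma> v = 0" "\<And>i. \<sigma> (\<rho> i) \<le> m"
  define n k where "n = eval x (\<sigma> \<circ> \<rho>) a" and "k i = eval x (case_nat i (\<sigma> \<circ> \<rho>)) b" for i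
  have ne: "f \<noteq> t" "t \<noteq> f" "\<sigma> f = 0" "\<And>i. \<rho> i \<noteq> f" "t \<noteq> Suc f" "Suc f \<noteq> t" "\<sigma> (Suc f) = 0" "\<And>i. \<rho> i \<noteq> Suc f"
    using h(2-5) by (auto simp: less_le) (metis Suc_n_not_le_n less_imp_le_nat less_Suc_eq not_less_eq)+
  have lt: "\<And>i. \<rho> i < Suc (Suc f)" using h(2) less_SucI by blast
  have n: "n \<le> Ba m" unfolding n_def using h by (auto intro: bd)
  have 1: "runs_in x (term_code \<rho> (f + 2) a f) (\<sigma>, 0, w) (Ta m) (\<sigma>(f := n), 0, w)"
    by (rule runs_in_conv[OF code_okD[OF A, of x m \<rho> "f + 2" f \<sigma> "\<sigma> \<circ> \<rho>" w]])
      (use h ne lt in \<open>auto simp: n_def\<close>)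
  \<comment> \<open>Counter \<open>f\<close> counts the remaining summands down, and
    \<open>f + 1\<close> counts up and is itself the bound variable of the sum.\<close>
  let ?S = "\<lambda>j. (\<sigma>(f := n - j, f + 1 := j, t := \<sigma> t + sum k {..<j}), 0 :: int, w)"
  let ?body = "Seq (Dec f) (Seq (term_code (case_nat (f + 1) \<rho>) (f + 2) b t) (Inc (f + 1)))"
  have 2: "runs_in x (While f ?body) (\<sigma>(f := n), 0, w) (n * (Tb (m + Ba m) + 4 + 1) + 1) (?S n)"
  proof (rule runs_in_loop[where S = ?S])
    fix j assume j: "j < n"
    let ?\<sigma> = "\<sigma>(f := n - Suc j, f + 1 := j, t := \<sigma> t + sum k {..<j})"
    have env: "case_nat j (\<sigma> \<circ> \<rho>) = ?\<sigma> \<circ> case_nat (f + 1) \<rho>"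
      using ne h(3) by (auto simp: fun_eq_iff split: nat.splits)
    have "runs_in x (term_code (case_nat (f + 1) \<rho>) (f + 2) b t) (?\<sigma>, 0, w) (Tb (m + Ba m)) (?\<sigma>(t := ?\<sigma> t + eval x (case_nat j (\<sigma> \<circ> \<rho>)) b), 0, w)"
    proof (rule code_okD[OF B])
      show "?\<sigma> (case_nat (f + 1) \<rho> i) \<le> m + Ba m" for i
        using ne h(3,6) j n by (auto split: nat.splits intro: trans_le_add1)
    qed (use h ne lt env in \<open>auto split: nat.splits\<close>)
    from runs_in_Seq[OF runs_in_Dec[of x f "\<sigma>(f := n - j, f + 1 := j, t := \<sigma> t + sum k {..<j})" 0 w]
        runs_in_Seq[OF runs_in_conv[OF this[folded k_def] _ refl order_refl] runs_in_Inc[of x "f + 1"]]]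
    have "runs_in x ?body (?S j) (1 + (Tb (m + Ba m) + 1 + 1) + 1)
      (?\<sigma>(t := ?\<sigma> t + k j, f + 1 := Suc ((?\<sigma>(t := ?\<sigma> t + k j)) (f + 1))), 0, w)"
      using ne by (simp add: fun_upd_twist)
    then show "0 < fst (?S j) f \<and> runs_in x ?body (?S j) (Tb (m + Ba m) + 4) (?S (Suc j))"
      using j ne by (auto elim!: runs_in_conv simp: fun_eq_iff)
  qed (use ne in \<open>auto simp: fun_eq_iff\<close>)
  let ?S' = "\<lambda>j. (\<sigma>(f + 1 := n - j, t := \<sigma> t + sum k {..<n}), 0 :: int, w)"
  have 3: "runs_in x (While (f + 1) (Dec (f + 1))) (?S n) (n * (1 + 1) + 1) (\<sigma>(t := \<sigma> t + sum k {..<n}), 0, w)"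
  proof (rule runs_in_loop[where S = ?S'])
    fix j assume "j < n"
    then show "0 < fst (?S' j) (f + 1) \<and> runs_in x (Dec (f + 1)) (?S' j) 1 (?S' (Suc j))"
      by (intro conjI runs_in_conv[OF runs_in_Dec], simp_all only:)
        (use ne in \<open>auto simp: fun_eq_iff\<close>)
  qed (use ne in \<open>auto simp: fun_eq_iff\<close>)
  have "n * (Tb (m + Ba m) + 4 + 1) \<le> Ba m * (Tb (m + Ba m) + 5)" using n by (intro mult_mono) auto
  then show "runs_in x (term_code \<rho> f (TSum a b) t) (\<sigma>, 0, w) (Ta m + Ba m * (Tb (m + Ba m) + 5) + 2 * Ba m + 4)
     (\<sigma>(t := \<sigma> t + eval x (\<sigma> \<circ> \<rho>) (TSum a b)), 0, w)"
    unfolding term_code.simps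
    by (intro runs_in_conv[OF runs_in_Seq[OF 1 runs_in_Seq[OF 2 3]]])
      (use n in \<open>auto simp: n_def k_def\<close>)
qed

lemma in_test_tape: "in_test True (tape_of x (int j)) \<longleftrightarrow> j < length x \<and> x ! j"
  "in_test False (tape_of x (int j)) \<longleftrightarrow> j < length x"
  by (auto simp: in_test_def tape_of_def)

lemma runs_in_return:
  assumes "v \<noteq> t" "\<sigma> v = 0"
  shows "runs_in x (While v (Seq (Dec v) InLeft)) (\<sigma>(v := n), int n, w) (n * (3 + 1) + 1) (\<sigma>, 0, w)"
proof (rule runs_in_loop[where S = "\<lambda>j. (\<sigma>(v := n - j), int n - int j, w)"])
  fix j assume "j < n"
  then show "0 < fst (\<sigma>(v := n - j), int n - int j, w) v \<and>
    runs_in x (Seq (Dec v) InLeft) (\<sigma>(v := n - j), int n - int j, w) 3 (\<sigma>(v := n - Suc j), int n - int (Suc j), w)"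
    by (intro conjI runs_in_conv[OF runs_in_Seq[OF runs_in_Dec runs_in_InLeft]], simp_all only:)
      (auto simp: fun_eq_iff)
qed (use assms in \<open>auto simp: fun_eq_iff\<close>)

lemma code_ok_TBit:
  assumes A: "code_ok Ta a"
    and bd: "\<And>x e m. length x \<le> m \<Longrightarrow> (\<forall>i. e i \<le> m) \<Longrightarrow> eval x e a \<le> Ba m"
  shows "code_ok (\<lambda>m. Ta m + 10 * Ba m + 6) (TBit a)"
proof (rule code_okI)
  fix x w :: "bool list" and m f t :: nat and \<rho> \<sigma> :: "nat \<Rightarrow> nat"
  assume h: "length x \<le> m" "\<And>i. \<rho> i < f" "\<And>i. \<rho> i \<noteq> t" "t < f" "\<And>v. v \<ge> f \<Longrightarrow> \<sigma> v = 0" "\<And>i. \<sigma> (\<rho> i) \<le> m"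
  define n where "n = eval x (\<sigma> \<circ> \<rho>) a"
  let ?t = "\<sigma> t + eval x (\<sigma> \<circ> \<rho>) (TBit a)"
  have ne: "f \<noteq> t" "t \<noteq> f" "\<sigma> f = 0" "\<And>i. \<rho> i \<noteq> f" "t \<noteq> Suc f" "Suc f \<noteq> t" "\<sigma> (Suc f) = 0"
    using h(2-5) by (auto simp: less_le)
  have lt: "\<And>i. \<rho> i < Suc (Suc f)" using h(2) less_SucI by blast
  have n: "n \<le> Ba m" unfolding n_def using h by (auto intro: bd)
  have 1: "runs_in x (term_code \<rho> (f + 2) a f) (\<sigma>, 0, w) (Ta m) (\<sigma>(f := n), 0, w)"
    by (rule runs_in_conv[OF code_okD[OF A, of x m \<rho> "f + 2" f \<sigma> "\<sigma> \<circ> \<rho>" w]])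
      (use h ne lt in \<open>auto simp: n_def\<close>)
  let ?S = "\<lambda>j. (\<sigma>(f := n - j, f + 1 := j), int j, w)"
  have 2: "runs_in x (While f (Seq (Dec f) (Seq InRight (Inc (f + 1))))) (\<sigma>(f := n), 0, w)
    (n * (5 + 1) + 1) (\<sigma>(f + 1 := n), int n, w)"
  proof (rule runs_in_loop[where S = ?S])
    fix j assume "j < n"
    then show "0 < fst (?S j) f \<and> runs_in x (Seq (Dec f) (Seq InRight (Inc (f + 1)))) (?S j) 5 (?S (Suc j))"
      by (intro conjI runs_in_conv[OF runs_in_Seq[OF runs_in_Dec runs_in_Seq[OF runs_in_InRight runs_in_Inc]]], simp_all only:)
        (use ne in \<open>auto simp: fun_eq_iff\<close>)
  qed (use ne in \<open>auto simp: fun_eq_iff\<close>)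
  have 3: "runs_in x (AddIn True t) (\<sigma>(f + 1 := n), int n, w) 1 ((\<sigma>(t := ?t))(f + 1 := n), int n, w)"
    by (rule runs_in_conv[OF runs_in_AddIn[of x True t "\<sigma>(f + 1 := n)"]])
      (use ne in \<open>auto simp: in_test_tape n_def fun_eq_iff\<close>)
  have 4: "runs_in x (While (f + 1) (Seq (Dec (f + 1)) InLeft)) ((\<sigma>(t := ?t))(f + 1 := n), int n, w)
    (n * (3 + 1) + 1) (\<sigma>(t := ?t), 0, w)"
    by (rule runs_in_return[of _ t]) (use ne in auto)
  show "runs_in x (term_code \<rho> f (TBit a) t) (\<sigma>, 0, w) (Ta m + 10 * Ba m + 6) (\<sigma>(t := ?t), 0, w)"
    unfolding term_code.simps
    by (rule runs_in_conv[OF runs_in_Seq[OF 1 runs_in_Seq[OF 2 runs_in_Seq[OF 3 4]]]]) (use n in auto)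
qed

lemma code_ok_TLen: "code_ok (\<lambda>m. 14 * m + 6) TLen"
proof (rule code_okI)
  fix x w :: "bool list" and m f t :: nat and \<rho> \<sigma> :: "nat \<Rightarrow> nat"
  assume h: "length x \<le> m" "\<And>i. \<rho> i < f" "\<And>i. \<rho> i \<noteq> t" "t < f" "\<And>v. v \<ge> f \<Longrightarrow> \<sigma> v = 0" "\<And>i. \<sigma> (\<rho> i) \<le> m"
  define n where "n = length x"
  have ne: "f \<noteq> t" "t \<noteq> f" "\<sigma> f = 0" "t \<noteq> Suc f" "Suc f \<noteq> t" "\<sigma> (Suc f) = 0" using h(2-5) by auto
  \<comment> \<open>Counter \<open>f\<close> is a flag saying whether the current cell belongs to
    the input, and \<open>f + 1\<close> remembers the distance for the way back.\<close>
  let ?S = "\<lambda>j. (\<sigma>(f := of_bool (j < n), f + 1 := j, t := \<sigma> t + j), int j, w)"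
  have 1: "runs_in x (AddIn False f) (\<sigma>, 0, w) 1 (\<sigma>(f := of_bool (0 < n)), 0, w)"
    by (rule runs_in_conv[OF runs_in_AddIn])
      (use ne in_test_tape(2)[of x 0] in \<open>auto simp: fun_eq_iff n_def\<close>)
  let ?body = "Seq (Dec f) (Seq InRight (Seq (Inc t) (Seq (Inc (f + 1)) (AddIn False f))))"
  have 2: "runs_in x (While f ?body) (\<sigma>(f := of_bool (0 < n)), 0, w) (n * (9 + 1) + 1) ((\<sigma>(t := \<sigma> t + n))(f + 1 := n), int n, w)"
  proof (rule runs_in_loop[where S = ?S])
    fix j assume "j < n"
    then show "0 < fst (?S j) f \<and> runs_in x ?body (?S j) 9 (?S (Suc j))"
      by (intro conjI runs_in_conv[OF runs_in_Seq[OF runs_in_Dec runs_in_Seq[OF runs_in_InRight runs_in_Seq[OF runs_in_Inc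
          runs_in_Seq[OF runs_in_Inc runs_in_AddIn]]]]], simp_all only:)
        (use ne in_test_tape(2)[of x "Suc j"] in \<open>auto simp: fun_eq_iff n_def add.commute\<close>)
  qed (use ne in \<open>auto simp: fun_eq_iff\<close>)
  have 3: "runs_in x (While (f + 1) (Seq (Dec (f + 1)) InLeft)) ((\<sigma>(t := \<sigma> t + n))(f + 1 := n), int n, w)
    (n * (3 + 1) + 1) (\<sigma>(t := \<sigma> t + n), 0, w)"
    by (rule runs_in_return[of _ t]) (use ne in auto)
  show "runs_in x (term_code \<rho> f TLen t) (\<sigma>, 0, w) (14 * m + 6) (\<sigma>(t := \<sigma> t + eval x (\<sigma> \<circ> \<rho>) TLen), 0, w)"
    unfolding term_code.simps
    by (rule runs_in_conv[OF runs_in_Seq[OF 1 runs_in_Seq[OF 2 3]]]) (use h(1) in \<open>auto simp: n_def\<close>)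
qed

lemma code_ok_TConst: "code_ok (\<lambda>_. 2 * n + 1) (TConst n)"
proof (rule code_okI)
  fix x w :: "bool list" and m f t :: nat and \<rho> \<sigma> :: "nat \<Rightarrow> nat"
  assume h: "length x \<le> m" "\<And>i. \<rho> i < f" "\<And>i. \<rho> i \<noteq> t" "t < f" "\<And>v. v \<ge> f \<Longrightarrow> \<sigma> v = 0" "\<And>i. \<sigma> (\<rho> i) \<le> m"
  show "runs_in x (term_code \<rho> f (TConst n) t) (\<sigma>, 0, w) (2 * n + 1) (\<sigma>(t := \<sigma> t + eval x (\<sigma> \<circ> \<rho>) (TConst n)), 0, w)"
    unfolding term_code.simps by (rule runs_in_conv[OF runs_in_incs]) (use h in auto)
qed

lemma code_ok_TAdd:
  assumes A: "code_ok Ta a" and B: "code_ok Tb b"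
  shows "code_ok (\<lambda>m. Ta m + Tb m + 1) (TAdd a b)"
proof (rule code_okI)
  fix x w :: "bool list" and m f t :: nat and \<rho> \<sigma> :: "nat \<Rightarrow> nat"
  assume h: "length x \<le> m" "\<And>i. \<rho> i < f" "\<And>i. \<rho> i \<noteq> t" "t < f" "\<And>v. v \<ge> f \<Longrightarrow> \<sigma> v = 0" "\<And>i. \<sigma> (\<rho> i) \<le> m"
  let ?\<sigma> = "\<sigma>(t := \<sigma> t + eval x (\<sigma> \<circ> \<rho>) a)"
  have 1: "runs_in x (term_code \<rho> f a t) (\<sigma>, 0, w) (Ta m) (?\<sigma>, 0, w)"
    by (rule code_okD[OF A]) (use h in auto)
  have 2: "runs_in x (term_code \<rho> f b t) (?\<sigma>, 0, w) (Tb m) (?\<sigma>(t := ?\<sigma> t + eval x (\<sigma> \<circ> \<rho>) b), 0, w)"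
    by (rule code_okD[OF B]) (use h in \<open>auto simp: fun_upd_comp_other\<close>)
  show "runs_in x (term_code \<rho> f (TAdd a b) t) (\<sigma>, 0, w) (Ta m + Tb m + 1) (\<sigma>(t := \<sigma> t + eval x (\<sigma> \<circ> \<rho>) (TAdd a b)), 0, w)"
    unfolding term_code.simps by (rule runs_in_conv[OF runs_in_Seq[OF 1 2]]) auto
qed

lemma code_ok_exists: "\<exists>T. polyb T \<and> code_ok T u"
proof (induction u)
  case (TSum a b)
  then obtain Ta Tb where T: "polyb Ta" "code_ok Ta a" "polyb Tb" "code_ok Tb b" by blast
  obtain B where B: "polyb B" "\<And>x e m. length x \<le> m \<Longrightarrow> (\<forall>i. e i \<le> m) \<Longrightarrow> eval x e a \<le> B m"
    using eval_polyb[of a] by blast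
  show ?case
    by (rule exI, rule conjI[OF _ code_ok_TSum[OF T(2,4) B(2)]]) (intro polyb_intros T polyb_comp[OF T(3)], (rule B(1))+)
next
  case (TMul a b)
  then obtain Ta Tb where T: "polyb Ta" "code_ok Ta a" "polyb Tb" "code_ok Tb b" by blast
  obtain B where B: "polyb B" "\<And>x e m. length x \<le> m \<Longrightarrow> (\<forall>i. e i \<le> m) \<Longrightarrow> eval x e a \<le> B m"
    using eval_polyb[of a] by blast
  show ?case by (rule exI, rule conjI[OF _ code_ok_TMul[OF T(2,4) B(2)]]) (intro polyb_intros T, (rule B(1))+)
next
  case (TMon a b)
  then obtain Ta Tb where T: "polyb Ta" "code_ok Ta a" "polyb Tb" "code_ok Tb b" by blast
  obtain B B' where B: "polyb B" "\<And>x e m. length x \<le> m \<Longrightarrow> (\<forall>i. e i \<le> m) \<Longrightarrow> eval x e a \<le> B m"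
    "polyb B'" "\<And>x e m. length x \<le> m \<Longrightarrow> (\<forall>i. e i \<le> m) \<Longrightarrow> eval x e b \<le> B' m"
    using eval_polyb[of a] eval_polyb[of b] by blast
  show ?case by (rule exI, rule conjI[OF _ code_ok_TMon[OF T(2,4) B(2,4)]]) (intro polyb_intros T, rule B(1), rule B(3))
next
  case (TAdd a b)
  then obtain Ta Tb where T: "polyb Ta" "code_ok Ta a" "polyb Tb" "code_ok Tb b" by blast
  show ?case by (rule exI, rule conjI[OF _ code_ok_TAdd[OF T(2,4)]]) (intro polyb_intros T)
next
  case (TBit a)
  then obtain Ta where T: "polyb Ta" "code_ok Ta a" by blast
  obtain B where B: "polyb B" "\<And>x e m. length x \<le> m \<Longrightarrow> (\<forall>i. e i \<le> m) \<Longrightarrow> eval x e a \<le> B m"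
    using eval_polyb[of a] by blast
  show ?case by (rule exI, rule conjI[OF _ code_ok_TBit[OF T(2) B(2)]]) (intro polyb_intros T, (rule B(1))+)
next
  case (TVar i)
  show ?case by (rule exI, rule conjI[OF _ code_ok_TVar]) (intro polyb_intros)
next
  case (TConst n)
  show ?case by (rule exI, rule conjI[OF _ code_ok_TConst]) (intro polyb_intros)
next
  case TLen
  show ?case by (rule exI, rule conjI[OF _ code_ok_TLen]) (intro polyb_intros)
qed


subsection \<open>Output given by terms\<close>

definition env1 :: "nat \<Rightarrow> nat \<Rightarrow> nat" where
  "env1 i = case_nat i (\<lambda>_. 0)"

text \<open>A block is a pair of terms, one for its length and one for its bit at a given index.
  Encodings are concatenations of a fixed number of such blocks, so one program scheme prints all of
  them.\<close>

definition blocks_output :: "(trm \<times> trm) list \<Rightarrow> bool list \<Rightarrow> bool list" where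
  "blocks_output bs x = concat (map (\<lambda>(a, b). map (\<lambda>i. eval x (env1 i) b > 0) [0..<eval x (\<lambda>_. 0) a]) bs)"

text \<open>Counter \<open>0\<close> remains zero, counter \<open>1\<close> holds the index within the block.\<close>

definition block_code :: "trm \<times> trm \<Rightarrow> com" where
  "block_code ab = Seq (term_code (\<lambda>_. 0) 4 (fst ab) 2)
     (Seq (While 2 (Seq (Dec 2) (Seq (term_code (case_nat 1 (\<lambda>_. 0)) 4 (snd ab) 3)
        (Seq (Emit 3) (Seq (While 3 (Dec 3)) (Inc 1))))))
       (While 1 (Dec 1)))"

fun blocks_code :: "(trm \<times> trm) list \<Rightarrow> com" where
  "blocks_code [] = Dec 0"
| "blocks_code (ab # bs) = Seq (block_code ab) (blocks_code bs)"

lemma runs_in_clear: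
  "runs_in x (While v (Dec v)) (\<sigma>, p, w) (\<sigma> v * 2 + 1) (\<sigma>(v := 0), p, w)"
proof -
  have "runs_in x (While v (Dec v)) (\<sigma>, p, w) (\<sigma> v * (1 + 1) + 1) (\<sigma>(v := 0), p, w)"
  proof (rule runs_in_loop[where S = "\<lambda>j. (\<sigma>(v := \<sigma> v - j), p, w)"])
    fix j assume "j < \<sigma> v"
    then show "0 < fst (\<sigma>(v := \<sigma> v - j), p, w) v \<and>
      runs_in x (Dec v) (\<sigma>(v := \<sigma> v - j), p, w) 1 (\<sigma>(v := \<sigma> v - Suc j), p, w)"
      by (intro conjI runs_in_conv[OF runs_in_Dec], simp_all only:) (auto simp: fun_eq_iff)
  qed auto
  then show ?thesis by (rule runs_in_mono) simp
qed

lemma block_code_correct: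
  "\<exists>T. polyb T \<and> (\<forall>x w. runs_in x (block_code (a, b)) (\<lambda>_. 0, 0, w) (T (length x)) (\<lambda>_. 0, 0, w @ blocks_output [(a, b)] x))"
proof -
  obtain Ta Tb where T: "polyb Ta" "code_ok Ta a" "polyb Tb" "code_ok Tb b"
    using code_ok_exists by meson
  obtain A where A: "polyb A" "\<And>x e m. length x \<le> m \<Longrightarrow> (\<forall>i. e i \<le> m) \<Longrightarrow> eval x e a \<le> A m"
    using eval_polyb[of a] by blast
  obtain B where B: "polyb B" "\<And>x e m. length x \<le> m \<Longrightarrow> (\<forall>i. e i \<le> m) \<Longrightarrow> eval x e b \<le> B m"
    using eval_polyb[of b] by blast
  define U where "U m = Tb (m + A m) + 2 * B (m + A m) + 8" for m
  define T where "T m = Ta m + A m * (U m + 3) + 10" for m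
  have pU: "polyb U" unfolding U_def
    by (intro polyb_intros polyb_comp[OF T(3)] polyb_comp[OF B(1)], (rule A(1))+)
  have "polyb T" unfolding T_def by (intro polyb_intros T(1) A(1) pU)
  moreover have "runs_in x (block_code (a, b)) (\<lambda>_. 0, 0, w) (T (length x)) (\<lambda>_. 0, 0, w @ blocks_output [(a, b)] x)" for x w
  proof -
    define m n where "m = length x" and "n = eval x (\<lambda>_. 0) a"
    define k where "k j = eval x (env1 j) b" for j
    define out where "out j = w @ map (\<lambda>i. k i > 0) [0..<j]" for j
    have n: "n \<le> A m" unfolding n_def by (intro A(2)) (auto simp: m_def)
    have 1: "runs_in x (term_code (\<lambda>_. 0) 4 a 2) (\<lambda>_. 0, 0, w) (Ta m) ((\<lambda>_. 0)(2 := n), 0, w)"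
      by (rule runs_in_conv[OF code_okD[OF T(2), of x m "\<lambda>_. 0" 4 2 "\<lambda>_. 0" "\<lambda>_. 0"]])
        (auto simp: m_def n_def fun_eq_iff)
    let ?body = "Seq (Dec 2) (Seq (term_code (case_nat 1 (\<lambda>_. 0)) 4 b 3) (Seq (Emit 3) (Seq (While 3 (Dec 3)) (Inc 1))))"
    let ?S = "\<lambda>j. ((\<lambda>_ :: nat. 0)(2 := n - j, 1 := j), 0 :: int, out j)"
    have 2: "runs_in x (While 2 ?body) ((\<lambda>_. 0)(2 := n), 0, w) (n * (U m + 1) + 1) (?S n)"
    proof (rule runs_in_loop[where S = ?S])
      fix j assume j: "j < n"
      let ?\<sigma> = "(\<lambda>_. 0)(2 := n - Suc j, 1 := j) :: nat \<Rightarrow> nat"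
      have b1: "runs_in x (Dec 2) (?S j) 1 (?\<sigma>, 0, out j)"
        by (rule runs_in_conv[OF runs_in_Dec], rule refl) (auto simp: fun_eq_iff)
      have "runs_in x (term_code (case_nat 1 (\<lambda>_. 0)) 4 b 3) (?\<sigma>, 0, out j) (Tb (m + A m))
        (?\<sigma>(3 := ?\<sigma> 3 + eval x (env1 j) b), 0, out j)"
        by (rule code_okD[OF T(4)]) (use j n in \<open>auto simp: m_def env1_def fun_eq_iff split: nat.splits\<close>)
      then have b2: "runs_in x (term_code (case_nat 1 (\<lambda>_. 0)) 4 b 3) (?\<sigma>, 0, out j) (Tb (m + A m)) (?\<sigma>(3 := k j), 0, out j)"
        by (simp add: k_def)
      have b3: "runs_in x (Emit 3) (?\<sigma>(3 := k j), 0, out j) 1 (?\<sigma>(3 := k j), 0, out (Suc j))"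
        by (rule runs_in_conv[OF runs_in_Emit]) (auto simp: out_def)
      have b4: "runs_in x (While 3 (Dec 3)) (?\<sigma>(3 := k j), 0, out (Suc j)) (k j * 2 + 1) (?\<sigma>, 0, out (Suc j))"
        by (rule runs_in_conv[OF runs_in_clear], rule refl) (auto simp: fun_eq_iff)
      have b5: "runs_in x (Inc 1) (?\<sigma>, 0, out (Suc j)) 1 (?S (Suc j))"
        by (rule runs_in_conv[OF runs_in_Inc], rule refl) (auto simp: fun_eq_iff)
      have "k j \<le> B (m + A m)" unfolding k_def
        by (intro B(2)) (use j n in \<open>auto simp: m_def env1_def split: nat.splits\<close>)
      then have "runs_in x ?body (?S j) (U m) (?S (Suc j))"
        by (intro runs_in_mono[OF runs_in_Seq[OF b1 runs_in_Seq[OF b2 runs_in_Seq[OF b3 runs_in_Seq[OF b4 b5]]]]])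
          (simp add: U_def)
      then show "0 < fst (?S j) 2 \<and> runs_in x ?body (?S j) (U m) (?S (Suc j))" using j by simp
    qed (auto simp: fun_eq_iff out_def)
    have 3: "runs_in x (While 1 (Dec 1)) (?S n) (n * 2 + 1) (\<lambda>_. 0, 0, out n)"
      by (rule runs_in_conv[OF runs_in_clear], rule refl) (auto simp: fun_eq_iff)
    have o: "out n = w @ blocks_output [(a, b)] x" by (simp add: out_def blocks_output_def n_def k_def)
    have "n * (U m + 1) + n * 2 \<le> A m * (U m + 3)"
      using mult_right_mono[OF n, of "U m + 3"] by (simp add: algebra_simps)
    then show ?thesis unfolding block_code_def fst_conv snd_conv o[symmetric] m_def[symmetric]
      by (intro runs_in_mono[OF runs_in_Seq[OF 1 runs_in_Seq[OF 2 3]]]) (simp add: T_def)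
  qed
  ultimately show ?thesis by blast
qed

lemma blocks_code_correct:
  "\<exists>T. polyb T \<and> (\<forall>x w. runs_in x (blocks_code bs) (\<lambda>_. 0, 0, w) (T (length x)) (\<lambda>_. 0, 0, w @ blocks_output bs x))"
proof (induction bs)
  case Nil
  have "runs_in x (Dec 0) (\<lambda>_. 0, 0, w) 1 (\<lambda>_. 0, 0, w)" for x w
    by (rule runs_in_conv[OF runs_in_Dec]) (auto simp: fun_eq_iff)
  then show ?case by (intro exI[of _ "\<lambda>_. 1"]) (auto simp: polyb_intros blocks_output_def)
next
  case (Cons ab bs)
  obtain T where T: "polyb T"
    "\<And>x w. runs_in x (blocks_code bs) (\<lambda>_. 0, 0, w) (T (length x)) (\<lambda>_. 0, 0, w @ blocks_output bs x)"
    using Cons by blast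
  obtain a b where ab: "ab = (a, b)" by (cases ab)
  obtain U where U: "polyb U"
    "\<And>x w. runs_in x (block_code ab) (\<lambda>_. 0, 0, w) (U (length x)) (\<lambda>_. 0, 0, w @ blocks_output [ab] x)"
    using block_code_correct[of a b] ab by blast
  have o: "(w @ blocks_output [ab] x) @ blocks_output bs x = w @ blocks_output (ab # bs) x" for w x
    by (simp add: blocks_output_def)
  have "runs_in x (blocks_code (ab # bs)) (\<lambda>_. 0, 0, w) (U (length x) + T (length x) + 1) (\<lambda>_. 0, 0, w @ blocks_output (ab # bs) x)" for x w
    using runs_in_Seq[OF U(2)[of x w] T(2)[of x "w @ blocks_output [ab] x"]] by (simp only: o blocks_code.simps)
  moreover have "polyb (\<lambda>m. U m + T m + 1)" by (intro polyb_intros U(1) T(1))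
  ultimately show ?case by blast
qed

lemma blocks_machine:
  obtains M c where "tm_wf M" "\<And>x. computes_within M x (blocks_output bs x) ((length x + 2) ^ c)"
proof -
  obtain T where T: "polyb T"
    "\<And>x w. runs_in x (blocks_code bs) (\<lambda>_. 0, 0, w) (T (length x)) (\<lambda>_. 0, 0, w @ blocks_output bs x)"
    using blocks_code_correct by blast
  obtain M where M: "tm_wf M"
    "\<And>x t \<sigma> p w. (cstep x ^^ t) ([blocks_code bs], (\<lambda>_. 0, 0, [])) = ([], (\<sigma>, p, w)) \<Longrightarrow> computes_within M x w (Suc t)"
    using com_machine[of "blocks_code bs"] by blast
  have "polyb (\<lambda>m. T m + 1)" by (intro polyb_intros T(1))
  then obtain c where c: "\<And>m. T m + 1 \<le> (m + 2) ^ c" unfolding polyb_def by blast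
  have "computes_within M x (blocks_output bs x) ((length x + 2) ^ c)" for x
  proof -
    obtain n where n: "n \<le> T (length x)"
      "(cstep x ^^ n) ([blocks_code bs], (\<lambda>_. 0, 0, [])) = ([], (\<lambda>_. 0, 0, blocks_output bs x))"
      using T(2)[of x "[]"] unfolding runs_in_def by auto
    show ?thesis
      by (rule computes_within_mono[OF M(2)[OF n(2)]]) (use n(1) c[of "length x"] in simp)
  qed
  with M(1) show ?thesis by (rule that)
qed


section \<open>Definable functions\<close>

text \<open>The semantic side of terms: the reductions are stated with ordinary functions, and their
  terms are only shown to exist, by syntax-directed rules.\<close>

definition definable :: "(bool list \<Rightarrow> (nat \<Rightarrow> nat) \<Rightarrow> nat) \<Rightarrow> bool" where
  "definable f \<longleftrightarrow> (\<exists>u. \<forall>x e. eval x e u = f x e)"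

abbreviation definable_pred :: "(bool list \<Rightarrow> (nat \<Rightarrow> nat) \<Rightarrow> bool) \<Rightarrow> bool" where
  "definable_pred P \<equiv> definable (\<lambda>x e. of_bool (P x e))"

fun rename :: "(nat \<Rightarrow> nat) \<Rightarrow> trm \<Rightarrow> trm" where
  "rename r (TConst n) = TConst n"
| "rename r (TVar i) = TVar (r i)"
| "rename r (TAdd a b) = TAdd (rename r a) (rename r b)"
| "rename r (TMul a b) = TMul (rename r a) (rename r b)"
| "rename r (TMon a b) = TMon (rename r a) (rename r b)"
| "rename r (TSum a b) = TSum (rename r a) (rename (case_nat 0 (\<lambda>i. Suc (r i))) b)"
| "rename r (TBit a) = TBit (rename r a)"
| "rename r TLen = TLen"

lemma eval_rename: "eval x e (rename r u) = eval x (\<lambda>i. e (r i)) u"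
proof (induction u arbitrary: r e)
  case (TSum a b)
  have "(\<lambda>j. case_nat i e (case_nat 0 (\<lambda>i. Suc (r i)) j)) = case_nat i (\<lambda>i. e (r i))" for i
    by (auto split: nat.splits)
  then show ?case using TSum by simp
qed auto

text \<open>Functions that occur below a bounded sum or quantifier see an environment shifted by
  one; renaming transfers their definability there.\<close>

lemma definable_rename: "definable f \<Longrightarrow> definable (\<lambda>x e. f x (\<lambda>n. e (r n)))"
  unfolding definable_def by (metis eval_rename)

lemma definable_const: "definable (\<lambda>x e. n)"
  and definable_var: "definable (\<lambda>x e. e i)"
  and definable_length: "definable (\<lambda>x e. length x)"
  unfolding definable_def by (rule exI[of _ "TConst n"], simp, rule exI[of _ "TVar i"], simp, rule exI[of _ TLen], simp)

lemma definable_add: "definable f \<Longrightarrow> definable g \<Longrightarrow> definable (\<lambda>x e. f x e + g x e)"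
  unfolding definable_def by (metis eval.simps(3))

lemma definable_mult: "definable f \<Longrightarrow> definable g \<Longrightarrow> definable (\<lambda>x e. f x e * g x e)"
  unfolding definable_def by (metis eval.simps(4))

lemma definable_diff: "definable f \<Longrightarrow> definable g \<Longrightarrow> definable (\<lambda>x e. f x e - g x e)"
  unfolding definable_def by (metis eval.simps(5))

lemma definable_bit: "definable f \<Longrightarrow> definable_pred (\<lambda>x e. f x e < length x \<and> x ! f x e)"
  unfolding definable_def by (metis eval.simps(7))

lemma definable_sum:
  assumes "definable f" "definable (\<lambda>x e. g (e 0) x (\<lambda>n. e (Suc n)))"
  shows "definable (\<lambda>x e. \<Sum>i < f x e. g i x e)"
proof -
  obtain u v where "\<And>x e. eval x e u = f x e" "\<And>x e. eval x e v = g (e 0) x (\<lambda>n. e (Suc n))"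
    using assms unfolding definable_def by metis
  then have "eval x e (TSum u v) = (\<Sum>i < f x e. g i x e)" for x e by simp
  then show ?thesis unfolding definable_def by blast
qed

lemma definable_cong: "definable f \<Longrightarrow> (\<And>x e. f x e = g x e) \<Longrightarrow> definable g"
proof -
  assume "definable f" "\<And>x e. f x e = g x e"
  moreover from this(2) have "f = g" by (intro ext)
  ultimately show ?thesis by simp
qed

lemma definable_Suc: "definable f \<Longrightarrow> definable (\<lambda>x e. Suc (f x e))"
  using definable_add[of f "\<lambda>x e. 1"] definable_const by simp

lemma definable_not: "definable_pred P \<Longrightarrow> definable_pred (\<lambda>x e. \<not> P x e)"
  by (rule definable_cong[OF definable_diff[OF definable_const[of 1]]]) auto

lemma definable_conj: "definable_pred P \<Longrightarrow> definable_pred Q \<Longrightarrow> definable_pred (\<lambda>x e. P x e \<and> Q x e)"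
  using definable_mult[of "\<lambda>x e. of_bool (P x e)" "\<lambda>x e. of_bool (Q x e)"] by (simp only: of_bool_conj)

lemma definable_disj: "definable_pred P \<Longrightarrow> definable_pred Q \<Longrightarrow> definable_pred (\<lambda>x e. P x e \<or> Q x e)"
  using definable_not[OF definable_conj[OF definable_not definable_not], of P Q] by simp

lemma definable_imp: "definable_pred P \<Longrightarrow> definable_pred Q \<Longrightarrow> definable_pred (\<lambda>x e. P x e \<longrightarrow> Q x e)"
  using definable_disj[OF definable_not, of P Q] by (simp only: imp_conv_disj)

text \<open>With truncated subtraction, \<open>1 - (1 - n)\<close> is the sign of
  \<open>n\<close>.\<close>

lemma definable_less: "definable f \<Longrightarrow> definable g \<Longrightarrow> definable_pred (\<lambda>x e. f x e < g x e)"
  by (rule definable_cong[OF definable_diff[OF definable_const[of 1]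
        definable_diff[OF definable_const[of 1] definable_diff[of g f]]]]) auto

lemma definable_le: "definable f \<Longrightarrow> definable g \<Longrightarrow> definable_pred (\<lambda>x e. f x e \<le> g x e)"
  using definable_not[OF definable_less[of g f]] by (simp add: not_less)

lemma definable_eq: "definable f \<Longrightarrow> definable g \<Longrightarrow> definable_pred (\<lambda>x e. f x e = g x e)"
  using definable_conj[OF definable_le definable_le, of f g g f] by (simp add: eq_iff)

lemma definable_iff: "definable_pred P \<Longrightarrow> definable_pred Q \<Longrightarrow> definable_pred (\<lambda>x e. P x e \<longleftrightarrow> Q x e)"
  using definable_conj[OF definable_imp definable_imp, of P Q Q P] by (simp only: iff_conv_conj_imp)

lemma definable_if:
  "definable_pred P \<Longrightarrow> definable f \<Longrightarrow> definable g \<Longrightarrow> definable (\<lambda>x e. if P x e then f x e else g x e)"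
  by (rule definable_cong[OF definable_add[OF definable_mult[of _ f] definable_mult[OF definable_not[of P], of g]]]) auto

lemma definable_pred_if:
  "definable_pred P \<Longrightarrow> definable_pred Q \<Longrightarrow> definable_pred R \<Longrightarrow> definable_pred (\<lambda>x e. if P x e then Q x e else R x e)"
  by (rule definable_cong[OF definable_if[of P "\<lambda>x e. of_bool (Q x e)" "\<lambda>x e. of_bool (R x e)"]]) auto

lemma definable_ex:
  assumes "definable f" "definable_pred (\<lambda>x e. P (e 0) x (\<lambda>n. e (Suc n)))"
  shows "definable_pred (\<lambda>x e. \<exists>i < f x e. P i x e)"
proof -
  have "definable (\<lambda>x e. \<Sum>i < f x e. of_bool (P i x e))" by (rule definable_sum[OF assms])
  from definable_less[OF definable_const[of 0] this] show ?thesis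
    by (rule definable_cong) (auto simp: sum_eq_0_iff simp flip: neq0_conv)
qed

lemma definable_all:
  assumes "definable f" "definable_pred (\<lambda>x e. P (e 0) x (\<lambda>n. e (Suc n)))"
  shows "definable_pred (\<lambda>x e. \<forall>i < f x e. P i x e)"
  using definable_not[OF definable_ex[of f "\<lambda>i x e. \<not> P i x e", OF assms(1) definable_not[OF assms(2)]]] by simp

lemma definable_TF: "definable_pred (\<lambda>x e. b)"
  using definable_const[of "of_bool b"] .

lemmas definable_intros =
  definable_const definable_var definable_length definable_add definable_mult definable_diff definable_Suc
  definable_not definable_conj definable_disj definable_imp definable_less definable_le definable_eq
  definable_iff definable_if definable_pred_if definable_ex definable_all definable_sum definable_TF

text \<open>A fixed number of cases is unfolded into the term. The index may then be an exponent, as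
  in digits of numbers, although terms only have powers with constant exponents.\<close>

lemma definable_fin_all: "(\<And>l. l < n \<Longrightarrow> definable_pred (P l)) \<Longrightarrow> definable_pred (\<lambda>x e. \<forall>l < (n :: nat). P l x e)"
proof (induction n)
  case (Suc n)
  have "definable_pred (\<lambda>x e. (\<forall>l<n. P l x e) \<and> P n x e)" by (intro definable_conj Suc) auto
  then show ?case by (rule definable_cong) (auto simp: less_Suc_eq)
qed (simp add: definable_intros)

lemma definable_fin_ex: "(\<And>l. l < n \<Longrightarrow> definable_pred (P l)) \<Longrightarrow> definable_pred (\<lambda>x e. \<exists>l < (n :: nat). P l x e)"
proof (induction n)
  case (Suc n)
  have "definable_pred (\<lambda>x e. (\<exists>l<n. P l x e) \<or> P n x e)" by (intro definable_disj Suc) auto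
  then show ?case by (rule definable_cong) (auto simp: less_Suc_eq)
qed (simp add: definable_intros)

lemma definable_power: "definable f \<Longrightarrow> definable (\<lambda>x e. f x e ^ n)"
  by (induction n) (auto intro!: definable_intros)

lemma definable_poly: "definable f \<Longrightarrow> definable (\<lambda>x e. poly p (f x e))"
  by (induction p) (auto intro!: definable_intros)

text \<open>The quotient counts the positive multiples of the divisor up to the dividend.\<close>

lemma div_eq_sum: "n div (k :: nat) = (if k = 0 then 0 else \<Sum>q < n. of_bool (Suc q * k \<le> n))"
proof (cases "k = 0")
  case False
  have "Suc q * k \<le> n \<longleftrightarrow> q < n div k" for q
    using False by (metis Suc_le_eq less_eq_div_iff_mult_less_eq neq0_conv)
  then have "(\<Sum>q < n. of_bool (Suc q * k \<le> n)) = (\<Sum>q < n. of_bool (q < n div k) :: nat)" by simp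
  also have "\<dots> = card {q. q < n \<and> q < n div k}" by (simp add: Int_def)
  also have "{q. q < n \<and> q < n div k} = {..<n div k}"
    using less_le_trans[OF _ div_le_dividend[of n k]] by auto
  finally show ?thesis using False by simp
qed simp

lemma definable_div:
  assumes "definable f" "definable g" shows "definable (\<lambda>x e. f x e div g x e)"
  unfolding div_eq_sum
  by (intro definable_intros definable_sum[where g = "\<lambda>q x e. of_bool (Suc q * g x e \<le> f x e)"]
      definable_rename[OF assms(1)] definable_rename[OF assms(2)] assms)

lemma definable_mod:
  assumes "definable f" "definable g" shows "definable (\<lambda>x e. f x e mod g x e)"
  by (rule definable_cong[OF definable_diff[OF assms(1) definable_mult[OF assms(2) definable_div[OF assms]]]])
    (metis minus_mult_div_eq_mod)

section \<open>Constraint satisfaction with slots\<close>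

text \<open>This is a coloured hitting set problem: the elements are the pairs of a slot and a
  value, the slot is the colour, and one element of each colour is chosen such that every set is
  hit.\<close>

definition csp_sat :: "nat \<Rightarrow> nat \<Rightarrow> nat \<Rightarrow> (nat \<Rightarrow> nat \<Rightarrow> nat \<Rightarrow> bool) \<Rightarrow> bool" where
  "csp_sat K D R C \<longleftrightarrow> (\<exists>\<sigma>. (\<forall>i < K. \<sigma> i < D) \<and> (\<forall>r < R. \<exists>i < K. C r i (\<sigma> i)))"


section \<open>Closeness and neighbourhoods\<close>

lemma adj_sym: "(u, v) \<in> adj E \<longleftrightarrow> (v, u) \<in> adj E"
  by (simp add: adj_def insert_commute)

lemma graph_dist_le: "(u, v) \<in> adj E ^^ m \<Longrightarrow> graph_dist E u v \<le> m"
  unfolding graph_dist_def by (rule Least_le)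

lemma graph_dist_relpow: "(u, v) \<in> (adj E)\<^sup>* \<Longrightarrow> (u, v) \<in> adj E ^^ graph_dist E u v"
  unfolding graph_dist_def by (auto simp: rtrancl_is_UN_relpow intro: LeastI)

lemma graph_dist_mono:
  assumes "E \<subseteq> F" "(u, v) \<in> (adj E)\<^sup>*"
  shows "graph_dist F u v \<le> graph_dist E u v"
proof -
  have "adj E \<subseteq> adj F" using assms(1) by (auto simp: adj_def)
  then have "adj E ^^ m \<subseteq> adj F ^^ m" for m by (induction m) auto
  then show ?thesis using graph_dist_relpow[OF assms(2)] by (blast intro: graph_dist_le)
qed

lemma graph_dist_0: "(u, v) \<in> (adj E)\<^sup>* \<Longrightarrow> graph_dist E u v = 0 \<longleftrightarrow> u = v"
  using graph_dist_relpow[of u v E] graph_dist_le[where E = E and m = 0] by auto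

lemma graph_dist_1: "(u, v) \<in> (adj E)\<^sup>* \<Longrightarrow> graph_dist E u v = 1 \<Longrightarrow> (u, v) \<in> adj E"
  using graph_dist_relpow[of u v E] by auto

definition within2 :: "'v set set \<Rightarrow> 'v \<Rightarrow> 'v \<Rightarrow> bool" where
  "within2 E u v \<longleftrightarrow> u = v \<or> (u, v) \<in> adj E \<or> (\<exists>w. (u, w) \<in> adj E \<and> (w, v) \<in> adj E)"

lemma within2_iff:
  assumes "(u, v) \<in> (adj E)\<^sup>*"
  shows "graph_dist E u v \<le> 2 \<longleftrightarrow> within2 E u v"
proof
  assume "graph_dist E u v \<le> 2"
  then have "graph_dist E u v = 0 \<or> graph_dist E u v = 1 \<or> graph_dist E u v = 2" by auto
  then show "within2 E u v"
    using graph_dist_relpow[OF assms] by (auto simp: within2_def numeral_2_eq_2)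
next
  assume "within2 E u v"
  then have "(u, v) \<in> adj E ^^ 0 \<or> (u, v) \<in> adj E ^^ 1 \<or> (u, v) \<in> adj E ^^ 2"
    by (auto simp: within2_def numeral_2_eq_2)
  then show "graph_dist E u v \<le> 2" by (elim disjE) (drule graph_dist_le; simp)+
qed

definition degree_in :: "'v set \<Rightarrow> 'v set set \<Rightarrow> 'v \<Rightarrow> nat" where
  "degree_in V E v = card {u \<in> V. (u, v) \<in> adj E}"

text \<open>The vertex itself contributes 0, a neighbour 1 and any other vertex at least 2, with
  exact equality if and only if no distance exceeds two. The summand 2 avoids subtraction.\<close>

lemma closeness_ge:
  assumes "finite V" "z \<in> V" "(z, z) \<notin> adj E" "\<forall>u \<in> V. (u, z) \<in> (adj E)\<^sup>*"
  shows "2 * card V \<le> closeness V E z + degree_in V E z + 2"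
    and "2 * card V = closeness V E z + degree_in V E z + 2 \<longleftrightarrow> (\<forall>u \<in> V. within2 E u z)"
proof -
  let ?N = "{u \<in> V. (u, z) \<in> adj E}"
  define f where "f u = (if u = z then 0 else if (u, z) \<in> adj E then 1 else 2 :: nat)" for u
  have le: "f u \<le> graph_dist E u z" if "u \<in> V" for u
    using graph_dist_0[of u z E] graph_dist_1[of u z E] assms(4) that unfolding f_def by force
  have "(\<Sum>u\<in>V. f u) = f z + (\<Sum>u\<in>V - {z}. f u)" by (rule sum.remove[OF assms(1,2)])
  also have "(\<Sum>u\<in>V - {z}. f u) = (\<Sum>u\<in>?N. f u) + (\<Sum>u\<in>V - {z} - ?N. f u)"
    using assms by (subst sum.subset_diff[of ?N]) auto
  also have "(\<Sum>u\<in>?N. f u) = (\<Sum>u\<in>?N. 1)" by (rule sum.cong) (use assms(3) in \<open>auto simp: f_def\<close>)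
  also have "(\<Sum>u\<in>V - {z} - ?N. f u) = (\<Sum>u\<in>V - {z} - ?N. 2)" by (rule sum.cong) (auto simp: f_def)
  finally have s: "(\<Sum>u\<in>V. f u) = card ?N + 2 * card (V - {z} - ?N)" by (simp add: f_def)
  have sub: "?N \<subseteq> V - {z}" using assms(3) by auto
  have "card (V - {z} - ?N) = card (V - {z}) - card ?N"
    using sub assms(1) by (simp add: card_Diff_subset)
  moreover have "card ?N \<le> card (V - {z})" using sub assms(1) by (intro card_mono) auto
  moreover have "card (V - {z}) = card V - 1" "0 < card V" using assms by (auto simp: card_gt_0_iff)
  ultimately have S: "2 * card V = (\<Sum>u\<in>V. f u) + degree_in V E z + 2"
    using s by (simp add: degree_in_def)
  show "2 * card V \<le> closeness V E z + degree_in V E z + 2"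
    unfolding S closeness_def using le by (simp add: sum_mono)
  have "(\<Sum>u\<in>V. f u) = (\<Sum>u\<in>V. graph_dist E u z) \<longleftrightarrow> (\<forall>u\<in>V. f u = graph_dist E u z)"
    using sum_mono_inv[of f V "\<lambda>u. graph_dist E u z"] le assms(1) by auto
  also have "\<dots> \<longleftrightarrow> (\<forall>u\<in>V. within2 E u z)"
  proof -
    have "f u = graph_dist E u z \<longleftrightarrow> within2 E u z" if u: "u \<in> V" for u
    proof -
      have r: "(u, z) \<in> (adj E)\<^sup>*" using assms(4) u by blast
      have "f u = graph_dist E u z \<longleftrightarrow> graph_dist E u z \<le> f u" using le[OF u] by auto
      also have "\<dots> \<longleftrightarrow> graph_dist E u z \<le> 2"
        using graph_dist_0[OF r] graph_dist_le[where E = E and u = u and v = z and m = 1] unfolding f_def by auto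
      finally show ?thesis using within2_iff[OF r] by simp
    qed
    then show ?thesis by blast
  qed
  finally show "2 * card V = closeness V E z + degree_in V E z + 2 \<longleftrightarrow> (\<forall>u \<in> V. within2 E u z)"
    unfolding S closeness_def by simp
qed

lemma closeness_mono:
  assumes "E \<subseteq> F" "\<forall>u \<in> V. (u, z) \<in> (adj E)\<^sup>*"
  shows "closeness V F z \<le> closeness V E z"
  unfolding closeness_def using assms by (intro sum_mono graph_dist_mono) auto

text \<open>Positivity enters because \<open>0 / 0 = 0\<close>.\<close>

lemma closeness_ratio_ge_1:
  "closeness_ratio V E a b \<ge> 1 \<longleftrightarrow> closeness V E a = closeness V E b \<and> closeness V E b > 0"
proof (cases "max (closeness V E a) (closeness V E b) = 0")
  case True
  then show ?thesis by (simp add: closeness_ratio_def)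
next
  case False
  then have "0 < (of_nat (max (closeness V E a) (closeness V E b)) :: rat)" by (simp only: of_nat_0_less_iff)
  then have "closeness_ratio V E a b \<ge> 1 \<longleftrightarrow>
    (of_nat (max (closeness V E a) (closeness V E b)) :: rat) \<le> of_nat (min (closeness V E a) (closeness V E b))"
    unfolding closeness_ratio_def by (simp only: le_divide_eq_1_pos)
  also have "\<dots> \<longleftrightarrow> max (closeness V E a) (closeness V E b) \<le> min (closeness V E a) (closeness V E b)"
    by (simp only: of_nat_le_iff)
  finally show ?thesis using False by auto
qed


section \<open>From constraint satisfaction to closeness ratio improvement\<close>

text \<open>
  Vertex \<open>0\<close> is \<open>a\<close>, vertex \<open>1\<close> is \<open>b\<close>, vertex \<open>2\<close> is a hub, and vertex \<open>3\<close> only raises the degree of \<open>a\<close>.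
  There are helpers \<open>4 + j\<close> for \<open>j \<le> K\<close>, one vertex for each possible choice of a value for a slot, and
  \<open>K + 1\<close> copies of each constraint, where the first \<open>K\<close> constraints say that the slots get a value.
  The helpers bring all constraints within distance two of \<open>b\<close>, but \<open>a\<close> cannot afford to use them.
\<close>

locale csp_graph =
  fixes K D R :: nat and C :: "nat \<Rightarrow> nat \<Rightarrow> nat \<Rightarrow> bool"
begin

definition sets_start :: nat where
  "sets_start = 5 + K + K * D"

definition size :: nat where
  "size = sets_start + (K + R) * (K + 1)"

definition member :: "nat \<Rightarrow> nat \<Rightarrow> nat \<Rightarrow> bool" where
  "member r i v \<longleftrightarrow> (if r < K then i = r else C (r - K) i v)"

text \<open>Each edge is listed once, from the smaller to the larger vertex. The hub takes care of
  all distances except those to the copies of constraints, so only these matter for the new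
  neighbours of \<open>a\<close>; helper \<open>j\<close> is joined to copy \<open>j\<close> of
  every constraint.\<close>

definition arc :: "nat \<Rightarrow> nat \<Rightarrow> bool" where
  "arc u v \<longleftrightarrow>
     u = 0 \<and> (v = 2 \<or> v = 3) \<or>
     u = 1 \<and> (v = 2 \<or> 4 \<le> v \<and> v < 5 + K) \<or>
     u = 2 \<and> 3 \<le> v \<and> v < sets_start \<or>
     4 \<le> u \<and> u < 5 + K \<and> sets_start \<le> v \<and> v < size \<and> (v - sets_start) mod (K + 1) = u - 4 \<or>
     5 + K \<le> u \<and> u < sets_start \<and> sets_start \<le> v \<and> v < size \<and>
       member ((v - sets_start) div (K + 1)) ((u - (5 + K)) div D) ((u - (5 + K)) mod D)"

definition edge_set :: "nat set set" where
  "edge_set = {{u, v} | u v. arc u v}"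

definition opt :: "nat \<Rightarrow> nat \<Rightarrow> nat" where
  "opt i v = 5 + K + (i * D + v)"

definition setv :: "nat \<Rightarrow> nat \<Rightarrow> nat" where
  "setv r j = sets_start + (r * (K + 1) + j)"

abbreviation V :: "nat set" where
  "V \<equiv> {..<size}"

lemma sets_start_le: "sets_start \<le> size" "5 + K \<le> sets_start"
  by (simp_all add: size_def sets_start_def)

lemma arc_less: "arc u v \<Longrightarrow> u < v \<and> v < size"
  using sets_start_le by (auto simp: arc_def)

lemma adj_edge_set: "(u, v) \<in> adj edge_set \<longleftrightarrow> arc u v \<or> arc v u"
  by (auto simp: adj_def edge_set_def doubleton_eq_iff)

lemma edge_set_pairs: "edge_set \<subseteq> vertex_pairs V"
  using arc_less by (fastforce simp: edge_set_def vertex_pairs_def card_2_iff)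

lemma opt_bounds: "i < K \<Longrightarrow> v < D \<Longrightarrow> 5 + K \<le> opt i v \<and> opt i v < sets_start"
proof -
  assume "i < K" "v < D"
  then have "i * D + v < (i + 1) * D" by simp
  also have "\<dots> \<le> K * D" using \<open>i < K\<close> by (intro mult_right_mono) auto
  finally show ?thesis by (simp add: opt_def sets_start_def)
qed

lemma opt_inject: "v < D \<Longrightarrow> v' < D \<Longrightarrow> opt i v = opt i' v' \<longleftrightarrow> i = i' \<and> v = v'"
  unfolding opt_def by (metis add_left_cancel div_mult_self3 div_less add.right_neutral mod_mult_self3 mod_less less_nat_zero_code)

lemma opt_cases:
  assumes "5 + K \<le> u" "u < sets_start"
  obtains i v where "i < K" "v < D" "u = opt i v"
proof -
  let ?w = "u - (5 + K)"
  have w: "?w < K * D" using assms by (simp add: sets_start_def)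
  then have "0 < D" by (cases D) auto
  have "?w div D < K" using w by (simp add: less_mult_imp_div_less)
  moreover have "?w mod D < D" using \<open>0 < D\<close> by simp
  moreover have "u = opt (?w div D) (?w mod D)" using assms(1) by (simp add: opt_def)
  ultimately show ?thesis by (rule that)
qed

lemma setv_bounds: "r < K + R \<Longrightarrow> j \<le> K \<Longrightarrow> sets_start \<le> setv r j \<and> setv r j < size"
proof -
  assume "r < K + R" "j \<le> K"
  then have "r * (K + 1) + j < (r + 1) * (K + 1)" by simp
  also have "\<dots> \<le> (K + R) * (K + 1)" using \<open>r < K + R\<close> by (intro mult_right_mono) auto
  finally show ?thesis by (simp add: setv_def size_def)
qed

lemma setv_cases:
  assumes "sets_start \<le> u" "u < size"
  obtains r j where "r < K + R" "j \<le> K" "u = setv r j"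
proof -
  let ?w = "u - sets_start"
  have w: "?w < (K + R) * (K + 1)" using assms by (simp add: size_def)
  have "?w div (K + 1) < K + R" using w by (rule less_mult_imp_div_less)
  moreover have "?w mod (K + 1) \<le> K" by (simp add: less_Suc_eq_le[symmetric])
  moreover have "u = setv (?w div (K + 1)) (?w mod (K + 1))"
    using assms(1) div_mult_mod_eq[of ?w "K + 1"] unfolding setv_def by linarith
  ultimately show ?thesis by (rule that)
qed

lemma setv_copy: "j \<le> K \<Longrightarrow> (setv r j - sets_start) mod (K + 1) = j"
  unfolding setv_def add_diff_cancel_left' by (subst mod_mult_self3) auto

lemma arc_helper_setv: "r < K + R \<Longrightarrow> j \<le> K \<Longrightarrow> j' \<le> K \<Longrightarrow> arc (4 + j') (setv r j) \<longleftrightarrow> j' = j"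
  using setv_bounds[of r j] sets_start_le setv_copy[of j r] by (auto simp: arc_def)

lemma arc_opt_setv:
  assumes "r < K + R" "j \<le> K" "i < K" "v < D"
  shows "arc (opt i v) (setv r j) \<longleftrightarrow> member r i v"
proof -
  have "(setv r j - sets_start) div (K + 1) = r"
    unfolding setv_def add_diff_cancel_left' using assms(2) by (subst div_mult_self3) auto
  moreover have "(opt i v - (5 + K)) div D = i" "(opt i v - (5 + K)) mod D = v" using assms(4) by (simp_all add: opt_def)
  ultimately show ?thesis using opt_bounds[OF assms(3,4)] setv_bounds[OF assms(1,2)] by (auto simp: arc_def)
qed

lemma vertex_cases:
  assumes "u < size"
  obtains "u \<le> 3" | j where "j \<le> K" "u = 4 + j" | i v where "i < K" "v < D" "u = opt i v"
    | r j where "r < K + R" "j \<le> K" "u = setv r j"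
proof -
  consider "u \<le> 3" | "4 \<le> u" "u < 5 + K" | "5 + K \<le> u" "u < sets_start" | "sets_start \<le> u"
    by linarith
  then show ?thesis
  proof cases
    case 2
    then show ?thesis by (intro that(2)[of "u - 4"]) auto
  next
    case 3
    then show ?thesis using opt_cases that(3) by metis
  next
    case 4
    then show ?thesis using setv_cases assms that(4) by metis
  qed (rule that(1))
qed

lemma arc_hub: "3 \<le> u \<Longrightarrow> u < sets_start \<Longrightarrow> arc 2 u" "arc 0 2" "arc 1 2" "arc 0 3" "j \<le> K \<Longrightarrow> arc 1 (4 + j)"
  by (auto simp: arc_def)

lemma reach_hub: "u < size \<Longrightarrow> (u, 2) \<in> (adj edge_set)\<^sup>*"
proof -
  assume u: "u < size"
  have hub: "(v, 2) \<in> (adj edge_set)\<^sup>*" if "v < sets_start" for v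
  proof (cases "v = 2")
    case False
    then have "arc v 2 \<or> arc 2 v" using that arc_hub(1)[of v] arc_hub(2,3) by (cases "v = 0"; cases "v = 1") auto
    then show ?thesis by (intro r_into_rtrancl) (simp add: adj_edge_set)
  qed simp
  show ?thesis
  proof (cases "u < sets_start")
    case False
    then obtain r j where rj: "r < K + R" "j \<le> K" "u = setv r j" using setv_cases[of u] u by auto
    then have "(u, 4 + j) \<in> adj edge_set" using arc_helper_setv[of r j j] by (simp add: adj_edge_set)
    moreover have "(4 + j, 2) \<in> (adj edge_set)\<^sup>*" using rj(2) sets_start_le by (intro hub) auto
    ultimately show ?thesis by (rule converse_rtrancl_into_rtrancl)
  qed (rule hub)
qed

lemma reach: "u < size \<Longrightarrow> v < size \<Longrightarrow> (u, v) \<in> (adj edge_set)\<^sup>*"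
proof -
  assume "u < size" "v < size"
  then have "(u, 2) \<in> (adj edge_set)\<^sup>*" "(v, 2) \<in> (adj edge_set)\<^sup>*" by (auto intro: reach_hub)
  moreover have "sym ((adj edge_set)\<^sup>*)" by (intro sym_rtrancl symI) (simp add: adj_sym)
  ultimately show ?thesis by (meson rtrancl_trans symD)
qed

lemma size_ge: "5 + K \<le> size"
  using sets_start_le by linarith

lemma connected: "connected_graph V edge_set"
proof -
  have "V \<noteq> {}" using size_ge by (auto simp: lessThan_empty_iff)
  then show ?thesis unfolding connected_graph_def using edge_set_pairs reach by auto
qed

lemma reach_superset: "edge_set \<subseteq> F \<Longrightarrow> u < size \<Longrightarrow> v < size \<Longrightarrow> (u, v) \<in> (adj F)\<^sup>*"
  using reach[of u v] rtrancl_mono[of "adj edge_set" "adj F"] by (auto simp: adj_def)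

lemma arc_0: "arc 0 v \<longleftrightarrow> v = 2 \<or> v = 3" "\<not> arc v 0"
  using sets_start_le by (auto simp: arc_def)

lemma arc_1: "arc (Suc 0) v \<longleftrightarrow> v = 2 \<or> 4 \<le> v \<and> v < 5 + K" "\<not> arc v (Suc 0)"
  using sets_start_le by (auto simp: arc_def)

lemma within2_b: "edge_set \<subseteq> F \<Longrightarrow> u < size \<Longrightarrow> within2 F u 1"
proof -
  assume F: "edge_set \<subseteq> F" and u: "u < size"
  have adjI: "(v, w) \<in> adj F" if "arc v w \<or> arc w v" for v w
    using that F adj_edge_set[of v w] by (auto simp: adj_def)
  from u show ?thesis
  proof (cases rule: vertex_cases)
    case 1
    then have "u = 0 \<or> u = 1 \<or> u = 2 \<or> u = 3" by auto
    moreover have "arc 2 3" using arc_hub(1)[of 3] sets_start_le by auto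
    ultimately show ?thesis
      unfolding within2_def using adjI[of 0 2] adjI[of 2 1] adjI[of 3 2] arc_hub(2,3) by auto
  next
    case (2 j)
    then show ?thesis unfolding within2_def using adjI arc_hub(5) by blast
  next
    case (3 i v)
    then have "arc 2 u" using opt_bounds[of i v] by (intro arc_hub) auto
    then show ?thesis unfolding within2_def using adjI[of u 2] adjI[of 2 1] arc_hub(3) by auto
  next
    case (4 r j)
    then have "arc (4 + j) u" using arc_helper_setv[of r j j] by simp
    then show ?thesis unfolding within2_def using adjI[of u "4 + j"] adjI[of "4 + j" 1] arc_hub(5)[OF 4(2)] by auto
  qed
qed

text \<open>The neighbours are the hub and \<open>K + 1\<close> helpers. Vertex \<open>a\<close>
  starts with the hub and vertex \<open>3\<close>, so exactly \<open>K\<close> neighbours are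
  missing, which equals the budget.\<close>

lemma degree_b: "degree_in V edge_set 1 = K + 2"
proof -
  have "{u \<in> V. (u, 1) \<in> adj edge_set} = insert 2 {4..<5 + K}"
    using size_ge by (auto simp: adj_edge_set arc_1)
  then show ?thesis by (simp add: degree_in_def)
qed

lemma closeness_b: "closeness V edge_set 1 + (K + 4) = 2 * size"
  using closeness_ge(2)[of V 1 edge_set] within2_b[OF subset_refl] reach size_ge arc_1 degree_b
  by (simp add: adj_edge_set)

text \<open>Vertex \<open>a\<close> is joined to the vertex of the chosen value of each slot. This
  gives \<open>a\<close> the degree of \<open>b\<close> and puts every constraint at distance two,
  while the degree of \<open>b\<close> does not change.\<close>

lemma sat_imp_improvement:
  assumes "csp_sat K D R C"
  shows "\<exists>T \<subseteq> vertex_pairs V - edge_set. card T \<le> K \<and> closeness_ratio V (edge_set \<union> T) 0 1 \<ge> 1"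
proof -
  obtain \<sigma> where \<sigma>: "\<And>i. i < K \<Longrightarrow> \<sigma> i < D" "\<And>r. r < R \<Longrightarrow> \<exists>i<K. C r i (\<sigma> i)"
    using assms unfolding csp_sat_def by blast
  define ch where "ch i = opt i (\<sigma> i)" for i
  define T where "T = (\<lambda>i. {ch i, 0}) ` {..<K}"
  let ?F = "edge_set \<union> T"
  have ch: "5 + K \<le> ch i" "ch i < sets_start" "ch i < size" if "i < K" for i
    using opt_bounds[OF that \<sigma>(1)[OF that]] sets_start_le by (auto simp: ch_def)
  have adjI: "(v, w) \<in> adj ?F" if "arc v w \<or> arc w v" for v w
    using that adj_edge_set[of v w] by (auto simp: adj_def)
  have adjT: "(v, w) \<in> adj T \<longleftrightarrow> (\<exists>i<K. v = ch i \<and> w = 0 \<or> v = 0 \<and> w = ch i)" for v w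
    by (auto simp: adj_def T_def doubleton_eq_iff)
  have adjF: "(v, w) \<in> adj ?F \<longleftrightarrow> arc v w \<or> arc w v \<or> (v, w) \<in> adj T" for v w
    using adj_edge_set[of v w] by (auto simp: adj_def)
  have ch0: "(ch i, 0) \<in> adj ?F" if "i < K" for i
    using that by (auto simp: adjF adjT)
  have "T \<subseteq> vertex_pairs V - edge_set"
  proof
    fix e assume "e \<in> T"
    then obtain i where i: "i < K" "e = {ch i, 0}" by (auto simp: T_def)
    have "(ch i, 0) \<notin> adj edge_set" using ch[OF i(1)] by (simp add: adj_edge_set arc_0)
    then show "e \<in> vertex_pairs V - edge_set"
      using i ch[OF i(1)] by (auto simp: adj_def vertex_pairs_def)
  qed
  moreover have "card T \<le> K" unfolding T_def using card_image_le[of "{..<K}"] by simp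
  moreover have "closeness_ratio V ?F 0 1 \<ge> 1"
  proof -
    have w0: "within2 ?F u 0" if "u < size" for u
      using that
    proof (cases rule: vertex_cases)
      case 1
      then have "u = 0 \<or> u = 1 \<or> u = 2 \<or> u = 3" by auto
      then show ?thesis unfolding within2_def using adjI[of 1 2] adjI[of 2 0] adjI[of 3 0] arc_hub(2-4) by auto
    next
      case (2 j)
      then have "arc 2 u" using sets_start_le by (intro arc_hub) auto
      then show ?thesis unfolding within2_def using adjI[of u 2] adjI[of 2 0] arc_hub(2) by auto
    next
      case (3 i v)
      then have "arc 2 u" using opt_bounds[of i v] by (intro arc_hub) auto
      then show ?thesis unfolding within2_def using adjI[of u 2] adjI[of 2 0] arc_hub(2) by auto
    next
      case (4 r j)
      have "\<exists>i<K. member r i (\<sigma> i)"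
        using \<sigma>(2)[of "r - K"] 4(1) by (cases "r < K") (auto simp: member_def)
      then obtain i where i: "i < K" "member r i (\<sigma> i)" by blast
      then have "arc (ch i) u" using arc_opt_setv[OF 4(1,2) i(1) \<sigma>(1)[OF i(1)]] 4(3) by (simp add: ch_def)
      then show ?thesis unfolding within2_def using adjI[of u "ch i"] ch0[OF i(1)] by auto
    qed
    have n0: "{u \<in> V. (u, 0) \<in> adj ?F} = {2, 3} \<union> ch ` {..<K}"
      using size_ge ch by (force simp: adjF adjT arc_0)
    have "inj_on ch {..<K}" using \<sigma>(1) by (auto simp: inj_on_def ch_def opt_inject)
    moreover have "{2, 3} \<inter> ch ` {..<K} = {}" using ch by force
    ultimately have "degree_in V ?F 0 = K + 2"
      unfolding degree_in_def n0 by (subst card_Un_disjoint) (auto simp: card_image)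
    moreover have "{u \<in> V. (u, 1) \<in> adj ?F} = {u \<in> V. (u, 1) \<in> adj edge_set}"
      using ch(1) by (force simp: adjF adjT adj_edge_set)
    then have "degree_in V ?F 1 = K + 2" using degree_b by (simp add: degree_in_def)
    moreover have "(0, 0) \<notin> adj ?F" "(1, 1) \<notin> adj ?F"
      using ch(1) arc_less[of 0 0] arc_less[of 1 1] by (force simp: adjF adjT)+
    ultimately have "closeness V ?F 0 + (K + 4) = 2 * size" "closeness V ?F 1 + (K + 4) = 2 * size"
      using closeness_ge(2)[of V 0 ?F] closeness_ge(2)[of V 1 ?F] w0 within2_b[of ?F] reach_superset[of ?F] size_ge
      by simp_all
    then show ?thesis using size_ge unfolding closeness_ratio_ge_1 by linarith
  qed
  ultimately show ?thesis by blast
qed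

text \<open>New edges cannot increase the closeness of \<open>b\<close>, so that of \<open>a\<close>
  has to drop to the initial value of \<open>b\<close>. By the lower bound on closeness, this needs
  \<open>K\<close> new neighbours of \<open>a\<close>, which uses up the budget, and all vertices
  within distance two of \<open>a\<close>.\<close>

lemma improvement_imp_sat:
  assumes T: "T \<subseteq> vertex_pairs V - edge_set" "card T \<le> K" "closeness_ratio V (edge_set \<union> T) 0 1 \<ge> 1"
  shows "csp_sat K D R C"
proof -
  let ?F = "edge_set \<union> T"
  define N where "N = {u \<in> V. {u, 0} \<in> T}"
  have finT: "finite T"
    by (rule finite_subset[of _ "Pow V"]) (use T(1) in \<open>auto simp: vertex_pairs_def\<close>)
  have finN: "finite N" by (simp add: N_def)
  have noloop: "{u} \<notin> T" for u using T(1) by (auto simp: vertex_pairs_def)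
  have inj: "inj_on (\<lambda>u. {u, 0}) N" by (auto simp: inj_on_def doubleton_eq_iff)
  have sub: "(\<lambda>u. {u, 0}) ` N \<subseteq> T" by (auto simp: N_def)
  have cardN: "card N \<le> K"
    using card_mono[OF finT sub] card_image[OF inj] T(2) by simp
  have adjF: "(v, w) \<in> adj ?F \<longleftrightarrow> arc v w \<or> arc w v \<or> {v, w} \<in> T" for v w
    using adj_edge_set[of v w] by (auto simp: adj_def)
  have n0: "{u \<in> V. (u, 0) \<in> adj ?F} = {2, 3} \<union> N"
    using size_ge by (auto simp: adjF arc_0 N_def)
  then have deg: "degree_in V ?F 0 \<le> card N + 2"
    unfolding degree_in_def n0 using card_Un_le[of "{2, 3 :: nat}" N] by simp
  have r: "\<forall>u\<in>V. (u, 0) \<in> (adj ?F)\<^sup>*" using reach_superset[of ?F] size_ge by simp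
  have l: "(0, 0) \<notin> adj ?F" using arc_less[of 0 0] noloop by (auto simp: adjF)
  have "closeness V ?F 0 = closeness V ?F 1" using T(3) by (simp only: closeness_ratio_ge_1)
  also have "\<dots> \<le> closeness V edge_set 1" using reach size_ge by (intro closeness_mono) auto
  finally have c: "closeness V ?F 0 + (K + 4) \<le> 2 * size" using closeness_b by linarith
  have ge: "2 * size \<le> closeness V ?F 0 + degree_in V ?F 0 + 2"
    using closeness_ge(1)[OF _ _ l r] size_ge by simp
  have "card N = K" and eq: "2 * card V = closeness V ?F 0 + degree_in V ?F 0 + 2"
    using c ge deg cardN by simp_all
  then have w: "within2 ?F u 0" if "u < size" for u
    using closeness_ge(2)[OF _ _ l r] size_ge that by auto
  have TN: "T = (\<lambda>u. {u, 0}) ` N"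
    using card_subset_eq[OF finT sub] card_image[OF inj] card_mono[OF finT sub] T(2) \<open>card N = K\<close> by simp
  \<comment> \<open>The tag is the number of the copy that a new neighbour can interfere with, as
    its helper or as a member of the copy; for vertices of values and for the first four vertices it
    is 0 by truncation, which is harmless. The \<open>K\<close> new neighbours do not exhaust the
    \<open>K + 1\<close> tags, so some copy \<open>j\<close> is left alone.\<close>
  define tag where "tag u = (if u < 5 + K then u - 4 else (u - sets_start) mod (K + 1))" for u
  have "card (tag ` N) \<le> K" using card_image_le[OF finN, of tag] cardN by linarith
  then have "\<not> {..K} \<subseteq> tag ` N" using card_mono[of "tag ` N" "{..K}"] finN by auto
  then obtain j where j: "j \<le> K" "j \<notin> tag ` N" by auto
  \<comment> \<open>A vertex of copy \<open>j\<close> is not itself a new neighbour of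
    \<open>a\<close>, nor is its helper. Hence the middle vertex of its path to \<open>a\<close> is
    the vertex of a value.\<close>
  have hit: "\<exists>i<K. \<exists>v<D. opt i v \<in> N \<and> member r i v" if r: "r < K + R" for r
  proof -
    define s where "s = setv r j"
    have s: "sets_start \<le> s" "s < size" using setv_bounds[OF r j(1)] by (auto simp: s_def)
    have "tag s = j" using s sets_start_le setv_copy[OF j(1), of r] by (auto simp: tag_def s_def)
    then have sN: "s \<notin> N" using j(2) by auto
    have s0: "s \<noteq> 0" "s \<noteq> 2" "s \<noteq> 3" using s sets_start_le by auto
    have "(s, 0) \<notin> adj ?F" using n0 s sN s0 by auto
    then obtain u where u: "(s, u) \<in> adj ?F" "(u, 0) \<in> adj ?F"
      using w[OF s(2)] s0 unfolding within2_def by auto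
    have "{s, u} \<notin> T"
      unfolding TN using sN s0 \<open>(s, 0) \<notin> adj ?F\<close> u(1) by (auto simp: doubleton_eq_iff)
    moreover have "\<not> arc s u" using s sets_start_le by (auto simp: arc_def)
    ultimately have us: "arc u s" using u(1) by (auto simp: adjF)
    then have "u < size" "u \<noteq> 2" "u \<noteq> 3" "u \<noteq> 0" "u \<noteq> 1"
      using arc_less[OF us] s sets_start_le by (auto simp: arc_def)
    then have uN: "u \<in> N" using n0 u(2) by auto
    from \<open>u < size\<close> show ?thesis
    proof (cases rule: vertex_cases)
      case 1
      then show ?thesis using \<open>u \<noteq> 2\<close> \<open>u \<noteq> 3\<close> \<open>u \<noteq> 0\<close> \<open>u \<noteq> 1\<close> by linarith
    next
      case (2 j')
      then have "j' = j" using arc_helper_setv[OF r j(1) 2(1)] us by (simp add: s_def)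
      then have "tag u = j" using 2 by (simp add: tag_def)
      then show ?thesis using uN j(2) by blast
    next
      case (3 i v)
      then show ?thesis using arc_opt_setv[OF r j(1) 3(1,2)] us uN by (auto simp: s_def)
    next
      case (4 r' j')
      then show ?thesis using us s setv_bounds[OF 4(1,2)] sets_start_le by (auto simp: arc_def)
    qed
  qed
  \<comment> \<open>The first \<open>K\<close> constraints demand a value for every slot. As there
    are only \<open>K\<close> new neighbours, each slot gets exactly one, and nothing else is a new
    neighbour.\<close>
  have "\<exists>v<D. opt i v \<in> N" if "i < K" for i
    using hit[of i] that by (auto simp: member_def)
  then obtain \<sigma> where \<sigma>: "\<And>i. i < K \<Longrightarrow> \<sigma> i < D \<and> opt i (\<sigma> i) \<in> N" by metis
  have "inj_on (\<lambda>i. opt i (\<sigma> i)) {..<K}" using \<sigma> by (auto simp: inj_on_def opt_inject)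
  then have "card ((\<lambda>i. opt i (\<sigma> i)) ` {..<K}) = K" by (simp add: card_image)
  moreover have "(\<lambda>i. opt i (\<sigma> i)) ` {..<K} \<subseteq> N" using \<sigma> by auto
  ultimately have N: "(\<lambda>i. opt i (\<sigma> i)) ` {..<K} = N" using card_subset_eq[OF finN] \<open>card N = K\<close> by simp
  have "\<exists>i<K. C r i (\<sigma> i)" if "r < R" for r
  proof -
    obtain i v where iv: "i < K" "v < D" "opt i v \<in> N" "member (K + r) i v" using hit[of "K + r"] \<open>r < R\<close> by auto
    then obtain i' where "i' < K" "opt i v = opt i' (\<sigma> i')" using N by auto
    then have "v = \<sigma> i" using opt_inject[of v "\<sigma> i'" i i'] \<sigma>[of i'] iv by auto
    then show ?thesis using iv by (auto simp: member_def)
  qed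
  then show ?thesis unfolding csp_sat_def using \<sigma> by blast
qed

definition cri :: cri_instance where
  "cri = \<lparr>nverts = size, edges = edge_set, vertex_a = 0, vertex_b = 1, budget = K, target = 1\<rparr>"

lemma cri_valid: "cri_valid cri"
  using connected size_ge by (simp add: cri_valid_def cri_def)

lemma cri_yes: "cri_yes cri \<longleftrightarrow> csp_sat K D R C"
  using sat_imp_improvement improvement_imp_sat by (auto simp: cri_yes_def cri_def)

end


section \<open>Generating encodings\<close>

definition generated :: "(bool list \<Rightarrow> bool list) \<Rightarrow> bool" where
  "generated f \<longleftrightarrow> (\<exists>bs. \<forall>x. f x = blocks_output bs x)"

lemma generated_append:
  assumes "generated f" "generated g" shows "generated (\<lambda>x. f x @ g x)"
proof -
  obtain bs cs where "\<forall>x. f x = blocks_output bs x" "\<forall>x. g x = blocks_output cs x"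
    using assms unfolding generated_def by blast
  then have "\<forall>x. f x @ g x = blocks_output (bs @ cs) x" by (simp add: blocks_output_def)
  then show ?thesis unfolding generated_def by blast
qed

lemma generated_map:
  assumes "definable (\<lambda>x e. n x)" "definable_pred (\<lambda>x e. P x (e 0))"
  shows "generated (\<lambda>x. map (P x) [0..<n x])"
proof -
  obtain a b where "\<forall>x e. eval x e a = n x" "\<forall>x e. eval x e b = of_bool (P x (e 0))"
    using assms unfolding definable_def by blast
  then have "\<forall>x. map (P x) [0..<n x] = blocks_output [(a, b)] x"
    by (simp add: blocks_output_def env1_def)
  then show ?thesis unfolding generated_def by blast
qed

lemma generated_replicate: "definable (\<lambda>x e. n x) \<Longrightarrow> generated (\<lambda>x. replicate (n x) b)"
  using generated_map[of n "\<lambda>x i. b"] by (simp add: definable_TF map_replicate_const)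

lemma generated_const: "generated (\<lambda>x. w)"
proof (induction w)
  case Nil
  have "blocks_output [] x = []" for x by (simp add: blocks_output_def)
  then show ?case unfolding generated_def by metis
next
  case (Cons b w)
  show ?case using generated_append[OF generated_replicate[OF definable_const[of 1], of b] Cons] by simp
qed

lemma generated_sd:
  assumes "generated f" "definable (\<lambda>x e. length (f x))" shows "generated (\<lambda>x. sd (f x))"
  using generated_append[OF generated_replicate[OF assms(2), of True] generated_append[OF generated_const[of "[False]"] assms(1)]]
  by (simp add: sd_def)

text \<open>Flattening the two loops of an adjacency matrix by division with remainder makes it a
  single output block.\<close>

lemma concat_map_upt:
  assumes "0 < n"
  shows "concat (map (\<lambda>u. map (\<lambda>v. P u v) [0..<n]) [0..<m]) = map (\<lambda>i. P (i div n) (i mod n)) [0..<m * n]"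
proof (induction m)
  case (Suc m)
  have "[0..<Suc m * n] = [0..<m * n] @ map (\<lambda>i. i + m * n) [0..<n]"
    using upt_add_eq_append[of 0 "m * n" n] by (simp add: map_add_upt add.commute)
  then show ?case using Suc assms by simp
qed simp

section \<open>Binary numbers without exponentiation\<close>

definition pow2 :: "nat \<Rightarrow> bool" where
  "pow2 p \<longleftrightarrow> 0 < p \<and> (\<forall>q < Suc p. p mod q = 0 \<longrightarrow> q = 1 \<or> q mod 2 = 0)"

text \<open>A number whose divisors other than 1 are all even has odd part 1. Divisibility is
  expressible by bounded quantifiers, in contrast to exponentiation with a variable
  exponent.\<close>

lemma pow2_iff: "pow2 p \<longleftrightarrow> (\<exists>i. p = 2 ^ i)"
proof
  assume "\<exists>i. p = 2 ^ i"
  then obtain i where i: "p = 2 ^ i" by blast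
  have "q = 1 \<or> even q" if "q dvd p" for q
    using that unfolding i by (auto simp: divides_primepow_nat)
  then show "pow2 p" unfolding pow2_def using i by (auto simp: mod_eq_0_iff_dvd)
next
  assume p: "pow2 p"
  then have "p \<noteq> 0" by (simp add: pow2_def)
  then obtain i m where m: "p = 2 ^ i * m" "odd m"
    using multiplicity_decompose'[of p 2] by (metis dvd_refl not_prime_unit two_is_prime_nat)
  have "m dvd p" using m(1) by simp
  then have "m < Suc p" using dvd_imp_le[of m p] \<open>p \<noteq> 0\<close> by simp
  then have "m = 1" using p m unfolding pow2_def by (auto simp: mod_eq_0_iff_dvd)
  then show "\<exists>i. p = 2 ^ i" using m by auto
qed

lemma sum_pow2: "(\<Sum>q < m. of_bool (pow2 q)) = card {i. 2 ^ i < m}"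
proof -
  have "{q. q < m \<and> pow2 q} = (\<lambda>i. 2 ^ i) ` {i. 2 ^ i < m}" by (auto simp: pow2_iff)
  moreover have "card ((\<lambda>i. 2 ^ i :: nat) ` {i. 2 ^ i < m}) = card {i. (2 :: nat) ^ i < m}"
    by (intro card_image) (auto simp: inj_on_def)
  ultimately show ?thesis by (simp add: Int_def conj_commute)
qed

lemma power_le_iff_bin: "2 ^ i \<le> n \<longleftrightarrow> i < length (bin n)"
proof (induction n arbitrary: i rule: bin.induct)
  case (1 n)
  show ?case
  proof (cases "n = 0")
    case True
    then show ?thesis by (simp add: bin.simps)
  next
    case False
    then have l: "length (bin n) = Suc (length (bin (n div 2)))" by (simp add: bin.simps[of n])
    show ?thesis
    proof (cases i)
      case 0
      then show ?thesis using False l by simp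
    next
      case (Suc j)
      have "2 * 2 ^ j \<le> n \<longleftrightarrow> 2 ^ j \<le> n div 2" by auto
      then show ?thesis using 1[OF False, of j] l Suc by simp
    qed
  qed
qed

lemma nth_bin: "i < length (bin n) \<Longrightarrow> bin n ! i = odd (n div 2 ^ i)"
proof (induction n arbitrary: i rule: bin.induct)
  case (1 n)
  then have n: "n \<noteq> 0" by (auto simp: bin.simps[of n] split: if_splits)
  then have b: "bin n = odd n # bin (n div 2)" by (simp add: bin.simps[of n])
  show ?case
  proof (cases i)
    case (Suc j)
    then show ?thesis using 1 n b by (simp add: div_mult2_eq)
  qed (simp add: b)
qed

lemma length_bin: "length (bin n) = (\<Sum>q < Suc n. of_bool (pow2 q))"
  unfolding sum_pow2 less_Suc_eq_le power_le_iff_bin by simp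

text \<open>The exponent of a power \<open>p\<close> of two is the number of smaller powers of two;
  so bit \<open>i\<close> is found by searching for the \<open>p\<close> that has exactly
  \<open>i\<close> powers below it.\<close>

lemma bin_eq_map:
  "bin n = map (\<lambda>i. \<exists>p < Suc n. pow2 p \<and> (\<Sum>q < p. of_bool (pow2 q)) = i \<and> n div p mod 2 = 1) [0..<length (bin n)]"
proof (rule nth_equalityI)
  fix i assume i: "i < length (bin n)"
  have c: "(\<Sum>q < 2 ^ j. of_bool (pow2 q)) = j" for j :: nat
    unfolding sum_pow2 by simp
  have "(\<exists>p < Suc n. pow2 p \<and> (\<Sum>q < p. of_bool (pow2 q)) = i \<and> n div p mod 2 = 1) \<longleftrightarrow> odd (n div 2 ^ i)"
    using i power_le_iff_bin[of i n] c by (auto simp: pow2_iff less_Suc_eq_le odd_iff_mod_2_eq_one)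
  then show "bin n ! i = map (\<lambda>i. \<exists>p < Suc n. pow2 p \<and> (\<Sum>q < p. of_bool (pow2 q)) = i \<and> n div p mod 2 = 1) [0..<length (bin n)] ! i"
    using i nth_bin[OF i] by simp
qed simp

lemma definable_pow2:
  assumes "definable f" shows "definable_pred (\<lambda>x e. pow2 (f x e))"
  unfolding pow2_def by (intro definable_intros definable_mod definable_rename[OF assms] assms)

lemma generated_bin:
  assumes n: "definable (\<lambda>x e. n x)"
  shows "generated (\<lambda>x. bin (n x))" and "definable (\<lambda>x e. length (bin (n x)))"
proof -
  show l: "definable (\<lambda>x e. length (bin (n x)))"
    unfolding length_bin by (intro definable_intros definable_pow2 n)
  have "generated (\<lambda>x. map (\<lambda>i. \<exists>p < Suc (n x). pow2 p \<and> (\<Sum>q < p. of_bool (pow2 q)) = i \<and> n x div p mod 2 = 1) [0..<length (bin (n x))])"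
    by (intro generated_map l definable_intros definable_pow2 definable_div definable_mod n)
  then show "generated (\<lambda>x. bin (n x))" by (simp only: bin_eq_map[symmetric])
qed

lemma definable_arc:
  assumes "definable (\<lambda>x e. K x)" "definable (\<lambda>x e. D x)" "definable (\<lambda>x e. R x)"
    and "\<And>f g h. definable f \<Longrightarrow> definable g \<Longrightarrow> definable h \<Longrightarrow> definable_pred (\<lambda>x e. C x (f x e) (g x e) (h x e))"
    and "definable f" "definable g"
  shows "definable_pred (\<lambda>x e. csp_graph.arc (K x) (D x) (R x) (C x) (f x e) (g x e))"
  unfolding csp_graph.arc_def csp_graph.member_def csp_graph.size_def csp_graph.sets_start_def
  by (intro definable_intros definable_div definable_mod assms)

lemma generated_cri:
  assumes KDR: "definable (\<lambda>x e. K x)" "definable (\<lambda>x e. D x)" "definable (\<lambda>x e. R x)"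
    and C: "\<And>f g h. definable f \<Longrightarrow> definable g \<Longrightarrow> definable h \<Longrightarrow> definable_pred (\<lambda>x e. C x (f x e) (g x e) (h x e))"
  shows "generated (\<lambda>x. enc_cri (csp_graph.cri (K x) (D x) (R x) (C x)))"
proof -
  define n where "n x = csp_graph.size (K x) (D x) (R x)" for x
  define E where "E x = csp_graph.edge_set (K x) (D x) (R x) (C x)" for x
  define P where "P x i \<longleftrightarrow> csp_graph.arc (K x) (D x) (R x) (C x) (i div n x) (i mod n x) \<or>
    csp_graph.arc (K x) (D x) (R x) (C x) (i mod n x) (i div n x)" for x i
  have dn: "definable (\<lambda>x e. n x)"
    unfolding n_def csp_graph.size_def csp_graph.sets_start_def by (intro definable_intros KDR)
  have pos: "0 < n x" for x using csp_graph.size_ge[of "K x" "D x" "R x"] unfolding n_def by linarith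
  have g: "enc_graph (n x) (E x) = map (P x) [0..<n x * n x]" for x
    unfolding enc_graph_def concat_map_upt[OF pos]
    using csp_graph.adj_edge_set[of _ _ "K x" "D x" "R x" "C x"] by (simp add: adj_def E_def P_def)
  have gg: "generated (\<lambda>x. enc_graph (n x) (E x))"
    unfolding g P_def
    by (intro generated_map definable_intros dn definable_arc KDR C definable_div definable_mod) auto
  have gl: "definable (\<lambda>x e. length (enc_graph (n x) (E x)))"
    unfolding g length_map length_upt by (intro definable_intros dn)
  have "enc_cri (csp_graph.cri (K x) (D x) (R x) (C x))
     = sd (enc_graph (n x) (E x)) @ concat (map sd [bin 0, bin 1]) @ sd (bin (K x)) @ concat (map sd [bin 1, bin 1])" for x
    by (simp add: enc_cri_def csp_graph.cri_def n_def E_def)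
  moreover have "generated (\<lambda>x. sd (enc_graph (n x) (E x)) @ concat (map sd [bin 0, bin 1]) @ sd (bin (K x)) @ concat (map sd [bin 1, bin 1]))"
    by (intro generated_append generated_sd generated_const gg gl generated_bin KDR)
  ultimately show ?thesis by simp
qed

section \<open>Languages in NP as constraint satisfaction problems\<close>

text \<open>A finite table is definable by case distinction. In this way the transition function of
  a fixed machine is built into the terms.\<close>

lemma definable_cases:
  assumes "definable f" "\<And>v. definable (H v)"
  shows "definable (\<lambda>x e. if f x e < n then H (f x e) x e else H 0 x e)"
proof (induction n)
  case 0
  then show ?case by (simp add: assms)
next
  case (Suc n)
  have "definable (\<lambda>x e. if f x e = n then H n x e else if f x e < n then H (f x e) x e else H 0 x e)"
    by (intro definable_intros assms Suc)
  then show ?case by (rule definable_cong) (auto simp: less_Suc_eq)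
qed

definition bit_at :: "bool list \<Rightarrow> nat \<Rightarrow> bool" where
  "bit_at x i \<longleftrightarrow> i < length x \<and> x ! i"

lemma definable_bit_at: "definable f \<Longrightarrow> definable_pred (\<lambda>x e. bit_at x (f x e))"
  unfolding bit_at_def by (rule definable_bit)

text \<open>Makes table lookup total: arguments outside the table are treated as 0.\<close>

definition clamp :: "nat \<Rightarrow> nat \<Rightarrow> nat" where
  "clamp n v = (if v < n then v else 0)"

lemma definable_clamp1: "definable f \<Longrightarrow> definable (\<lambda>x e. h (clamp n (f x e)))"
  by (rule definable_cong[OF definable_cases[of f "\<lambda>v x e. h v" n]]) (auto simp: clamp_def definable_intros)

lemma definable_clamp2:
  "definable f \<Longrightarrow> definable g \<Longrightarrow> definable (\<lambda>x e. h (clamp n (f x e)) (clamp m (g x e)))"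
  by (rule definable_cong[OF definable_cases[of f "\<lambda>v x e. h v (clamp m (g x e))" n]])
    (auto simp: clamp_def[of n] definable_clamp1)

text \<open>Number \<open>r\<close> codes a pair in mixed radix, so several bounded parameters of a
  constraint fit into its index.\<close>

lemma all_less_mult: "(\<forall>r < a * b. P (r mod a) (r div a)) \<longleftrightarrow> (\<forall>i < a. \<forall>s < b. P i s)" for a b :: nat
proof (intro iffI allI impI)
  fix i s assume h: "\<forall>r < a * b. P (r mod a) (r div a)" "i < a" "s < b"
  have "a * s + i < a * (s + 1)" using h by simp
  also have "\<dots> \<le> a * b" using h by (intro mult_left_mono) auto
  finally show "P i s" using h(1)[rule_format, of "a * s + i"] h(2) by simp
next
  fix r assume h: "\<forall>i < a. \<forall>s < b. P i s" "r < a * b"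
  have "r div a < b" using h(2) by (simp add: less_mult_imp_div_less mult.commute)
  moreover have "r mod a < a" using h(2) by (cases a) auto
  ultimately show "P (r mod a) (r div a)" using h(1) by blast
qed

lemma all_less_mult6:
  "(\<forall>r < a * (b * (b * (b * (b * b)))). P (r mod a) (r div a mod b) (r div a div b mod b) (r div a div b div b mod b)
      (r div a div b div b div b mod b) (r div a div b div b div b div b)) \<longleftrightarrow>
   (\<forall>k < a. \<forall>t < b. \<forall>t' < b. \<forall>j < b. \<forall>u < b. \<forall>v < b. P k t t' j u v)" for a b :: nat
proof -
  note m = all_less_mult
  show ?thesis
    by (subst m[of a _ "\<lambda>k s. P k (s mod b) (s div b mod b) (s div b div b mod b) (s div b div b div b mod b) (s div b div b div b div b)"],
        subst m[of b _ "\<lambda>t s. P _ t (s mod b) (s div b mod b) (s div b div b mod b) (s div b div b div b)"],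
        subst m[of b _ "\<lambda>t' s. P _ _ t' (s mod b) (s div b mod b) (s div b div b)"],
        subst m[of b _ "\<lambda>j s. P _ _ _ j (s mod b) (s div b)"],
        subst m[of b _ "\<lambda>u s. P _ _ _ _ u s"], rule refl)
qed

lemma content_unvisited:
  assumes "\<And>t. cont (Suc t) = (cont t)(h t := w t)" "\<And>s. t0 \<le> s \<Longrightarrow> s < t \<Longrightarrow> h s \<noteq> y" "t0 \<le> t"
  shows "cont t y = cont t0 y"
  using assms(3,2)
proof (induction t rule: dec_induct)
  case (step t)
  then have "cont t y = cont t0 y" "h t \<noteq> y" by auto
  then show ?case using assms(1)[of t] by simp
qed simp

lemma content_last_visit:
  assumes "\<And>t. cont (Suc t) = (cont t)(h t := w t)" "\<And>s. t' < s \<Longrightarrow> s < t \<Longrightarrow> h s \<noteq> y" "t' < t" "h t' = y"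
  shows "cont t y = w t'"
  using content_unvisited[of cont h w "Suc t'" t y] assms by auto

lemma last_visit_exists:
  assumes "h s = y" "s < (t :: nat)"
  obtains t' where "t' < t" "h t' = y" "\<And>s. t' < s \<Longrightarrow> s < t \<Longrightarrow> h s \<noteq> y"
proof -
  define S where "S = {s. s < t \<and> h s = y}"
  have S: "finite S" "S \<noteq> {}" using assms by (auto simp: S_def)
  define m where "m = Max S"
  have "m \<in> S" using Max_in[OF S] by (simp add: m_def)
  moreover have "h s \<noteq> y" if "m < s" "s < t" for s
  proof
    assume "h s = y"
    then have "s \<in> S" using that by (simp add: S_def)
    then show False using Max_ge[OF S(1), of s] that(1) by (simp add: m_def)
  qed
  ultimately show ?thesis by (intro that[of m]) (auto simp: S_def)
qed

text \<open>
  There is a slot for the state and the symbols read at each time (a \<open>view\<close>), a slot for each head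
  position at each time, shifted by the total time, and a slot for each cell of the certificate.
\<close>

locale tableau =
  fixes M :: tm and p q :: "nat poly"
  assumes wf: "tm_wf M"
begin

section \<open>Transitions of the machine as finite tables over views\<close>

definition views :: "(nat \<times> nat list) list" where
  "views = (SOME l. set l = {..states M} \<times> {ss. set ss \<subseteq> {..<symbols M} \<and> length ss = tapes M})"

lemma set_views: "set views = {..states M} \<times> {ss. set ss \<subseteq> {..<symbols M} \<and> length ss = tapes M}"
proof -
  have "finite ({..states M} \<times> {ss. set ss \<subseteq> {..<symbols M} \<and> length ss = tapes M})"
    by (intro finite_cartesian_product finite_lists_length_eq) auto
  then show ?thesis unfolding views_def using finite_list by (metis (mono_tags, lifting) someI_ex)
qed

lemma K2: "2 \<le> tapes M" "3 \<le> symbols M" "0 < states M"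
  using wf by (simp_all add: tm_wf_def)

lemma views_nonempty: "0 < length views"
proof -
  have "(0, replicate (tapes M) 0) \<in> set views" using K2 by (auto simp: set_views)
  then show ?thesis by (cases views) auto
qed

definition view :: "nat \<Rightarrow> nat \<times> nat list" where
  "view v = views ! clamp (length views) v"

lemma view_in: "view v \<in> set views"
  using views_nonempty by (auto simp: view_def clamp_def)

definition vstate :: "nat \<Rightarrow> nat" where
  "vstate v = fst (view v)"

definition vread :: "nat \<Rightarrow> nat \<Rightarrow> nat" where
  "vread v j = snd (view v) ! clamp (tapes M) j"

definition vnext :: "nat \<Rightarrow> nat" where
  "vnext v = (case view v of (s, ss) \<Rightarrow> if s < states M then fst (delta M s ss) else s)"

definition vwrite :: "nat \<Rightarrow> nat \<Rightarrow> nat" where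
  "vwrite v j = (case view v of (s, ss) \<Rightarrow>
     if s < states M then fst (snd (delta M s ss) ! clamp (tapes M) j) else ss ! clamp (tapes M) j)"

text \<open>With the codes 0, 1, 2, the new position plus 1 is the old position plus the code, so
  natural numbers suffice. A halted machine rewrites what it reads and stays.\<close>

definition vmove :: "nat \<Rightarrow> nat \<Rightarrow> nat" where
  "vmove v j = (case view v of (s, ss) \<Rightarrow>
     if s < states M then (case snd (snd (delta M s ss) ! clamp (tapes M) j) of GoLeft \<Rightarrow> 0 | Stay \<Rightarrow> 1 | GoRight \<Rightarrow> 2)
     else 1)"

lemma definable_v:
  "definable f \<Longrightarrow> definable (\<lambda>x e. vstate (f x e))"
  "definable f \<Longrightarrow> definable (\<lambda>x e. vnext (f x e))"
  "definable f \<Longrightarrow> definable g \<Longrightarrow> definable (\<lambda>x e. vread (f x e) (g x e))"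
  "definable f \<Longrightarrow> definable g \<Longrightarrow> definable (\<lambda>x e. vwrite (f x e) (g x e))"
  "definable f \<Longrightarrow> definable g \<Longrightarrow> definable (\<lambda>x e. vmove (f x e) (g x e))"
  unfolding vstate_def vnext_def vread_def vwrite_def vmove_def view_def
  by (erule definable_clamp1 | erule (1) definable_clamp2)+

definition cert_len :: "bool list \<Rightarrow> nat" where
  "cert_len x = poly p (length x)"

definition sd_len :: "bool list \<Rightarrow> nat" where
  "sd_len x = 2 * length x + 1"

definition time :: "bool list \<Rightarrow> nat" where
  "time x = poly q (sd_len x + cert_len x)"

text \<open>One generous bound for the values of all kinds of slots as well as for the times, tapes
  and positions that the constraints range over.\<close>

definition dom_size :: "bool list \<Rightarrow> nat" where
  "dom_size x = length views + 2 * time x + 4 + tapes M + cert_len x"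

definition view_slot :: "nat \<Rightarrow> nat" where
  "view_slot t = t * (tapes M + 1)"

definition pos_slot :: "nat \<Rightarrow> nat \<Rightarrow> nat" where
  "pos_slot t j = t * (tapes M + 1) + (j + 1)"

definition cert_slot :: "bool list \<Rightarrow> nat \<Rightarrow> nat" where
  "cert_slot x i = (time x + 1) * (tapes M + 1) + i"

definition slots :: "bool list \<Rightarrow> nat" where
  "slots x = (time x + 1) * (tapes M + 1) + cert_len x"

definition cert_cell :: "bool list \<Rightarrow> nat \<Rightarrow> nat \<Rightarrow> bool" where
  "cert_cell x j u \<longleftrightarrow> j = 0 \<and> time x + sd_len x \<le> u \<and> u < time x + sd_len x + cert_len x"

text \<open>The initial content outside the certificate, at positions shifted by the total time: on
  tape \<open>0\<close> the three cases are the length in unary, the separator and the bits of the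
  word.\<close>

definition sd_cell :: "bool list \<Rightarrow> nat \<Rightarrow> nat \<Rightarrow> nat" where
  "sd_cell x j u =
     (if j = 0 \<and> time x \<le> u \<and> u < time x + sd_len x
      then (if u - time x < length x then 2 else if u - time x = length x then 1
            else if bit_at x (u - time x - length x - 1) then 2 else 1)
      else 0)"

definition cert_symbol :: "nat \<Rightarrow> nat" where
  "cert_symbol v = (if v = 0 then 0 else if v = 1 then 1 else 2)"

text \<open>The kinds \<open>k\<close> are: initial state, initial head positions, next state, head
  moves, reading a cell last visited at time \<open>t'\<close>, reading a cell for the first time,
  acceptance, and the shape of the certificate. A premise that a slot has value \<open>v\<close>
  appears as the disjunct that it has another value. If the parameters are out of range for their
  kind, every pair satisfies the formula.\<close>

definition clause :: "bool list \<Rightarrow> nat \<Rightarrow> nat \<Rightarrow> nat \<Rightarrow> nat \<Rightarrow> nat \<Rightarrow> nat \<Rightarrow> nat \<Rightarrow> nat \<Rightarrow> bool" where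
  "clause x k t t' j u v i w \<longleftrightarrow>
    (k = 0 \<longrightarrow> i = view_slot 0 \<and> vstate w = 0) \<and>
    (k = 1 \<and> j < tapes M \<longrightarrow> i = pos_slot 0 j \<and> w = time x) \<and>
    (k = 2 \<and> t < time x \<longrightarrow> i = view_slot t \<and> w \<noteq> v \<or> i = view_slot (t + 1) \<and> vstate w = vnext v) \<and>
    (k = 3 \<and> t < time x \<and> j < tapes M \<longrightarrow>
       i = view_slot t \<and> w \<noteq> v \<or> i = pos_slot t j \<and> w \<noteq> u \<or> i = pos_slot (t + 1) j \<and> w + 1 = u + vmove v j) \<and>
    (k = 4 \<and> t' < t \<and> t < time x + 1 \<and> j < tapes M \<longrightarrow>
       i = view_slot t' \<and> w \<noteq> v \<or> i = pos_slot t' j \<and> w \<noteq> u \<or> i = pos_slot t j \<and> w \<noteq> u \<or>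
       (\<exists>s < t. t' < s \<and> i = pos_slot s j \<and> w = u) \<or> i = view_slot t \<and> vread w j = vwrite v j) \<and>
    (k = 5 \<and> t < time x + 1 \<and> j < tapes M \<longrightarrow>
       i = pos_slot t j \<and> w \<noteq> u \<or> (\<exists>s < t. i = pos_slot s j \<and> w = u) \<or>
       \<not> cert_cell x j u \<and> i = view_slot t \<and> vread w j = sd_cell x j u \<or>
       cert_cell x j u \<and> (i = cert_slot x (u - (time x + sd_len x)) \<and> w \<noteq> v \<or> i = view_slot t \<and> vread w j = cert_symbol v)) \<and>
    (k = 6 \<and> t < time x + 1 \<longrightarrow>
       i = view_slot t \<and> vwrite w 1 = 2 \<or> i = pos_slot t 1 \<and> w \<noteq> time x \<or>
       (\<exists>s < time x + 1. t < s \<and> i = pos_slot s 1 \<and> w = time x)) \<and>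
    (k = 7 \<and> u + 1 < cert_len x \<longrightarrow> i = cert_slot x u \<and> w \<noteq> 0 \<or> i = cert_slot x (u + 1) \<and> w = 0)"

definition constraint :: "bool list \<Rightarrow> nat \<Rightarrow> nat \<Rightarrow> nat \<Rightarrow> bool" where
  "constraint x r i w \<longleftrightarrow> (let b = dom_size x in
     clause x (r mod 8) (r div 8 mod b) (r div 8 div b mod b) (r div 8 div b div b mod b)
       (r div 8 div b div b div b mod b) (r div 8 div b div b div b div b) i w)"

definition constraints :: "bool list \<Rightarrow> nat" where
  "constraints x = (let b = dom_size x in 8 * (b * (b * (b * (b * b)))))"

lemma definable_params:
  "definable (\<lambda>x e. cert_len x)" "definable (\<lambda>x e. time x)" "definable (\<lambda>x e. sd_len x)"
  "definable (\<lambda>x e. dom_size x)" "definable (\<lambda>x e. slots x)" "definable (\<lambda>x e. constraints x)"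
  unfolding cert_len_def time_def sd_len_def dom_size_def slots_def constraints_def Let_def
  by (intro definable_intros definable_poly)+

lemma definable_clause:
  assumes "definable k" "definable t" "definable t'" "definable j" "definable u" "definable v" "definable i" "definable w"
  shows "definable_pred (\<lambda>x e. clause x (k x e) (t x e) (t' x e) (j x e) (u x e) (v x e) (i x e) (w x e))"
  unfolding clause_def view_slot_def pos_slot_def cert_slot_def cert_cell_def sd_cell_def cert_symbol_def
  by (intro definable_intros definable_params definable_v definable_bit_at assms assms[THEN definable_rename])

lemma definable_constraint:
  "definable r \<Longrightarrow> definable i \<Longrightarrow> definable w \<Longrightarrow> definable_pred (\<lambda>x e. constraint x (r x e) (i x e) (w x e))"
  unfolding constraint_def Let_def
  by (intro definable_clause definable_intros definable_params definable_mod definable_div)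

definition spec :: "bool list \<Rightarrow> (nat \<Rightarrow> nat) \<Rightarrow> (nat \<Rightarrow> nat \<Rightarrow> nat) \<Rightarrow> (nat \<Rightarrow> nat) \<Rightarrow> bool" where
  "spec x cf ps ct \<longleftrightarrow>
     vstate (cf 0) = 0 \<and>
     (\<forall>j < tapes M. ps 0 j = time x) \<and>
     (\<forall>t < time x. vstate (cf (t + 1)) = vnext (cf t)) \<and>
     (\<forall>t < time x. \<forall>j < tapes M. ps (t + 1) j + 1 = ps t j + vmove (cf t) j) \<and>
     (\<forall>t < time x + 1. \<forall>t' < t. \<forall>j < tapes M. ps t' j = ps t j \<longrightarrow> (\<forall>s < t. t' < s \<longrightarrow> ps s j \<noteq> ps t j) \<longrightarrow>
        vread (cf t) j = vwrite (cf t') j) \<and>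
     (\<forall>t < time x + 1. \<forall>j < tapes M. (\<forall>s < t. ps s j \<noteq> ps t j) \<longrightarrow>
        vread (cf t) j = (if cert_cell x j (ps t j) then cert_symbol (ct (ps t j - (time x + sd_len x))) else sd_cell x j (ps t j))) \<and>
     (\<forall>t < time x + 1. ps t 1 = time x \<longrightarrow> (\<forall>s < time x + 1. t < s \<longrightarrow> ps s 1 \<noteq> time x) \<longrightarrow> vwrite (cf t) 1 = 2) \<and>
     (\<forall>u. u + 1 < cert_len x \<longrightarrow> ct u = 0 \<longrightarrow> ct (u + 1) = 0)"

lemma slot_bounds:
  "t < time x + 1 \<Longrightarrow> view_slot t < slots x"
  "t < time x + 1 \<Longrightarrow> j < tapes M \<Longrightarrow> pos_slot t j < slots x"
  "i < cert_len x \<Longrightarrow> cert_slot x i < slots x"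
proof -
  have t: "t * (tapes M + 1) + (tapes M + 1) \<le> (time x + 1) * (tapes M + 1)" if "t < time x + 1"
    using mult_right_mono[of "t + 1" "time x + 1" "tapes M + 1"] that by simp
  show "t < time x + 1 \<Longrightarrow> view_slot t < slots x"
    using t unfolding view_slot_def slots_def by linarith
  show "t < time x + 1 \<Longrightarrow> j < tapes M \<Longrightarrow> pos_slot t j < slots x"
    using t unfolding pos_slot_def slots_def by linarith
  show "i < cert_len x \<Longrightarrow> cert_slot x i < slots x"
    by (simp add: cert_slot_def slots_def)
qed

lemma all_less_8: "(\<forall>k < 8. P k) \<longleftrightarrow> P 0 \<and> P 1 \<and> P 2 \<and> P 3 \<and> P 4 \<and> P 5 \<and> P 6 \<and> P (7 :: nat)"
proof -
  have "k < 8 \<longleftrightarrow> k = 0 \<or> k = 1 \<or> k = 2 \<or> k = 3 \<or> k = 4 \<or> k = 5 \<or> k = 6 \<or> k = 7" for k :: nat by auto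
  then show ?thesis by (simp only: imp_disjL all_conj_distrib simp_thms)
qed

text \<open>For each kind, the disjunction over slots is an implication whose premises fix the
  values \<open>u\<close> and \<open>v\<close>. Since the constraints range over all values that
  slots may have, these parameters disappear in \<open>spec\<close>.\<close>

lemma constraints_iff_spec:
  assumes dom: "\<forall>i < slots x. \<sigma> i < dom_size x"
  shows "(\<forall>r < constraints x. \<exists>i < slots x. constraint x r i (\<sigma> i)) \<longleftrightarrow>
    spec x (\<lambda>t. \<sigma> (view_slot t)) (\<lambda>t j. \<sigma> (pos_slot t j)) (\<lambda>i. \<sigma> (cert_slot x i))"
proof -
  define b T K where "b = dom_size x" and "T = time x" and "K = slots x"
  define cf ps ct where "cf = (\<lambda>t. \<sigma> (view_slot t))" and "ps = (\<lambda>t j. \<sigma> (pos_slot t j))" and "ct = (\<lambda>i. \<sigma> (cert_slot x i))"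
  note sb = slot_bounds[of _ x, folded T_def K_def]
  have b: "T + 1 < b" "\<And>j. j < tapes M \<Longrightarrow> j < b" "\<And>u. u < cert_len x \<Longrightarrow> u < b" "0 < b"
    by (auto simp: b_def T_def dom_size_def)
  have K: "0 < K" "1 < tapes M" using K2 by (auto simp: K_def slots_def)
  have v: "cf t < b" "j < tapes M \<Longrightarrow> ps t j < b" if "t < T + 1" for t j
    using dom sb that by (auto simp: cf_def ps_def b_def K_def)
  have vc: "ct u < b" if "u < cert_len x" for u
    using dom sb that by (auto simp: ct_def b_def K_def)
  have cc: "u - (T + sd_len x) < cert_len x" if "cert_cell x j u" for j u
    using that by (auto simp: cert_cell_def T_def)
  have c0: "(\<exists>i < K. clause x 0 t t' j u v i (\<sigma> i)) \<longleftrightarrow> vstate (cf 0) = 0" for t t' j u v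
    using sb(1)[of 0] by (auto simp: clause_def cf_def)
  have c1: "(\<exists>i < K. clause x 1 t t' j u v i (\<sigma> i)) \<longleftrightarrow> (j < tapes M \<longrightarrow> ps 0 j = T)" for t t' j u v
    using sb(2)[of 0 j] K by (auto simp: clause_def ps_def T_def)
  have c2: "(\<exists>i < K. clause x 2 t t' j u v i (\<sigma> i)) \<longleftrightarrow> (t < T \<longrightarrow> cf t = v \<longrightarrow> vstate (cf (t + 1)) = vnext v)" for t t' j u v
    using sb(1)[of t] sb(1)[of "t + 1"] K by (cases "t < T") (auto simp: clause_def cf_def T_def)
  have c3: "(\<exists>i < K. clause x 3 t t' j u v i (\<sigma> i)) \<longleftrightarrow> (t < T \<and> j < tapes M \<longrightarrow> cf t = v \<longrightarrow> ps t j = u \<longrightarrow> ps (t + 1) j + 1 = u + vmove v j)" for t t' j u v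
    using sb(1)[of t] sb(2)[of t j] sb(2)[of "t + 1" j] K by (cases "t < T \<and> j < tapes M") (auto simp: clause_def cf_def ps_def T_def)
  have c4: "(\<exists>i < K. clause x 4 t t' j u v i (\<sigma> i)) \<longleftrightarrow> (t' < t \<and> t < T + 1 \<and> j < tapes M \<longrightarrow> cf t' = v \<longrightarrow> ps t' j = u \<longrightarrow>
      ps t j = u \<longrightarrow> (\<forall>s < t. t' < s \<longrightarrow> ps s j \<noteq> u) \<longrightarrow> vread (cf t) j = vwrite v j)" for t t' j u v
  proof (cases "t' < t \<and> t < T + 1 \<and> j < tapes M")
    case True
    have sbj: "pos_slot s j < K" if "s < t" for s using True that sb(2)[of s j] by simp
    have "(\<exists>i < K. \<exists>s < t. t' < s \<and> i = pos_slot s j \<and> \<sigma> i = u) \<longleftrightarrow> (\<exists>s < t. t' < s \<and> ps s j = u)"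
      unfolding ps_def using sbj by blast
    moreover have "(\<exists>i < K. clause x 4 t t' j u v i (\<sigma> i)) \<longleftrightarrow> cf t' \<noteq> v \<or> ps t' j \<noteq> u \<or> ps t j \<noteq> u \<or>
       (\<exists>i < K. \<exists>s < t. t' < s \<and> i = pos_slot s j \<and> \<sigma> i = u) \<or> vread (cf t) j = vwrite v j"
      using True sb(1)[of t] sb(1)[of t'] sb(2)[of t j] sb(2)[of t' j] by (auto simp: clause_def cf_def ps_def T_def)
    ultimately show ?thesis using True by blast
  qed (use K in \<open>auto simp: clause_def T_def\<close>)
  have c5: "(\<exists>i < K. clause x 5 t t' j u v i (\<sigma> i)) \<longleftrightarrow> (t < T + 1 \<and> j < tapes M \<longrightarrow> ps t j = u \<longrightarrow> (\<forall>s < t. ps s j \<noteq> u) \<longrightarrow>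
     (if cert_cell x j u then ct (u - (T + sd_len x)) = v \<longrightarrow> vread (cf t) j = cert_symbol v else vread (cf t) j = sd_cell x j u))" for t t' j u v
  proof (cases "t < T + 1 \<and> j < tapes M")
    case True
    have sbj: "pos_slot s j < K" if "s < t" for s using True that sb(2)[of s j] by simp
    have "(\<exists>i < K. \<exists>s < t. i = pos_slot s j \<and> \<sigma> i = u) \<longleftrightarrow> (\<exists>s < t. ps s j = u)"
      unfolding ps_def using sbj by blast
    moreover have "(\<exists>i < K. clause x 5 t t' j u v i (\<sigma> i)) \<longleftrightarrow> ps t j \<noteq> u \<or>
       (\<exists>i < K. \<exists>s < t. i = pos_slot s j \<and> \<sigma> i = u) \<or>
       (if cert_cell x j u then ct (u - (T + sd_len x)) \<noteq> v \<or> vread (cf t) j = cert_symbol v else vread (cf t) j = sd_cell x j u)"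
      using True sb(1)[of t] sb(2)[of t j] sb(3)[OF cc, of j u] by (auto simp: clause_def cf_def ps_def ct_def T_def)
    ultimately show ?thesis using True by auto
  qed (use K in \<open>auto simp: clause_def T_def\<close>)
  have c6: "(\<exists>i < K. clause x 6 t t' j u v i (\<sigma> i)) \<longleftrightarrow> (t < T + 1 \<longrightarrow> ps t 1 = T \<longrightarrow> (\<forall>s < T + 1. t < s \<longrightarrow> ps s 1 \<noteq> T) \<longrightarrow> vwrite (cf t) 1 = 2)" for t t' j u v
  proof (cases "t < T + 1")
    case True
    have "(\<exists>i < K. \<exists>s < T + 1. t < s \<and> i = pos_slot s 1 \<and> \<sigma> i = T) \<longleftrightarrow> (\<exists>s < T + 1. t < s \<and> ps s 1 = T)"
      unfolding ps_def using sb(2)[OF _ K(2)] by blast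
    moreover have "(\<exists>i < K. clause x 6 t t' j u v i (\<sigma> i)) \<longleftrightarrow> ps t 1 \<noteq> T \<or>
       (\<exists>i < K. \<exists>s < T + 1. t < s \<and> i = pos_slot s 1 \<and> \<sigma> i = T) \<or> vwrite (cf t) 1 = 2"
      using True sb(1)[of t] sb(2)[of t 1] K by (auto simp: clause_def cf_def ps_def T_def)
    ultimately show ?thesis using True by blast
  qed (use K in \<open>auto simp: clause_def T_def\<close>)
  have c7: "(\<exists>i < K. clause x 7 t t' j u v i (\<sigma> i)) \<longleftrightarrow> (u + 1 < cert_len x \<longrightarrow> ct u = 0 \<longrightarrow> ct (u + 1) = 0)" for t t' j u v
    using sb(3)[of u] sb(3)[of "u + 1"] K by (cases "u + 1 < cert_len x") (auto simp: clause_def ct_def)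
  have "(\<forall>r < constraints x. \<exists>i < K. constraint x r i (\<sigma> i)) \<longleftrightarrow>
    (\<forall>k < 8. \<forall>t < b. \<forall>t' < b. \<forall>j < b. \<forall>u < b. \<forall>v < b. \<exists>i < K. clause x k t t' j u v i (\<sigma> i))"
    unfolding constraints_def constraint_def Let_def b_def[symmetric] by (rule all_less_mult6)
  \<comment> \<open>In the direction to \<open>spec\<close>, the parameters are instantiated with
    the actual values of the slots, which lie below \<open>b\<close>.\<close>
  also have "\<dots> \<longleftrightarrow> spec x cf ps ct"
    unfolding all_less_8 c0 c1 c2 c3 c4 c5 c6 c7 spec_def T_def[symmetric]
  proof (intro conj_cong)
    show "(\<forall>t<b. \<forall>t'<b. \<forall>j<b. \<forall>u<b. \<forall>v<b. vstate (cf 0) = 0) \<longleftrightarrow> vstate (cf 0) = 0"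
      using b by auto
    show "(\<forall>t<b. \<forall>t'<b. \<forall>j<b. \<forall>u<b. \<forall>v<b. j < tapes M \<longrightarrow> ps 0 j = T) \<longleftrightarrow> (\<forall>j<tapes M. ps 0 j = T)"
      using b by auto
    show "(\<forall>t<b. \<forall>t'<b. \<forall>j<b. \<forall>u<b. \<forall>v<b. t < T \<longrightarrow> cf t = v \<longrightarrow> vstate (cf (t + 1)) = vnext v) \<longleftrightarrow>
      (\<forall>t<T. vstate (cf (t + 1)) = vnext (cf t))"
      using b v(1) by (smt (verit) add_lessD1 less_add_one less_trans)
    show "(\<forall>t<b. \<forall>t'<b. \<forall>j<b. \<forall>u<b. \<forall>v<b. t < T \<and> j < tapes M \<longrightarrow> cf t = v \<longrightarrow> ps t j = u \<longrightarrow> ps (t + 1) j + 1 = u + vmove v j) \<longleftrightarrow>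
      (\<forall>t<T. \<forall>j<tapes M. ps (t + 1) j + 1 = ps t j + vmove (cf t) j)"
      using b v by (smt (verit) add_lessD1 less_add_one less_trans)
    show "(\<forall>t<b. \<forall>t'<b. \<forall>j<b. \<forall>u<b. \<forall>v<b. t' < t \<and> t < T + 1 \<and> j < tapes M \<longrightarrow> cf t' = v \<longrightarrow> ps t' j = u \<longrightarrow>
      ps t j = u \<longrightarrow> (\<forall>s < t. t' < s \<longrightarrow> ps s j \<noteq> u) \<longrightarrow> vread (cf t) j = vwrite v j) \<longleftrightarrow>
      (\<forall>t < T + 1. \<forall>t' < t. \<forall>j < tapes M. ps t' j = ps t j \<longrightarrow> (\<forall>s < t. t' < s \<longrightarrow> ps s j \<noteq> ps t j) \<longrightarrow>
        vread (cf t) j = vwrite (cf t') j)" (is "?l \<longleftrightarrow> ?r")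
    proof
      assume l: ?l
      show ?r
      proof (intro allI impI)
        fix t t' j assume a: "t < T + 1" "t' < t" "j < tapes M" "ps t' j = ps t j" "\<forall>s < t. t' < s \<longrightarrow> ps s j \<noteq> ps t j"
        moreover have "t < b" "t' < b" "j < b" "ps t j < b" "cf t' < b" using a b v(2)[of t j] v(1)[of t'] by auto
        ultimately show "vread (cf t) j = vwrite (cf t') j" using l by blast
      qed
    qed metis
    show "(\<forall>t<b. \<forall>t'<b. \<forall>j<b. \<forall>u<b. \<forall>v<b. t < T + 1 \<and> j < tapes M \<longrightarrow> ps t j = u \<longrightarrow> (\<forall>s < t. ps s j \<noteq> u) \<longrightarrow>
     (if cert_cell x j u then ct (u - (T + sd_len x)) = v \<longrightarrow> vread (cf t) j = cert_symbol v else vread (cf t) j = sd_cell x j u)) \<longleftrightarrow>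
      (\<forall>t < T + 1. \<forall>j < tapes M. (\<forall>s < t. ps s j \<noteq> ps t j) \<longrightarrow>
        vread (cf t) j = (if cert_cell x j (ps t j) then cert_symbol (ct (ps t j - (T + sd_len x))) else sd_cell x j (ps t j)))"
      (is "?l \<longleftrightarrow> ?r")
    proof
      assume l: ?l
      show ?r
      proof (intro allI impI)
        fix t j assume a: "t < T + 1" "j < tapes M" "\<forall>s < t. ps s j \<noteq> ps t j"
        have bd: "t < b" "0 < b" "j < b" "ps t j < b" using a b v(2)[of t j] by auto
        have "ct (ps t j - (T + sd_len x)) < b" if "cert_cell x j (ps t j)" using vc cc[OF that] by simp
        then show "vread (cf t) j = (if cert_cell x j (ps t j) then cert_symbol (ct (ps t j - (T + sd_len x))) else sd_cell x j (ps t j))"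
          using l[rule_format, OF bd(1,2,3,4), of "if cert_cell x j (ps t j) then ct (ps t j - (T + sd_len x)) else 0"] a bd by auto
      qed
    qed auto
    show "(\<forall>t<b. \<forall>t'<b. \<forall>j<b. \<forall>u<b. \<forall>v<b. t < T + 1 \<longrightarrow> ps t 1 = T \<longrightarrow> (\<forall>s < T + 1. t < s \<longrightarrow> ps s 1 \<noteq> T) \<longrightarrow> vwrite (cf t) 1 = 2) \<longleftrightarrow>
      (\<forall>t < T + 1. ps t 1 = T \<longrightarrow> (\<forall>s < T + 1. t < s \<longrightarrow> ps s 1 \<noteq> T) \<longrightarrow> vwrite (cf t) 1 = 2)"
      (is "?l \<longleftrightarrow> ?r")
    proof
      assume l: ?l
      show ?r
      proof (intro allI impI)
        fix t assume a: "t < T + 1" "ps t 1 = T" "\<forall>s < T + 1. t < s \<longrightarrow> ps s 1 \<noteq> T"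
        have "t < b" using a(1) b(1) by simp
        then show "vwrite (cf t) 1 = 2" using l a b(4) by blast
      qed
    qed blast
    show "(\<forall>t<b. \<forall>t'<b. \<forall>j<b. \<forall>u<b. \<forall>v<b. u + 1 < cert_len x \<longrightarrow> ct u = 0 \<longrightarrow> ct (u + 1) = 0) \<longleftrightarrow>
      (\<forall>u. u + 1 < cert_len x \<longrightarrow> ct u = 0 \<longrightarrow> ct (u + 1) = 0)"
      using b(3)[OF Suc_lessD] b(4) by auto
  qed
  finally show ?thesis unfolding K_def cf_def ps_def ct_def .
qed

section \<open>Actual runs of the machine in terms of views\<close>

definition run :: "bool list \<Rightarrow> nat \<Rightarrow> config" where
  "run z t = (tm_step M ^^ t) (tm_init M z)"

definition cont :: "bool list \<Rightarrow> nat \<Rightarrow> nat \<Rightarrow> int \<Rightarrow> nat" where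
  "cont z t j = fst (snd (run z t) ! j)"

definition head :: "bool list \<Rightarrow> nat \<Rightarrow> nat \<Rightarrow> int" where
  "head z t j = snd (snd (run z t) ! j)"

definition code :: "bool list \<Rightarrow> nat \<Rightarrow> nat" where
  "code z t = (SOME v. v < length views \<and> views ! v = (fst (run z t), map head_read (snd (run z t))))"

lemma run_inv: "fst (run z t) \<le> states M" "length (snd (run z t)) = tapes M" "cells_below (symbols M) (snd (run z t))"
  using msteps_inv[OF tm_wf_mwf[OF wf], of 0 "init_tapes (tapes M) z" t "fst (run z t)" "snd (run z t)"]
    init_tapes_inv[OF K2(1,2), of z] K2(3)
  by (auto simp: run_def tm_init_eq tm_step_eq_mstep)

lemma code: "code z t < length views" "view (code z t) = (fst (run z t), map head_read (snd (run z t)))"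
proof -
  have "(fst (run z t), map head_read (snd (run z t))) \<in> set views"
    using run_inv[where z = z and t = t] head_read_below[OF run_inv(3)[where z = z and t = t]]
    by (simp add: set_views subset_eq)
  then have "\<exists>v. v < length views \<and> views ! v = (fst (run z t), map head_read (snd (run z t)))"
    by (meson in_set_conv_nth)
  then have *: "code z t < length views \<and> views ! code z t = (fst (run z t), map head_read (snd (run z t)))"
    unfolding code_def by (rule someI_ex)
  then show "code z t < length views" "view (code z t) = (fst (run z t), map head_read (snd (run z t)))"
    by (simp_all add: view_def clamp_def)
qed

lemma run_start:
  "vstate (code z 0) = 0" "j < tapes M \<Longrightarrow> head z 0 j = 0"
  "j < tapes M \<Longrightarrow> cont z 0 j y = (if j = 0 then tape_of z y else 0)"
  by (auto simp: vstate_def code run_def tm_init_def head_def cont_def nth_Cons' tape_of_def)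

lemma run_read: "j < tapes M \<Longrightarrow> vread (code z t) j = cont z t j (head z t j)"
  by (simp add: vread_def code clamp_def run_inv cont_def head_def head_read_eq)

lemma run_step:
  assumes j: "j < tapes M"
  shows "vstate (code z (Suc t)) = vnext (code z t)"
    and "cont z (Suc t) j = (cont z t j)(head z t j := vwrite (code z t) j)"
    and "head z (Suc t) j + 1 = head z t j + int (vmove (code z t) j)"
proof -
  obtain s ts where r: "run z t = (s, ts)" by fastforce
  have len: "length ts = tapes M" and s: "s \<le> states M"
    using run_inv(1,2)[where z = z and t = t] r by auto
  have v: "view (code z t) = (s, map head_read ts)" using code(2)[where z = z and t = t] r by simp
  show "vstate (code z (Suc t)) = vnext (code z t)"
    "cont z (Suc t) j = (cont z t j)(head z t j := vwrite (code z t) j)"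
    "head z (Suc t) j + 1 = head z t j + int (vmove (code z t) j)"
  proof (atomize (full), cases "s < states M")
    case True
    obtain s' as where d: "delta M s (map head_read ts) = (s', as)" by fastforce
    have las: "length as = tapes M"
      using wf True d len head_read_below[OF run_inv(3)[where z = z and t = t]] r unfolding tm_wf_def
      by (metis length_map snd_conv)
    have r': "run z (Suc t) = (s', map2 head_act as ts)" using r True d by (simp add: run_def)
    show "vstate (code z (Suc t)) = vnext (code z t) \<and> cont z (Suc t) j = (cont z t j)(head z t j := vwrite (code z t) j) \<and>
      head z (Suc t) j + 1 = head z t j + int (vmove (code z t) j)"
      using r r' v d True j len las
      by (auto simp: vstate_def vnext_def code(2) cont_def head_def vwrite_def vmove_def clamp_def fst_head_act snd_head_act split: move.splits)
  next
    case False
    then have r': "run z (Suc t) = (s, ts)" using r by (simp add: run_def)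
    then show "vstate (code z (Suc t)) = vnext (code z t) \<and> cont z (Suc t) j = (cont z t j)(head z t j := vwrite (code z t) j) \<and>
      head z (Suc t) j + 1 = head z t j + int (vmove (code z t) j)"
      using r v False j len
      by (auto simp: vstate_def vnext_def code(2) cont_def head_def vwrite_def vmove_def clamp_def head_read_eq)
  qed
qed

text \<open>Because of this bound, positions shifted by the total time are natural numbers.\<close>

lemma head_bound: "j < tapes M \<Longrightarrow> \<bar>head z t j\<bar> \<le> int t"
proof (induction t)
  case (Suc t)
  have "vmove (code z t) j \<le> 2" by (auto simp: vmove_def split: prod.splits move.splits)
  then show ?case using Suc run_step(3)[of j z t] by auto
qed (simp add: run_start)

lemma cont_last:
  assumes "j < tapes M" "t' < t" "head z t' j = y" "\<And>s. t' < s \<Longrightarrow> s < t \<Longrightarrow> head z s j \<noteq> y"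
  shows "cont z t j y = vwrite (code z t') j"
  using content_last_visit[of "\<lambda>t. cont z t j" "\<lambda>t. head z t j" "\<lambda>t. vwrite (code z t) j" t' t y] run_step(2)[OF assms(1)] assms by blast

lemma cont_first:
  assumes "j < tapes M" "\<And>s. s < t \<Longrightarrow> head z s j \<noteq> y"
  shows "cont z t j y = (if j = 0 then tape_of z y else 0)"
  using content_unvisited[of "\<lambda>t. cont z t j" "\<lambda>t. head z t j" "\<lambda>t. vwrite (code z t) j" 0 t y] run_step(2)[OF assms(1)]
    run_start(3)[OF assms(1)] assms(2) by auto

definition initial :: "bool list \<Rightarrow> (nat \<Rightarrow> nat) \<Rightarrow> nat \<Rightarrow> nat \<Rightarrow> nat" where
  "initial x ct j u = (if cert_cell x j u then cert_symbol (ct (u - (time x + sd_len x))) else sd_cell x j u)"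

lemma length_sd: "length (sd x) = sd_len x"
  by (simp add: sd_def sd_len_def)

lemma initial_eq:
  assumes w: "length w \<le> cert_len x" "\<And>i. i < cert_len x \<Longrightarrow> cert_symbol (ct i) = (if i < length w then if w ! i then 2 else 1 else 0)"
  shows "initial x ct j u = (if j = 0 then tape_of (sd x @ w) (int u - int (time x)) else 0)"
proof (cases "j = 0 \<and> time x \<le> u")
  case True
  then obtain h where h: "u = time x + h" "j = 0" using le_Suc_ex by blast
  have t: "tape_of (sd x @ w) (int u - int (time x)) = (if h < sd_len x + length w then if (sd x @ w) ! h then 2 else 1 else 0)"
    by (simp add: tape_of_def h length_sd)
  consider "h < sd_len x" | "sd_len x \<le> h" "h < sd_len x + cert_len x" | "sd_len x + cert_len x \<le> h" by linarith
  then show ?thesis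
  proof cases
    case 1
    then have "initial x ct j u = (if sd x ! h then 2 else 1)"
      by (auto simp: initial_def cert_cell_def sd_cell_def h bit_at_def sd_def sd_len_def nth_append nth_Cons')
    then show ?thesis using 1 h t by (simp add: nth_append length_sd)
  next
    case 2
    then have "initial x ct j u = cert_symbol (ct (h - sd_len x))"
      by (simp add: initial_def cert_cell_def h)
    then show ?thesis using 2 h t w(2)[of "h - sd_len x"] by (auto simp: nth_append length_sd)
  next
    case 3
    then show ?thesis using h t w(1) by (simp add: initial_def cert_cell_def sd_cell_def)
  qed
next
  case False
  then show ?thesis by (auto simp: initial_def cert_cell_def sd_cell_def tape_of_def)
qed

text \<open>The views at times \<open>0\<close> to \<open>t\<close> include what is written at time
  \<open>t\<close>, so they determine the output after \<open>Suc t\<close> steps.\<close>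

definition accepts :: "bool list \<Rightarrow> nat \<Rightarrow> bool" where
  "accepts z t \<longleftrightarrow> cont z (Suc t) 1 0 = 2"

lemma accepts_imp_spec:
  assumes w: "length w \<le> cert_len x" "accepts (sd x @ w) (time x)"
  defines "z \<equiv> sd x @ w"
  shows "spec x (code z) (\<lambda>t j. nat (head z t j + int (time x))) (\<lambda>i. if i < length w then if w ! i then 2 else 1 else 0)"
proof -
  let ?T = "time x"
  define ct where "ct = (\<lambda>i. if i < length w then if w ! i then 2 else 1 else 0 :: nat)"
  define ps where "ps = (\<lambda>t j. nat (head z t j + int ?T))"
  have ps: "int (ps t j) = head z t j + int ?T" if "t < ?T + 1" "j < tapes M" for t j
    using head_bound[OF that(2), of z t] that(1) by (auto simp: ps_def)
  have ps_eq: "ps t j = ps t' j \<longleftrightarrow> head z t j = head z t' j" if "t < ?T + 1" "t' < ?T + 1" "j < tapes M" for t t' j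
    using ps[OF that(1,3)] ps[OF that(2,3)] by linarith
  have ps_T: "ps t j = ?T \<longleftrightarrow> head z t j = 0" if "t < ?T + 1" "j < tapes M" for t j
    using ps[OF that] by linarith
  have j1: "1 < tapes M" "0 < tapes M" using K2 by auto
  have ini: "initial x ct j u = (if j = 0 then tape_of z (int u - int ?T) else 0)" for j u
    unfolding z_def by (rule initial_eq[OF w(1)]) (simp add: cert_symbol_def ct_def)
  have "spec x (code z) ps ct"
    unfolding spec_def initial_def[symmetric]
  proof (intro conjI allI impI)
    show "vstate (code z 0) = 0" by (rule run_start)
    show "ps 0 j = ?T" if "j < tapes M" for j using that by (simp add: ps_T run_start)
    show "vstate (code z (t + 1)) = vnext (code z t)" for t using run_step(1)[OF j1(1)] by simp
    show "ps (t + 1) j + 1 = ps t j + vmove (code z t) j" if "t < ?T" "j < tapes M" for t j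
      using run_step(3)[OF that(2), of z t] ps[of t j] ps[of "Suc t" j] that by simp
    show "vread (code z t) j = vwrite (code z t') j"
      if a: "t < ?T + 1" "t' < t" "j < tapes M" "ps t' j = ps t j" "\<forall>s<t. t' < s \<longrightarrow> ps s j \<noteq> ps t j" for t t' j
      unfolding run_read[OF a(3)]
      by (rule cont_last[OF a(3,2)]) (use a ps_eq[of _ t j] in auto)
    show "vread (code z t) j = initial x ct j (ps t j)"
      if a: "t < ?T + 1" "j < tapes M" "\<forall>s<t. ps s j \<noteq> ps t j" for t j
    proof -
      have "cont z t j (head z t j) = (if j = 0 then tape_of z (head z t j) else 0)"
        by (rule cont_first[OF a(2)]) (use a ps_eq[of _ t j] in auto)
      moreover have "int (ps t j) - int ?T = head z t j" using ps[OF a(1,2)] by simp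
      ultimately show ?thesis unfolding ini run_read[OF a(2)] by (simp only:)
    qed
    show "vwrite (code z t) 1 = 2"
      if a: "t < ?T + 1" "ps t 1 = ?T" "\<forall>s<?T + 1. t < s \<longrightarrow> ps s 1 \<noteq> ?T" for t
      using cont_last[OF j1(1), of t "Suc ?T" z 0] w(2) a ps_T j1(1) by (auto simp: accepts_def z_def[symmetric])
    show "ct (u + 1) = 0" if "ct u = 0" for u using that by (auto simp: ct_def split: if_splits)
  qed
  then show ?thesis unfolding ps_def ct_def .
qed

text \<open>The certificate is read off its slots, and the remaining slots are then forced to
  describe the run on it.\<close>

lemma spec_imp_accepts:
  assumes "spec x cf ps ct"
  shows "\<exists>w. length w \<le> cert_len x \<and> accepts (sd x @ w) (time x)"
proof -
  let ?T = "time x"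
  note s = assms[unfolded spec_def initial_def[symmetric]]
  \<comment> \<open>The certificate ends at its first blank or at the maximal length; by the last
    condition of \<open>spec\<close>, only blanks follow the first one.\<close>
  define n where "n = (LEAST u. cert_len x \<le> u \<or> ct u = 0)"
  have n1: "cert_len x \<le> n \<or> ct n = 0" unfolding n_def by (rule LeastI[of _ "cert_len x"]) simp
  have n2: "n \<le> cert_len x" unfolding n_def by (rule Least_le) simp
  have n3: "ct u \<noteq> 0" if "u < n" for u using not_less_Least[OF that[unfolded n_def]] by simp
  have n4: "ct u = 0" if "n \<le> u" "u < cert_len x" for u
    using that
  proof (induction u rule: dec_induct)
    case base
    then show ?case using n1 by simp
  next
    case (step u)
    then show ?case using s by simp
  qed
  define w where "w = map (\<lambda>i. ct i \<noteq> 1) [0..<n]"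
  define z where "z = sd x @ w"
  have lw: "length w = n" by (simp add: w_def)
  have ini: "initial x ct j u = (if j = 0 then tape_of z (int u - int ?T) else 0)" for j u
    unfolding z_def
  proof (rule initial_eq)
    show "cert_symbol (ct i) = (if i < length w then if w ! i then 2 else 1 else 0)" if "i < cert_len x" for i
      using that n3[of i] n4[of i] by (auto simp: cert_symbol_def w_def)
  qed (simp add: lw n2)
  \<comment> \<open>The induction is over all earlier times, because the symbol read at
    \<open>t\<close> may have been written at any of them.\<close>
  have main: "view (cf t) = view (code z t) \<and> (\<forall>j < tapes M. int (ps t j) = head z t j + int ?T)" if "t < ?T + 1" for t
    using that
  proof (induction t rule: less_induct)
    case (less t)
    have IHv: "view (cf t') = view (code z t')" if "t' < t" for t' using less that by simp
    have IHp: "int (ps t' j) = head z t' j + int ?T" if "t' < t" "j < tapes M" for t' j using less that by simp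
    have st: "vstate (cf t) = vstate (code z t)"
    proof (cases t)
      case 0
      then show ?thesis using s run_start(1) by simp
    next
      case (Suc t')
      have "vnext (cf t') = vnext (code z t')" using IHv[of t'] Suc by (simp add: vnext_def)
      then show ?thesis using s Suc less.prems run_step(1)[of 0 z t'] K2 by simp
    qed
    have pos: "int (ps t j) = head z t j + int ?T" if j: "j < tapes M" for j
    proof (cases t)
      case 0
      then show ?thesis using s run_start(2)[OF j] j by simp
    next
      case (Suc t')
      have "vmove (cf t') j = vmove (code z t') j" using IHv[of t'] Suc by (simp add: vmove_def)
      moreover have "ps (t' + 1) j + 1 = ps t' j + vmove (cf t') j" using s Suc less.prems j by simp
      ultimately show ?thesis using Suc run_step(3)[OF j, of z t'] IHp[of t' j] j by simp
    qed
    have eq: "ps t' j = ps t j \<longleftrightarrow> head z t' j = head z t j" if "t' < t" "j < tapes M" for t' j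
      using IHp[OF that] pos[OF that(2)] by linarith
    have rd: "vread (cf t) j = vread (code z t) j" if j: "j < tapes M" for j
    proof (cases "\<exists>t' < t. head z t' j = head z t j")
      case True
      then obtain t' where t': "t' < t" "head z t' j = head z t j" "\<And>s. t' < s \<Longrightarrow> s < t \<Longrightarrow> head z s j \<noteq> head z t j"
        using last_visit_exists[of "\<lambda>t. head z t j" _ "head z t j" t] by blast
      have "vread (cf t) j = vwrite (cf t') j" using s less.prems t' j eq by auto
      also have "\<dots> = vwrite (code z t') j" using IHv[OF t'(1)] by (simp add: vwrite_def)
      also have "\<dots> = cont z t j (head z t j)" using cont_last[OF j t'(1,2)] t'(3) by simp
      finally show ?thesis using run_read[OF j] by simp
    next
      case False
      then have "vread (cf t) j = initial x ct j (ps t j)" using s less.prems j eq by auto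
      also have "\<dots> = (if j = 0 then tape_of z (head z t j) else 0)"
      proof -
        have "int (ps t j) - int ?T = head z t j" using pos[OF j] by simp
        then show ?thesis unfolding ini by (simp only:)
      qed
      also have "\<dots> = cont z t j (head z t j)" using cont_first[OF j, of t z "head z t j"] False by auto
      finally show ?thesis using run_read[OF j] by simp
    qed
    have "view (cf t) = view (code z t)"
    proof (rule prod_eqI)
      show "fst (view (cf t)) = fst (view (code z t))" using st by (simp add: vstate_def)
      show "snd (view (cf t)) = snd (view (code z t))"
      proof (rule nth_equalityI)
        have l: "length (snd (view v)) = tapes M" for v using view_in[of v] by (auto simp: set_views)
        then show "length (snd (view (cf t))) = length (snd (view (code z t)))" by simp
        show "snd (view (cf t)) ! j = snd (view (code z t)) ! j" if "j < length (snd (view (cf t)))" for j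
          using rd[of j] that l by (simp add: vread_def clamp_def)
      qed
    qed
    then show ?case using pos by blast
  qed
  have j1: "1 < tapes M" using K2 by simp
  \<comment> \<open>A last visit to the output cell exists, since the head starts there.\<close>
  obtain t where t: "t < Suc ?T" "head z t 1 = 0" "\<And>s. t < s \<Longrightarrow> s < Suc ?T \<Longrightarrow> head z s 1 \<noteq> 0"
    using last_visit_exists[of "\<lambda>t. head z t 1" 0 0 "Suc ?T"] run_start(2)[OF j1] by blast
  have p1: "ps s 1 = ?T \<longleftrightarrow> head z s 1 = 0" if "s < ?T + 1" for s using main[OF that] j1 by force
  have "vwrite (cf t) 1 = 2" using s t p1 by auto
  then have "vwrite (code z t) 1 = 2" using main[of t] t(1) by (simp add: vwrite_def)
  then have "accepts z ?T" unfolding accepts_def using cont_last[OF j1 t(1,2,3)] by simp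
  then show ?thesis using n2 lw unfolding z_def by auto
qed

lemma csp_sat_iff:
  "csp_sat (slots x) (dom_size x) (constraints x) (constraint x) \<longleftrightarrow>
    (\<exists>w. length w \<le> cert_len x \<and> accepts (sd x @ w) (time x))"
proof
  assume "csp_sat (slots x) (dom_size x) (constraints x) (constraint x)"
  then show "\<exists>w. length w \<le> cert_len x \<and> accepts (sd x @ w) (time x)"
    unfolding csp_sat_def using constraints_iff_spec[of x] spec_imp_accepts[of x] by blast
next
  assume "\<exists>w. length w \<le> cert_len x \<and> accepts (sd x @ w) (time x)"
  then obtain w where w: "length w \<le> cert_len x" "accepts (sd x @ w) (time x)" by blast
  define z where "z = sd x @ w"
  define A where "A = tapes M + 1"
  define ps where "ps t j = nat (head z t j + int (time x))" for t j
  define ct where "ct i = (if i < length w then if w ! i then 2 else 1 else 0 :: nat)" for i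
  \<comment> \<open>Each time owns \<open>A\<close> consecutive slots, its view followed by the head
    positions; the slots of the certificate come last.\<close>
  define \<sigma> where "\<sigma> i = (if i < (time x + 1) * A then if i mod A = 0 then code z (i div A) else ps (i div A) (i mod A - 1)
    else ct (i - (time x + 1) * A))" for i
  have sp: "spec x (code z) ps ct"
    using accepts_imp_spec[OF w] by (simp only: z_def[symmetric] ps_def[symmetric] ct_def[symmetric] fun_eq_iff)
  have A: "0 < A" by (simp add: A_def)
  have lt: "t * A + j < (time x + 1) * A" if "t < time x + 1" "j < A" for t j
  proof -
    have "(t + 1) * A \<le> (time x + 1) * A" using that by (intro mult_right_mono) auto
    moreover have "t * A + j < (t + 1) * A" using that by simp
    ultimately show ?thesis by linarith
  qed
  have s1: "\<sigma> (view_slot t) = code z t" if "t < time x + 1" for t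
    using lt[OF that A] A unfolding \<sigma>_def view_slot_def A_def[symmetric] by simp
  have s2: "\<sigma> (pos_slot t j) = ps t j" if "t < time x + 1" "j < tapes M" for t j
  proof -
    have j: "j + 1 < A" using that by (simp add: A_def)
    have "(t * A + (j + 1)) mod A = j + 1" "(t * A + (j + 1)) div A = t"
      by (subst mod_mult_self3 div_mult_self3; use j A in simp)+
    then show ?thesis using lt[OF that(1) j] unfolding \<sigma>_def pos_slot_def A_def[symmetric] by simp
  qed
  have s3: "\<sigma> (cert_slot x i) = ct i" for i
    unfolding \<sigma>_def cert_slot_def A_def[symmetric] by simp
  have dom: "\<sigma> i < dom_size x" if "i < slots x" for i
  proof (cases "i < (time x + 1) * A")
    case True
    then have t: "i div A < time x + 1" by (rule less_mult_imp_div_less)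
    have "i mod A < A" using A by simp
    then have j: "i mod A - 1 < tapes M" using K2(1) unfolding A_def by linarith
    have "ps (i div A) (i mod A - 1) < dom_size x"
      using head_bound[OF j, of z "i div A"] t by (simp add: ps_def dom_size_def)
    moreover have "code z (i div A) < dom_size x" using code(1)[of z "i div A"] by (simp add: dom_size_def)
    ultimately show ?thesis using True by (simp add: \<sigma>_def)
  next
    case False
    then show ?thesis by (auto simp: \<sigma>_def ct_def dom_size_def)
  qed
  have "spec x (\<lambda>t. \<sigma> (view_slot t)) (\<lambda>t j. \<sigma> (pos_slot t j)) (\<lambda>i. \<sigma> (cert_slot x i))"
  proof -
    have "1 < tapes M" using K2 by simp
    then show ?thesis using sp unfolding spec_def s3 by (simp add: s1 s2)
  qed
  then show "csp_sat (slots x) (dom_size x) (constraints x) (constraint x)"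
    unfolding csp_sat_def using constraints_iff_spec[of x \<sigma>] dom by blast
qed

end

lemma poly_nat_mono: "a \<le> b \<Longrightarrow> poly (p :: nat poly) a \<le> poly p b"
  by (induction p) (auto intro: add_mono mult_mono)

text \<open>The verifier answers with one bit, so acceptance is symbol 2 in cell \<open>0\<close> of
  the output tape. Its time bound is taken at the maximal length of an input with certificate;
  waiting longer does not change a halted configuration.\<close>

lemma NP_csp:
  assumes "L \<in> class_NP"
  obtains K D R C where "definable (\<lambda>x e. K x)" "definable (\<lambda>x e. D x)" "definable (\<lambda>x e. R x)"
    "\<And>f g h. definable f \<Longrightarrow> definable g \<Longrightarrow> definable h \<Longrightarrow> definable_pred (\<lambda>x e. C x (f x e) (g x e) (h x e))"
    "\<And>x. x \<in> L \<longleftrightarrow> csp_sat (K x) (D x) (R x) (C x)"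
proof -
  obtain R p where R: "R \<in> class_P" "\<And>x. x \<in> L \<longleftrightarrow> (\<exists>w. length w \<le> poly p (length x) \<and> sd x @ w \<in> R)"
    using assms unfolding class_NP_def by blast
  obtain M q where M: "tm_wf M" "\<And>z. computes_within M z [z \<in> R] (poly q (length z))"
    using R(1) unfolding class_P_def polytime_def by blast
  interpret tableau M p q by unfold_locales (rule M(1))
  have acc: "accepts (sd x @ w) (time x) \<longleftrightarrow> sd x @ w \<in> R" if "length w \<le> cert_len x" for x w
  proof -
    have "length (sd x @ w) \<le> sd_len x + cert_len x" using that by (simp add: length_sd)
    then have "poly q (length (sd x @ w)) \<le> Suc (time x)" unfolding time_def by (intro le_SucI poly_nat_mono)
    from computes_within_mono[OF M(2) this]
    have "cont (sd x @ w) (Suc (time x)) 1 = tape_of [sd x @ w \<in> R]"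
      by (auto simp: computes_within_def cont_def run_def split: prod.splits)
    then show ?thesis by (simp add: accepts_def tape_of_def)
  qed
  have "x \<in> L \<longleftrightarrow> csp_sat (slots x) (dom_size x) (constraints x) (constraint x)" for x
    unfolding csp_sat_iff R(2) using acc[of _ x] by (auto simp: cert_len_def)
  then show ?thesis
    using that[of slots dom_size constraints constraint] definable_params(4-6) definable_constraint by blast
qed

section \<open>Weighted circuits of weft two as constraint satisfaction problems\<close>

subsection \<open>Reading an encoded circuit\<close>

text \<open>Length of the run of ones that starts at position \<open>a\<close>; this is how unary
  prefixes are decoded.\<close>

definition lead :: "bool list \<Rightarrow> nat \<Rightarrow> nat" where
  "lead z a = (\<Sum>i < length z. of_bool (\<forall>l < Suc i. bit_at z (a + l)))"

lemma lead_eq: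
  assumes "\<And>l. l < n \<Longrightarrow> bit_at z (a + l)" "\<not> bit_at z (a + n)"
  shows "lead z a = n"
proof -
  have "n \<le> length z"
  proof (cases n)
    case (Suc m)
    then show ?thesis using assms(1)[of m] by (simp add: bit_at_def)
  qed simp
  have "(\<forall>l < Suc i. bit_at z (a + l)) \<longleftrightarrow> i < n" for i
    using assms by (metis less_Suc_eq less_trans not_less_eq)
  then have "lead z a = (\<Sum>i < length z. of_bool (i < n))" by (simp add: lead_def)
  also have "\<dots> = card {i. i < length z \<and> i < n}" by (simp add: Int_def)
  also have "{i. i < length z \<and> i < n} = {..<n}" using \<open>n \<le> length z\<close> by auto
  finally show ?thesis by simp
qed

definition weight :: "bool list \<Rightarrow> nat" where
  "weight z = lead z 0"

text \<open>The first row of the circuit begins with its own length in unary, which is the number of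
  gates plus two bits for the label.\<close>

definition gates :: "bool list \<Rightarrow> nat" where
  "gates z = lead z (weight z + 1) - 2"

text \<open>Position of the label of gate \<open>j\<close>. A row for \<open>n\<close> gates
  occupies \<open>2 * (n + 2) + 1\<close> bits, and its label follows \<open>n + 2\<close> ones and
  a separator. As all rows have equal length, they can be addressed directly.\<close>

definition gate_pos :: "bool list \<Rightarrow> nat \<Rightarrow> nat" where
  "gate_pos z j = weight z + 1 + (j * (2 * gates z + 5) + (gates z + 3))"

definition inp :: "bool list \<Rightarrow> nat \<Rightarrow> bool" where
  "inp z j \<longleftrightarrow> \<not> bit_at z (gate_pos z j) \<and> \<not> bit_at z (gate_pos z j + 1)"

definition neg :: "bool list \<Rightarrow> nat \<Rightarrow> bool" where
  "neg z j \<longleftrightarrow> \<not> bit_at z (gate_pos z j) \<and> bit_at z (gate_pos z j + 1)"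

definition conj_gate :: "bool list \<Rightarrow> nat \<Rightarrow> bool" where
  "conj_gate z j \<longleftrightarrow> bit_at z (gate_pos z j) \<and> \<not> bit_at z (gate_pos z j + 1)"

definition mem :: "bool list \<Rightarrow> nat \<Rightarrow> nat \<Rightarrow> bool" where
  "mem z j i \<longleftrightarrow> i < gates z \<and> bit_at z (gate_pos z j + 2 + i)"

definition large :: "bool list \<Rightarrow> nat \<Rightarrow> bool" where
  "large z j \<longleftrightarrow> (2 :: nat) < (\<Sum>i < gates z. of_bool (mem z j i))"

text \<open>Tells the two in-neighbours of a small gate apart.\<close>

definition not_first :: "bool list \<Rightarrow> nat \<Rightarrow> nat \<Rightarrow> bool" where
  "not_first z j i \<longleftrightarrow> (\<exists>l < i. mem z j l)"

text \<open>Gate \<open>j\<close> has value \<open>s\<close> if all (rather than some) in-neighbours have the appropriate value.\<close>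

definition universal :: "bool list \<Rightarrow> bool \<Rightarrow> nat \<Rightarrow> bool" where
  "universal z s j \<longleftrightarrow> neg z j \<or> (conj_gate z j \<longleftrightarrow> s)"

lemma definable_weight: "definable (\<lambda>x e. weight x)"
  unfolding weight_def lead_def by (intro definable_intros definable_bit_at)

lemma definable_gates: "definable (\<lambda>x e. gates x)"
  unfolding gates_def lead_def by (intro definable_intros definable_bit_at definable_weight)

lemma definable_gate_preds:
  assumes "definable j"
  shows "definable_pred (\<lambda>x e. inp x (j x e))" "definable_pred (\<lambda>x e. neg x (j x e))"
    "definable_pred (\<lambda>x e. conj_gate x (j x e))" "definable_pred (\<lambda>x e. universal x s (j x e))"
    "definable_pred (\<lambda>x e. large x (j x e))"
  unfolding inp_def neg_def conj_gate_def universal_def gate_pos_def large_def mem_def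
  by (intro definable_intros definable_bit_at definable_weight definable_gates definable_rename[OF assms] assms)+

lemma definable_mem:
  assumes "definable j" "definable i"
  shows "definable_pred (\<lambda>x e. mem x (j x e) (i x e))" "definable_pred (\<lambda>x e. not_first x (j x e) (i x e))"
  unfolding mem_def not_first_def gate_pos_def
  by (intro definable_intros definable_bit_at definable_weight definable_gates
      definable_rename[OF assms(1)] definable_rename[OF assms(2)] assms)+

lemma nth_concat_equal_lengths:
  "(\<And>b. b \<in> set bs \<Longrightarrow> length b = n) \<Longrightarrow> j < length bs \<Longrightarrow> i < n \<Longrightarrow> concat bs ! (j * n + i) = bs ! j ! i"
proof (induction bs arbitrary: j)
  case (Cons b bs)
  then show ?case by (cases j) (auto simp: nth_append)
qed simp

lemma enc_circuit_bit:
  assumes "circuit_wf C" "j < length C" "i < 2 * length C + 5"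
  shows "bit_at (enc_par (enc_circuit C, k)) (k + 1 + (j * (2 * length C + 5) + i)) \<longleftrightarrow>
    sd (enc_label (fst (C ! j)) @ map (\<lambda>l. l \<in> snd (C ! j)) [0..<length C]) ! i"
proof -
  define bs where "bs = map (\<lambda>(l, S). sd (enc_label l @ map (\<lambda>j. j \<in> S) [0..<length C])) C"
  have ll: "length (enc_label l) = 2" for l by (cases l) auto
  have len: "length b = 2 * length C + 5" if "b \<in> set bs" for b
    using that by (auto simp: bs_def sd_def ll)
  have lbs: "length (concat bs) = length C * (2 * length C + 5)"
  proof -
    have "map length bs = map (\<lambda>_. 2 * length C + 5) bs" using len by (intro map_cong) auto
    then have "sum_list (map length bs) = sum_list (map (\<lambda>_. 2 * length C + 5) bs)" by (simp only:)
    then have "sum_list (map length bs) = length bs * (2 * length C + 5)" by (simp add: sum_list_triv)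
    then show ?thesis by (simp add: length_concat bs_def)
  qed
  have "j * (2 * length C + 5) + i < (j + 1) * (2 * length C + 5)" using assms by simp
  also have "\<dots> \<le> length C * (2 * length C + 5)" using assms by (intro mult_right_mono) auto
  finally have lt: "j * (2 * length C + 5) + i < length (concat bs)" by (simp only: lbs)
  have "concat bs ! (j * (2 * length C + 5) + i) = bs ! j ! i"
    using assms len by (intro nth_concat_equal_lengths) (auto simp: bs_def)
  also have "bs ! j = sd (enc_label (fst (C ! j)) @ map (\<lambda>l. l \<in> snd (C ! j)) [0..<length C])"
    using assms(2) by (simp add: bs_def case_prod_unfold)
  finally have c: "concat bs ! (j * (2 * length C + 5) + i) \<longleftrightarrow>
    sd (enc_label (fst (C ! j)) @ map (\<lambda>l. l \<in> snd (C ! j)) [0..<length C]) ! i" by simp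
  have z: "enc_par (enc_circuit C, k) = replicate k True @ False # concat bs"
    by (simp add: enc_circuit_def bs_def)
  have "(replicate k True @ False # concat bs) ! (k + 1 + (j * (2 * length C + 5) + i)) = concat bs ! (j * (2 * length C + 5) + i)"
    by (simp add: nth_append)
  then show ?thesis unfolding bit_at_def z using lt c by simp
qed

lemma sd_circuit_nth:
  assumes "length lb = 2"
  shows "l < n + 2 \<Longrightarrow> sd (lb @ map P [0..<n]) ! l" "\<not> sd (lb @ map P [0..<n]) ! (n + 2)"
    "sd (lb @ map P [0..<n]) ! (n + 3) = lb ! 0" "sd (lb @ map P [0..<n]) ! (n + 4) = lb ! 1"
    "i < n \<Longrightarrow> sd (lb @ map P [0..<n]) ! (n + 5 + i) = P i"
  using assms by (auto simp: sd_def nth_append nth_Cons')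

lemma circuit_wf_nth:
  assumes "circuit_wf C" "i < length C"
  shows "snd (C ! i) \<subseteq> {..<i}" "fst (C ! i) = Not \<Longrightarrow> card (snd (C ! i)) = 1"
    "fst (C ! i) \<noteq> Input \<Longrightarrow> snd (C ! i) \<noteq> {}"
proof -
  obtain l S where "C ! i = (l, S)" by fastforce
  then show "snd (C ! i) \<subseteq> {..<i}" "fst (C ! i) = Not \<Longrightarrow> card (snd (C ! i)) = 1"
    "fst (C ! i) \<noteq> Input \<Longrightarrow> snd (C ! i) \<noteq> {}"
    using assms unfolding circuit_wf_def by (cases l; fastforce)+
qed

context
  fixes C :: circuit and k :: nat
  assumes C: "circuit_wf C"
begin

private abbreviation "z \<equiv> enc_par (enc_circuit C, k)"
private abbreviation "n \<equiv> length C"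

private lemma n_pos: "0 < n"
  using C by (auto simp: circuit_wf_def)

private lemma ll: "length (enc_label l) = 2"
  by (cases l) auto

lemma weight_enc: "weight z = k"
  unfolding weight_def by (rule lead_eq) (auto simp: bit_at_def nth_append)

lemma gates_enc: "gates z = n"
proof -
  have "lead z (k + 1) = n + 2"
  proof (rule lead_eq)
    show "bit_at z (k + 1 + l)" if "l < n + 2" for l
      using enc_circuit_bit[OF C n_pos, of l k] that sd_circuit_nth(1)[OF ll] by (simp del: enc_par.simps)
    show "\<not> bit_at z (k + 1 + (n + 2))"
      using enc_circuit_bit[OF C n_pos, of "n + 2" k] sd_circuit_nth(2)[OF ll] by (simp del: enc_par.simps)
  qed
  then show ?thesis by (simp add: gates_def weight_enc del: enc_par.simps)
qed

lemma gate_enc: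
  assumes j: "j < n"
  shows "inp z j \<longleftrightarrow> fst (C ! j) = Input" "neg z j \<longleftrightarrow> fst (C ! j) = Not" "conj_gate z j \<longleftrightarrow> fst (C ! j) = And"
    "mem z j i \<longleftrightarrow> i \<in> snd (C ! j)"
proof -
  have b: "bit_at z (gate_pos z j) \<longleftrightarrow> enc_label (fst (C ! j)) ! 0" "bit_at z (gate_pos z j + 1) \<longleftrightarrow> enc_label (fst (C ! j)) ! 1"
    using enc_circuit_bit[OF C j, of "n + 3" k] enc_circuit_bit[OF C j, of "n + 4" k]
      sd_circuit_nth(3,4)[OF ll, where n = n]
    by (simp_all add: gate_pos_def weight_enc gates_enc add.assoc del: enc_par.simps)
  have m: "bit_at z (gate_pos z j + 2 + i) \<longleftrightarrow> i \<in> snd (C ! j)" if "i < n"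
    using enc_circuit_bit[OF C j, of "n + 5 + i" k] sd_circuit_nth(5)[OF ll that] that
    by (simp add: gate_pos_def weight_enc gates_enc add.assoc del: enc_par.simps)
  have "snd (C ! j) \<subseteq> {..<j}" using circuit_wf_nth(1)[OF C j] .
  then show "mem z j i \<longleftrightarrow> i \<in> snd (C ! j)"
    using m j by (auto simp: mem_def gates_enc simp del: enc_par.simps)
  show "inp z j \<longleftrightarrow> fst (C ! j) = Input" "neg z j \<longleftrightarrow> fst (C ! j) = Not" "conj_gate z j \<longleftrightarrow> fst (C ! j) = And"
    unfolding inp_def neg_def conj_gate_def b by (cases "fst (C ! j)"; simp)+
qed

lemma large_enc: "j < n \<Longrightarrow> large z j \<longleftrightarrow> card (snd (C ! j)) > 2"
proof -
  assume j: "j < n"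
  have "snd (C ! j) \<subseteq> {..<j}" using circuit_wf_nth(1)[OF C j] .
  then have "{i. i < n \<and> i \<in> snd (C ! j)} = snd (C ! j)" using j by auto
  then show ?thesis
    unfolding large_def gates_enc gate_enc(4)[OF j] by (simp add: Int_def)
qed

end


subsection \<open>The constraints\<close>

definition digit :: "nat \<Rightarrow> nat \<Rightarrow> nat \<Rightarrow> nat" where
  "digit b n l = n div b ^ l mod b"

lemma digits_exist:
  assumes "length xs = s" "\<And>y. y \<in> set xs \<Longrightarrow> y < b"
  shows "\<exists>n < b ^ s. \<forall>l < s. digit b n l = xs ! l"
  using assms
proof (induction s arbitrary: xs)
  case (Suc s)
  then obtain y ys where ys: "xs = y # ys" "length ys = s" by (cases xs) auto
  then obtain n where n: "n < b ^ s" "\<forall>l < s. digit b n l = ys ! l"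
    using Suc.IH[of ys] Suc.prems(2) by (metis list.set_intros(2))
  have y: "y < b" using Suc.prems ys by simp
  have "digit b (y + b * n) l = xs ! l" if "l < Suc s" for l
  proof (cases l)
    case 0
    then show ?thesis using y ys by (simp add: digit_def)
  next
    case (Suc l')
    have "(y + b * n) div b = n" using y by simp
    then have "digit b (y + b * n) l = digit b n l'" by (simp add: digit_def Suc div_mult2_eq)
    then show ?thesis using n Suc that ys by simp
  qed
  moreover have "y + b * n < b ^ Suc s"
  proof -
    have "y + b * n < b * (n + 1)" using y by simp
    also have "\<dots> \<le> b * b ^ s" using n(1) by (intro mult_left_mono) auto
    finally show ?thesis by simp
  qed
  ultimately show ?case by blast
qed simp

text \<open>
  A set \<open>X\<close> of pairs \<open>(i, t)\<close> says that the \<open>i\<close>-th true input is \<open>t - 1\<close>; hence an input between consecutive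
  true inputs is false.
\<close>

definition literal :: "bool \<Rightarrow> nat \<Rightarrow> (nat \<times> nat) set \<Rightarrow> bool" where
  "literal s j X \<longleftrightarrow> (if s then \<exists>(i, t) \<in> X. t = j + 1
     else \<exists>(i, t) \<in> X. \<exists>(i', t') \<in> X. i' = i + 1 \<and> t < j + 1 \<and> j + 1 < t')"

text \<open>The set \<open>X\<close> is evidence that gate \<open>j\<close> has value
  \<open>s\<close>, and \<open>m\<close> is the remaining depth. The case distinction on negation
  encloses the recursive calls so that \<open>s\<close> remains a constant outside the terms; hence
  definability is an induction on \<open>m\<close>.\<close>

fun witness :: "bool list \<Rightarrow> nat \<Rightarrow> bool \<Rightarrow> nat \<Rightarrow> (nat \<times> nat) set \<Rightarrow> bool" where
  "witness z 0 s j X \<longleftrightarrow> inp z j \<and> literal s j X"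
| "witness z (Suc m) s j X \<longleftrightarrow>
     (if inp z j then literal s j X
      else if universal z s j then \<forall>i < gates z. mem z j i \<longrightarrow> (if neg z j then witness z m (\<not> s) i X else witness z m s i X)
      else \<exists>i < gates z. mem z j i \<and> (if neg z j then witness z m (\<not> s) i X else witness z m s i X))"

text \<open>
  For circuits of depth \<open>d\<close>, the first \<open>4 ^ d\<close> slots are for choosing in-neighbours of gates, the other slots are
  indexed by the \<open>tuple_len d\<close>-tuples of ranks, and their values are the corresponding true inputs.
\<close>

definition tuple_len :: "nat \<Rightarrow> nat" where
  "tuple_len d = 2 ^ (d + 1)"

definition tuples :: "nat \<Rightarrow> bool list \<Rightarrow> nat" where
  "tuples d z = (weight z + 2) ^ tuple_len d"

text \<open>Digits below \<open>gates z + 2\<close> leave room for the sentinels: rank 0 stands for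
  0 and rank \<open>k + 1\<close> for \<open>N + 1\<close>, where inputs are shifted by one. The
  gaps before the first and after the last true input thus need no special treatment.\<close>

definition nvalues :: "nat \<Rightarrow> bool list \<Rightarrow> nat" where
  "nvalues d z = (gates z + 2) ^ tuple_len d"

definition facts :: "nat \<Rightarrow> bool list \<Rightarrow> nat \<Rightarrow> nat \<Rightarrow> (nat \<times> nat) set" where
  "facts d z I A = (\<lambda>l. (digit (weight z + 2) I l, digit (gates z + 2) A l)) ` {..<tuple_len d}"

text \<open>A factor \<open>nvalues\<close> for the choice of an in-neighbour, and two for
  constraints of in-neighbours. One count serves gates of either kind, so it does not depend on the
  gate.\<close>

fun clauses :: "nat \<Rightarrow> bool list \<Rightarrow> nat \<Rightarrow> nat" where
  "clauses d z 0 = 1"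
| "clauses d z (Suc m) = nvalues d z * (clauses d z m * clauses d z m)"

text \<open>
  \<open>hit0\<close>, \<open>hit1\<close>, \<open>hit2\<close> deal with the parts of the circuit above the first, between the first and the
  second, and below the second large gate on a path from the output. The number \<open>r\<close> of the constraint codes the
  choices for universal gates and, in the second part, the choices of constraints for both
  in-neighbours of existential gates; in the first part, slot \<open>p\<close> has the choice for an existential gate.
\<close>

definition hit2 :: "nat \<Rightarrow> bool list \<Rightarrow> nat \<Rightarrow> bool \<Rightarrow> nat \<Rightarrow> nat \<Rightarrow> nat \<Rightarrow> bool" where
  "hit2 d z m s j i v \<longleftrightarrow> 4 ^ d \<le> i \<and> witness z m s j (facts d z (i - 4 ^ d) v)"

fun hit1 :: "nat \<Rightarrow> bool list \<Rightarrow> nat \<Rightarrow> bool \<Rightarrow> nat \<Rightarrow> nat \<Rightarrow> nat \<Rightarrow> nat \<Rightarrow> bool" where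
  "hit1 d z 0 s j r i v \<longleftrightarrow> hit2 d z 0 s j i v"
| "hit1 d z (Suc m) s j r i v \<longleftrightarrow>
     (if inp z j then hit2 d z 0 s j i v
      else if universal z s j then
        mem z j (r mod nvalues d z) \<longrightarrow>
          (if large z j then hit2 d z m s (r mod nvalues d z) i v
           else if neg z j then hit1 d z m (\<not> s) (r mod nvalues d z) (r div nvalues d z mod clauses d z m) i v
           else hit1 d z m s (r mod nvalues d z) (r div nvalues d z mod clauses d z m) i v)
      else \<exists>i' < gates z. mem z j i' \<and>
          (if large z j then hit2 d z m s i' i v
           else hit1 d z m s i' (if not_first z j i' then r div clauses d z m mod clauses d z m else r mod clauses d z m) i v))"

fun hit0 :: "nat \<Rightarrow> bool list \<Rightarrow> nat \<Rightarrow> bool \<Rightarrow> nat \<Rightarrow> nat \<Rightarrow> nat \<Rightarrow> nat \<Rightarrow> nat \<Rightarrow> bool" where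
  "hit0 d z 0 s j p r i v \<longleftrightarrow> hit2 d z 0 s j i v"
| "hit0 d z (Suc m) s j p r i v \<longleftrightarrow>
     (if inp z j then hit2 d z 0 s j i v
      else if universal z s j then
        mem z j (r mod nvalues d z) \<longrightarrow>
          (if large z j then hit1 d z m s (r mod nvalues d z) (r div nvalues d z mod clauses d z m) i v
           else if neg z j then hit0 d z m (\<not> s) (r mod nvalues d z) (p + 1 + (if not_first z j (r mod nvalues d z) then 4 ^ m else 0))
             (r div nvalues d z mod clauses d z m) i v
           else hit0 d z m s (r mod nvalues d z) (p + 1 + (if not_first z j (r mod nvalues d z) then 4 ^ m else 0))
             (r div nvalues d z mod clauses d z m) i v)
      else i = p \<and> v \<noteq> r mod nvalues d z \<or> mem z j (r mod nvalues d z) \<and>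
          (if large z j then hit1 d z m s (r mod nvalues d z) (r div nvalues d z mod clauses d z m) i v
           else hit0 d z m s (r mod nvalues d z) (p + 1) (r div nvalues d z mod clauses d z m) i v))"

text \<open>Order is preserved in both directions and between any two slots. So equal ranks have
  equal entries everywhere, and all slots describe one strictly increasing function with the
  prescribed sentinels and with inputs in between.\<close>

definition compatible :: "nat \<Rightarrow> bool list \<Rightarrow> nat \<Rightarrow> nat \<Rightarrow> nat \<Rightarrow> nat \<Rightarrow> bool" where
  "compatible d z I A J B \<longleftrightarrow> (\<forall>l < tuple_len d. \<forall>l' < tuple_len d.
     (digit (weight z + 2) I l < digit (weight z + 2) J l' \<longleftrightarrow> digit (gates z + 2) A l < digit (gates z + 2) B l') \<and>
     (digit (weight z + 2) I l = 0 \<longrightarrow> digit (gates z + 2) A l = 0) \<and>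
     (digit (weight z + 2) I l = weight z + 1 \<longrightarrow> digit (gates z + 2) A l = gates z + 1) \<and>
     (0 < digit (weight z + 2) I l \<and> digit (weight z + 2) I l < weight z + 1 \<longrightarrow>
        0 < digit (gates z + 2) A l \<and> digit (gates z + 2) A l < gates z + 1 \<and> inp z (digit (gates z + 2) A l - 1)))"

text \<open>For a constant \<open>A\<close>: if the slot of tuple \<open>I\<close> holds
  \<open>A\<close>, then the slot of \<open>J\<close> is compatible with it.\<close>

definition consistency :: "nat \<Rightarrow> bool list \<Rightarrow> nat \<Rightarrow> nat \<Rightarrow> nat \<Rightarrow> nat \<Rightarrow> nat \<Rightarrow> bool" where
  "consistency d z I J A i v \<longleftrightarrow> i = 4 ^ d + I \<and> v \<noteq> A \<or> i = 4 ^ d + J \<and> compatible d z I A J v"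

definition wslots :: "nat \<Rightarrow> bool list \<Rightarrow> nat" where
  "wslots d z = 4 ^ d + tuples d z"

definition wconstraints :: "nat \<Rightarrow> bool list \<Rightarrow> nat" where
  "wconstraints d z = clauses d z d + tuples d z * (tuples d z * nvalues d z)"

definition wconstraint :: "nat \<Rightarrow> bool list \<Rightarrow> nat \<Rightarrow> nat \<Rightarrow> nat \<Rightarrow> bool" where
  "wconstraint d z r i v \<longleftrightarrow>
     (if r < clauses d z d then hit0 d z d True (gates z - 1) 0 r i v
      else consistency d z ((r - clauses d z d) mod tuples d z) ((r - clauses d z d) div tuples d z mod tuples d z)
        ((r - clauses d z d) div tuples d z div tuples d z) i v)"

lemma literal_facts:
  "literal s j (facts d z I A) \<longleftrightarrow> (if s then \<exists>l < tuple_len d. digit (gates z + 2) A l = j + 1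
     else \<exists>l < tuple_len d. \<exists>l' < tuple_len d. digit (weight z + 2) I l' = digit (weight z + 2) I l + 1 \<and>
       digit (gates z + 2) A l < j + 1 \<and> j + 1 < digit (gates z + 2) A l')"
  by (auto simp: literal_def facts_def)

lemma definable_digit: "definable b \<Longrightarrow> definable n \<Longrightarrow> definable (\<lambda>x e. digit (b x e) (n x e) l)"
  unfolding digit_def by (intro definable_mod definable_div definable_power)

lemma definable_literal:
  assumes "definable j" "definable I" "definable A"
  shows "definable_pred (\<lambda>x e. literal s (j x e) (facts d x (I x e) (A x e)))"
proof -
  note i = definable_const definable_add definable_digit definable_weight definable_gates definable_eq definable_less
    definable_conj assms
  have "definable_pred (\<lambda>x e. \<exists>l < tuple_len d. digit (gates x + 2) (A x e) l = j x e + 1)"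
    by (intro definable_fin_ex i)
  moreover have "definable_pred (\<lambda>x e. \<exists>l < tuple_len d. \<exists>l' < tuple_len d.
       digit (weight x + 2) (I x e) l' = digit (weight x + 2) (I x e) l + 1 \<and>
       digit (gates x + 2) (A x e) l < j x e + 1 \<and> j x e + 1 < digit (gates x + 2) (A x e) l')"
    by (intro definable_fin_ex i)
  ultimately show ?thesis unfolding literal_facts by (cases s) simp_all
qed

lemma definable_witness:
  "definable j \<Longrightarrow> definable I \<Longrightarrow> definable A \<Longrightarrow> definable_pred (\<lambda>x e. witness x m s (j x e) (facts d x (I x e) (A x e)))"
proof (induction m arbitrary: s j I A)
  case 0
  then show ?case unfolding witness.simps by (intro definable_intros definable_gate_preds definable_literal)
next
  case (Suc m)
  note r = Suc.prems[THEN definable_rename]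
  show ?case unfolding witness.simps
    by (intro definable_intros definable_gate_preds definable_gates definable_literal definable_mem Suc.IH r Suc.prems)
qed

lemma definable_nvalues: "definable (\<lambda>x e. nvalues d x)" and definable_tuples: "definable (\<lambda>x e. tuples d x)"
  unfolding nvalues_def tuples_def by (intro definable_power definable_intros definable_gates definable_weight)+

lemma definable_clauses: "definable (\<lambda>x e. clauses d x m)"
  by (induction m) (auto intro!: definable_intros definable_nvalues)

lemma definable_hit2:
  "definable j \<Longrightarrow> definable i \<Longrightarrow> definable v \<Longrightarrow> definable_pred (\<lambda>x e. hit2 d x m s (j x e) (i x e) (v x e))"
  unfolding hit2_def by (intro definable_intros definable_witness)

lemma definable_hit1:
  "definable j \<Longrightarrow> definable r \<Longrightarrow> definable i \<Longrightarrow> definable v \<Longrightarrow>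
   definable_pred (\<lambda>x e. hit1 d x m s (j x e) (r x e) (i x e) (v x e))"
proof (induction m arbitrary: s j r i v)
  case 0
  then show ?case unfolding hit1.simps by (intro definable_hit2)
next
  case (Suc m)
  note rn = Suc.prems[THEN definable_rename]
  show ?case unfolding hit1.simps
    by (intro definable_intros definable_gate_preds definable_gates definable_hit2 definable_mem definable_mod definable_div
        definable_nvalues definable_clauses Suc.IH rn Suc.prems)
qed

lemma definable_hit0:
  "definable j \<Longrightarrow> definable p \<Longrightarrow> definable r \<Longrightarrow> definable i \<Longrightarrow> definable v \<Longrightarrow>
   definable_pred (\<lambda>x e. hit0 d x m s (j x e) (p x e) (r x e) (i x e) (v x e))"
proof (induction m arbitrary: s j p r i v)
  case 0
  then show ?case unfolding hit0.simps by (intro definable_hit2)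
next
  case (Suc m)
  show ?case unfolding hit0.simps
    by (intro definable_intros definable_gate_preds definable_gates definable_hit2 definable_hit1 definable_mem definable_mod definable_div
        definable_nvalues definable_clauses Suc.IH Suc.prems)
qed

lemma definable_compatible:
  assumes "definable I" "definable A" "definable J" "definable B"
  shows "definable_pred (\<lambda>x e. compatible d x (I x e) (A x e) (J x e) (B x e))"
  unfolding compatible_def
  by (intro definable_fin_all definable_const definable_add definable_diff definable_digit definable_weight definable_gates definable_eq
      definable_less definable_conj definable_imp definable_iff definable_gate_preds assms)

lemma definable_wconstraint:
  "definable r \<Longrightarrow> definable i \<Longrightarrow> definable v \<Longrightarrow> definable_pred (\<lambda>x e. wconstraint d x (r x e) (i x e) (v x e))"
  unfolding wconstraint_def consistency_def
  by (intro definable_intros definable_hit0 definable_compatible definable_mod definable_div definable_nvalues definable_tuples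
      definable_clauses definable_gates)

lemma definable_wparams: "definable (\<lambda>x e. wslots d x)" "definable (\<lambda>x e. wconstraints d x)"
  unfolding wslots_def wconstraints_def by (intro definable_intros definable_nvalues definable_tuples definable_clauses)+

subsection \<open>Correctness of the constraints\<close>

text \<open>Padding the range by a factor \<open>c\<close> repeats codes but yields the same
  pairs.\<close>

lemma all_less_mult_mod:
  assumes "0 < b" "0 < c"
  shows "(\<forall>r < a * (b * c). P (r mod a) (r div a mod b)) \<longleftrightarrow> (\<forall>i < a. \<forall>j < (b :: nat). P i j)"
proof -
  have "(\<forall>r < a * (b * c). P (r mod a) (r div a mod b)) \<longleftrightarrow> (\<forall>i < a. \<forall>s < b * c. P i (s mod b))"
    by (rule all_less_mult)
  also have "\<dots> \<longleftrightarrow> (\<forall>i < a. \<forall>j < b. P i j)"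
  proof (intro iffI allI impI)
    fix i j assume h: "\<forall>i < a. \<forall>s < b * c. P i (s mod b)" "i < a" "j < b"
    have "j < b * c" using h(3) assms by (meson less_le_trans mult_le_mono nat_mult_1_right Suc_leI le_refl One_nat_def dvd_imp_le dvd_triv_left nat_0_less_mult_iff)
    then show "P i j" using h by fastforce
  qed (use assms in auto)
  finally show ?thesis .
qed

lemma node_val_cong:
  "(\<And>i. i \<in> input_nodes C \<Longrightarrow> v i = v' i) \<Longrightarrow> j < length C \<Longrightarrow> node_val C v j = node_val C v' j"
proof (induction j rule: less_induct)
  case (less j)
  have "node_val C v i = node_val C v' i" if "i \<in> snd (C ! j) \<inter> {..<j}" for i
    using less that by auto
  moreover have "v j = v' j" if "fst (C ! j) = Input" using less that by (simp add: input_nodes_def)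
  ultimately show ?case
    unfolding node_val.simps[of C v j] node_val.simps[of C v' j] by (cases "fst (C ! j)") auto
qed

locale weighted_circuit =
  fixes C :: circuit and k d :: nat
  assumes wf: "circuit_wf C"
begin

abbreviation "z \<equiv> enc_par (enc_circuit C, k)"
abbreviation "N \<equiv> length C"

lemmas enc [simp] = weight_enc[OF wf] gates_enc[OF wf]

declare enc_par.simps [simp del]

lemma child: "j < N \<Longrightarrow> mem z j i \<longleftrightarrow> i \<in> snd (C ! j)" "j < N \<Longrightarrow> i \<in> snd (C ! j) \<Longrightarrow> i < j"
  using gate_enc(4)[OF wf, of j] circuit_wf_nth(1)[OF wf, of j] by auto

section \<open>Depth and weft of the part of the circuit below a gate\<close>

definition path_to :: "nat \<Rightarrow> nat list \<Rightarrow> bool" where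
  "path_to j p \<longleftrightarrow> p \<noteq> [] \<and> hd p \<in> input_nodes C \<and> last p = j \<and>
     (\<forall>l. Suc l < length p \<longrightarrow> p ! Suc l < length C \<and> p ! l \<in> snd (C ! (p ! Suc l)))"

definition good :: "nat \<Rightarrow> nat \<Rightarrow> nat \<Rightarrow> bool" where
  "good m w j \<longleftrightarrow> (\<forall>p. path_to j p \<longrightarrow> length p - 1 \<le> m \<and> length (filter (\<lambda>i. card (snd (C ! i)) > 2) p) \<le> w)"

lemma path_snoc:
  assumes "path_to i p" "i \<in> snd (C ! j)" "j < N"
  shows "path_to j (p @ [j])"
proof -
  have "(p @ [j]) ! Suc l < length C \<and> (p @ [j]) ! l \<in> snd (C ! ((p @ [j]) ! Suc l))" if "Suc l < length (p @ [j])" for l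
  proof (cases "Suc l < length p")
    case True
    then show ?thesis using assms(1) by (auto simp: path_to_def nth_append)
  next
    case False
    then have l: "Suc l = length p" using that by simp
    then have "p ! l = i" using assms(1) by (metis path_to_def last_conv_nth diff_Suc_1)
    then show ?thesis using l assms(2,3) by (auto simp: nth_append)
  qed
  then show ?thesis using assms(1) by (auto simp: path_to_def)
qed

lemma path_exists: "j < N \<Longrightarrow> \<exists>p. path_to j p"
proof (induction j rule: less_induct)
  case (less j)
  show ?case
  proof (cases "fst (C ! j) = Input")
    case True
    then have "path_to j [j]" using less by (simp add: path_to_def input_nodes_def)
    then show ?thesis by blast
  next
    case False
    then obtain i where i: "i \<in> snd (C ! j)" using circuit_wf_nth(3)[OF wf less.prems] by blast
    then have "i < j" using child(2)[OF less.prems] by simp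
    then obtain p where "path_to i p" using less by auto
    then show ?thesis using path_snoc[OF _ i less.prems] by blast
  qed
qed

text \<open>A path to an in-neighbour is extended by the gate. Paths exist at all because every gate
  without in-neighbours is an input, and so a non-input has positive depth.\<close>

lemma good_child:
  assumes "good m w j" "j < N" "i \<in> snd (C ! j)"
  obtains m' where "m = Suc m'" "good m' (if card (snd (C ! j)) > 2 then w - 1 else w) i" "card (snd (C ! j)) > 2 \<Longrightarrow> 0 < w"
proof -
  have g: "length p \<le> m \<and> length (filter (\<lambda>i. card (snd (C ! i)) > 2) p) + of_bool (card (snd (C ! j)) > 2) \<le> w"
    if "path_to i p" for p
    using assms(1) path_snoc[OF that assms(3,2)] unfolding good_def by fastforce
  have "i < N" using child(2)[OF assms(2,3)] assms(2) by simp
  then obtain p where p: "path_to i p" using path_exists by blast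
  then have "0 < length p" by (simp add: path_to_def)
  then obtain m' where m': "m = Suc m'" using g[OF p] by (cases m) auto
  moreover have "good m' (if card (snd (C ! j)) > 2 then w - 1 else w) i"
    unfolding good_def using g m' by (fastforce simp: of_bool_def split: if_splits)
  moreover have "0 < w" if "card (snd (C ! j)) > 2" using g[OF p] that by simp
  ultimately show ?thesis by (rule that)
qed

lemma good_input: "j < N \<Longrightarrow> fst (C ! j) = Input \<Longrightarrow> good 0 0 j"
proof -
  assume j: "j < N" "fst (C ! j) = Input"
  obtain l S where "C ! j = (l, S)" by fastforce
  then have e: "snd (C ! j) = {}" using wf j unfolding circuit_wf_def by fastforce
  have *: "p = [j]" if p: "path_to j p" for p
  proof (cases "length p < 2")
    case True
    then show ?thesis using p by (cases p) (auto simp: path_to_def)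
  next
    case False
    then have "Suc (length p - 2) < length p" "p ! Suc (length p - 2) = j"
      using p by (auto simp: path_to_def last_conv_nth Suc_diff_le numeral_2_eq_2 Suc_diff_Suc)
    then have "p ! (length p - 2) \<in> snd (C ! j)" using p unfolding path_to_def by metis
    then show ?thesis using e by simp
  qed
  show ?thesis unfolding good_def
  proof (intro allI impI)
    fix p assume "path_to j p"
    then have "p = [j]" by (rule *)
    then show "length p - 1 \<le> 0 \<and> length (filter (\<lambda>i. 2 < card (snd (C ! i))) p) \<le> 0" using e by simp
  qed
qed

lemma good_output: "depth_at_most C m \<Longrightarrow> weft_at_most C w \<Longrightarrow> good m w (N - 1)"
  by (auto simp: good_def depth_at_most_def weft_at_most_def path_to_def input_output_path_def)

lemma good_0: "good 0 w j \<Longrightarrow> j < N \<Longrightarrow> inp z j"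
  using good_child[of 0 w j] circuit_wf_nth(3)[OF wf, of j] gate_enc(1)[OF wf, of j k] by blast

lemma good_mem:
  assumes "good (Suc m) w j" "j < N" "mem z j i"
  shows "i < N" "good m (if large z j then w - 1 else w) i" "large z j \<Longrightarrow> 0 < w"
proof -
  have i: "i \<in> snd (C ! j)" using child(1)[OF assms(2)] assms(3) by simp
  show "i < N" using child(2)[OF assms(2) i] assms(2) by simp
  obtain m' where "Suc m = Suc m'" "good m' (if card (snd (C ! j)) > 2 then w - 1 else w) i" "card (snd (C ! j)) > 2 \<Longrightarrow> 0 < w"
    using good_child[OF assms(1,2) i] by blast
  then show "good m (if large z j then w - 1 else w) i" "large z j \<Longrightarrow> 0 < w"
    using large_enc[OF wf assms(2)] by auto
qed

lemma neg_not_large: "j < N \<Longrightarrow> neg z j \<Longrightarrow> \<not> large z j"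
  using large_enc[OF wf] gate_enc(2)[OF wf, of j k] circuit_wf_nth(2)[OF wf, of j] by simp

text \<open>Two different in-neighbours that are not the first would give, together with the first
  one, three of them.\<close>

lemma small_unique:
  assumes "j < N" "\<not> large z j" "mem z j i" "mem z j i'" "not_first z j i \<longleftrightarrow> not_first z j i'"
  shows "i = i'"
proof -
  have *: False if a: "i < i'" "mem z j i" "mem z j i'" "not_first z j i \<longleftrightarrow> not_first z j i'" for i i'
  proof -
    have "not_first z j i'" using a by (auto simp: not_first_def)
    then obtain l where l: "l < i" "mem z j l" using a(4) by (auto simp: not_first_def)
    have "{l, i, i'} \<subseteq> snd (C ! j)" using l a child(1)[OF assms(1)] by auto
    moreover have "finite (snd (C ! j))" using circuit_wf_nth(1)[OF wf assms(1)] finite_subset by blast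
    ultimately have "card {l, i, i'} \<le> card (snd (C ! j))" by (rule card_mono[rotated])
    then show False using l a assms(2) large_enc[OF wf assms(1)] by simp
  qed
  show ?thesis using *[of i i'] *[of i' i] assms by (meson linorder_neqE_nat)
qed

lemma clauses_pos: "0 < clauses d z m" and nvalues_pos: "0 < nvalues d z" and tuples_pos: "0 < tuples d z"
proof -
  show n: "0 < nvalues d z" "0 < tuples d z" by (simp_all add: nvalues_def tuples_def)
  show "0 < clauses d z m" using n by (induction m) auto
qed

lemma N_le_nvalues: "N + 2 \<le> nvalues d z" and k_le_tuples: "k + 2 \<le> tuples d z"
  using self_le_power[of "N + 2" "tuple_len d"] self_le_power[of "k + 2" "tuple_len d"]
  by (simp_all add: nvalues_def tuples_def tuple_len_def)

end

section \<open>Evaluation for a fixed enumeration of the true inputs\<close>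

locale ranked_circuit = weighted_circuit +
  fixes t :: "nat \<Rightarrow> nat"
  assumes t_0: "t 0 = 0" and t_last: "t (Suc k) = Suc N"
    and t_mono: "i < i' \<Longrightarrow> i' \<le> Suc k \<Longrightarrow> t i < t i'"
    and t_input: "0 < i \<Longrightarrow> i \<le> k \<Longrightarrow> t i - 1 \<in> input_nodes C"
begin

definition v :: "nat \<Rightarrow> bool" where
  "v j \<longleftrightarrow> (\<exists>i. 0 < i \<and> i \<le> k \<and> t i = Suc j)"

abbreviation val :: "nat \<Rightarrow> bool" where
  "val j \<equiv> node_val C v j"

definition graph_of :: "nat set \<Rightarrow> (nat \<times> nat) set" where
  "graph_of Y = (\<lambda>i. (i, t i)) ` Y"

text \<open>Every tuple slot holds the restriction of the common enumeration \<open>t\<close> to the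
  ranks in its tuple.\<close>

definition tuple_ok :: "(nat \<Rightarrow> nat) \<Rightarrow> bool" where
  "tuple_ok \<sigma> \<longleftrightarrow> (\<forall>I < tuples d z. facts d z I (\<sigma> (4 ^ d + I)) = graph_of (digit (k + 2) I ` {..<tuple_len d}))"

lemma val_input: "j < N \<Longrightarrow> inp z j \<Longrightarrow> val j = v j"
  using gate_enc(1)[OF wf, of j k] by (simp add: node_val.simps[of C v j])

text \<open>By duality, a conjunction with value false behaves as a disjunction. A negation has one
  in-neighbour, so it may count as universal for both values.\<close>

lemma val_gate:
  assumes j: "j < N" "\<not> inp z j"
  shows "val j = s \<longleftrightarrow> (if universal z s j then \<forall>i < N. mem z j i \<longrightarrow> val i = (if neg z j then \<not> s else s)
    else \<exists>i < N. mem z j i \<and> val i = (if neg z j then \<not> s else s))"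
proof -
  let ?S = "snd (C ! j)"
  have S: "?S \<inter> {..<j} = ?S" using circuit_wf_nth(1)[OF wf j(1)] by auto
  have m: "i < N \<and> mem z j i \<longleftrightarrow> i \<in> ?S" for i using child[OF j(1)] j(1) by (auto intro: less_trans)
  have all: "(\<forall>i < N. mem z j i \<longrightarrow> Q i) \<longleftrightarrow> (\<forall>i \<in> ?S. Q i)" and ex: "(\<exists>i < N. mem z j i \<and> Q i) \<longleftrightarrow> (\<exists>i \<in> ?S. Q i)" for Q
    using m by blast+
  note g = gate_enc[OF wf j(1), of k]
  show ?thesis
  proof (cases "fst (C ! j)")
    case Input
    then show ?thesis using g(1) j(2) by simp
  next
    case Not
    then obtain a where a: "?S = {a}" using circuit_wf_nth(2)[OF wf j(1)] card_1_singletonE by metis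
    show ?thesis unfolding all ex using Not g S a
      by (auto simp: node_val.simps[of C v j] universal_def)
  next
    case And
    then show ?thesis unfolding all ex using g S by (cases s) (auto simp: node_val.simps[of C v j] universal_def)
  next
    case Or
    then show ?thesis unfolding all ex using g S by (cases s) (auto simp: node_val.simps[of C v j] universal_def)
  qed
qed

lemma t_less_iff: "i \<le> Suc k \<Longrightarrow> i' \<le> Suc k \<Longrightarrow> t i < t i' \<longleftrightarrow> i < i'"
  using t_mono[of i i'] t_mono[of i' i] by (cases i i' rule: linorder_cases) auto

text \<open>For falsity, a rank of the input would have to lie strictly between two consecutive
  numbers.\<close>

lemma literal_sound:
  assumes "Y \<subseteq> {..Suc k}" "j < N" "literal s j (graph_of Y)"
  shows "v j = s"
proof (cases s)
  case True
  then obtain i where i: "i \<in> Y" "t i = Suc j" using assms(3) by (auto simp: literal_def graph_of_def)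
  have "i \<noteq> 0" using i(2) t_0 by (cases i) auto
  moreover have "i \<noteq> Suc k" using i(2) t_last assms(2) by auto
  ultimately have "v j" unfolding v_def using i assms(1) by (intro exI[of _ i]) auto
  then show ?thesis using True by simp
next
  case False
  then obtain i where i: "i \<in> Y" "Suc i \<in> Y" "t i < Suc j" "Suc j < t (Suc i)"
    using assms(3) by (auto simp: literal_def graph_of_def)
  have "\<not> v j"
  proof
    assume "v j"
    then obtain i' where i': "i' \<le> k" "t i' = Suc j" by (auto simp: v_def)
    then have "i < i'" "i' < Suc i" using i assms(1) t_less_iff[of i i'] t_less_iff[of i' "Suc i"] by auto
    then show False by simp
  qed
  then show ?thesis using False by simp
qed

lemma literal_complete:
  assumes "j < N" "v j = s"
  shows "\<exists>Y \<subseteq> {..Suc k}. card Y \<le> 2 \<and> literal s j (graph_of Y)"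
proof (cases s)
  case True
  then obtain i where "0 < i" "i \<le> k" "t i = Suc j" using assms by (auto simp: v_def)
  then show ?thesis using True by (intro exI[of _ "{i}"]) (auto simp: literal_def graph_of_def)
next
  case False
  \<comment> \<open>The gap around a false input starts at the largest rank whose entry is at most
    \<open>j\<close>; the sentinels ensure that this rank and its successor exist.\<close>
  define A where "A = {i. i \<le> k \<and> t i \<le> j}"
  define i where "i = Max A"
  have A: "finite A" "A \<noteq> {}" using t_0 by (auto simp: A_def intro!: exI[of _ 0])
  have "i \<in> A" unfolding i_def using Max_in[OF A] .
  then have i: "i \<le> k" "t i \<le> j" by (auto simp: A_def)
  have "Suc j < t (Suc i)"
  proof (cases "i = k")
    case True
    then show ?thesis using t_last assms by simp
  next
    case False
    then have "Suc i \<notin> A" using Max_ge[OF A(1), of "Suc i"] by (auto simp: i_def)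
    then have "j < t (Suc i)" using False i by (auto simp: A_def)
    moreover have "t (Suc i) \<noteq> Suc j" using assms(2) \<open>\<not> s\<close> False i by (auto simp: v_def dest: spec[of _ "Suc i"])
    ultimately show ?thesis by simp
  qed
  then show ?thesis using False i
    by (intro exI[of _ "{i, Suc i}"]) (auto simp: literal_def graph_of_def card_insert_if)
qed

lemma literal_mono: "X \<subseteq> X' \<Longrightarrow> literal s j X \<Longrightarrow> literal s j X'"
  unfolding literal_def by (cases s) (simp_all, blast+)

lemma witness_mono: "X \<subseteq> X' \<Longrightarrow> witness z m s j X \<Longrightarrow> witness z m s j X'"
proof (induction m arbitrary: s j)
  case 0
  then show ?case using literal_mono by auto
next
  case (Suc m)
  then show ?case using literal_mono[of X X' s j] by (auto split: if_splits)
qed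

lemma witness_sound:
  assumes "Y \<subseteq> {..Suc k}"
  shows "j < N \<Longrightarrow> witness z m s j (graph_of Y) \<Longrightarrow> val j = s"
proof (induction m arbitrary: s j)
  case 0
  then show ?case using literal_sound[OF assms] val_input by auto
next
  case (Suc m)
  show ?case
  proof (cases "inp z j")
    case True
    then show ?thesis using Suc literal_sound[OF assms] val_input by simp
  next
    case False
    have "val i = (if neg z j then \<not> s else s)"
      if "i < N" "if neg z j then witness z m (\<not> s) i (graph_of Y) else witness z m s i (graph_of Y)" for i
      using Suc.IH[OF that(1)] that(2) by (auto split: if_splits)
    then show ?thesis unfolding val_gate[OF Suc.prems(1) False, of s]
      using Suc.prems(2) False by (auto split: if_splits simp del: witness.simps(1))
  qed
qed

text \<open>An input needs at most two ranks, and without large gates a gate has at most two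
  in-neighbours, so their number at most doubles with each level. This is the origin of the exponent
  in \<open>tuple_len\<close>.\<close>

lemma witness_complete:
  "good m 0 j \<Longrightarrow> j < N \<Longrightarrow> val j = s \<Longrightarrow> \<exists>Y \<subseteq> {..Suc k}. card Y \<le> 2 ^ (m + 1) \<and> witness z m s j (graph_of Y)"
proof (induction m arbitrary: s j)
  case 0
  then show ?case using good_0 literal_complete[of j s] val_input by auto
next
  case (Suc m)
  show ?case
  proof (cases "inp z j")
    case True
    then obtain Y where "Y \<subseteq> {..Suc k}" "card Y \<le> 2" "literal s j (graph_of Y)"
      using Suc.prems literal_complete[of j s] val_input by auto
    moreover have "(2 :: nat) ^ 1 \<le> 2 ^ (Suc m + 1)" by (rule power_increasing) auto
    then have "card Y \<le> 2 ^ (Suc m + 1)" using \<open>card Y \<le> 2\<close> by (metis le_trans power_one_right)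
    ultimately show ?thesis using True by (intro exI[of _ Y]) (simp del: power_Suc)
  next
    case False
    have small: "\<not> large z j" if "mem z j i" for i using good_mem(3)[OF Suc.prems(1,2) that] by auto
    define W where "W i Y \<longleftrightarrow> (if neg z j then witness z m (\<not> s) i (graph_of Y) else witness z m s i (graph_of Y))" for i Y
    have ch: "\<exists>Y \<subseteq> {..Suc k}. card Y \<le> 2 ^ (m + 1) \<and> W i Y"
      if "mem z j i" "val i = (if neg z j then \<not> s else s)" for i
      using Suc.IH[of i "if neg z j then \<not> s else s"] good_mem(1,2)[OF Suc.prems(1,2) that(1)] small[OF that(1)] that(2)
      unfolding W_def by (auto split: if_splits)
    have Wm: "W i Y \<Longrightarrow> Y \<subseteq> Y' \<Longrightarrow> W i Y'" for i Y Y'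
    proof -
      assume "W i Y" "Y \<subseteq> Y'"
      moreover from this(2) have "graph_of Y \<subseteq> graph_of Y'" by (auto simp: graph_of_def)
      ultimately show "W i Y'" unfolding W_def using witness_mono by (metis (full_types))
    qed
    show ?thesis
    proof (cases "universal z s j")
      case True
      let ?S = "snd (C ! j)"
      have fin: "finite ?S" using circuit_wf_nth(1)[OF wf Suc.prems(2)] finite_subset by blast
      have mem: "mem z j i \<longleftrightarrow> i \<in> ?S" for i by (rule child(1)[OF Suc.prems(2)])
      have "\<forall>i \<in> ?S. \<exists>Y \<subseteq> {..Suc k}. card Y \<le> 2 ^ (m + 1) \<and> W i Y"
        using ch val_gate[OF Suc.prems(2) False, of s] True Suc.prems(3) good_mem(1)[OF Suc.prems(1,2)] by (simp add: mem)
      then obtain Y where Y: "\<And>i. i \<in> ?S \<Longrightarrow> Y i \<subseteq> {..Suc k} \<and> card (Y i) \<le> 2 ^ (m + 1) \<and> W i (Y i)" by metis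
      have "card ?S \<le> 2"
        using small circuit_wf_nth(3)[OF wf Suc.prems(2)] large_enc[OF wf Suc.prems(2), of k] mem by (cases "?S = {}") auto
      have "card (\<Union>i\<in>?S. Y i) \<le> (\<Sum>i\<in>?S. card (Y i))" by (rule card_UN_le[OF fin])
      also have "\<dots> \<le> card ?S * 2 ^ (m + 1)" using sum_bounded_above[of ?S "\<lambda>i. card (Y i)" "2 ^ (m + 1)"] Y by simp
      also have "\<dots> \<le> 2 * 2 ^ (m + 1)" using \<open>card ?S \<le> 2\<close> by (rule mult_right_mono) simp
      finally have "card (\<Union>i\<in>?S. Y i) \<le> 2 ^ (Suc m + 1)" by simp
      moreover have "W i (\<Union>i\<in>?S. Y i)" if "mem z j i" for i using Y[of i] Wm[of i "Y i"] that mem by blast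
      ultimately show ?thesis using False True Y
        by (intro exI[of _ "\<Union>i\<in>?S. Y i"]) (auto simp: W_def simp del: power_Suc)
    next
      case nu: False
      then obtain i where i: "i < N" "mem z j i" "val i = (if neg z j then \<not> s else s)"
        using val_gate[OF Suc.prems(2) False, of s] Suc.prems(3) by auto
      then obtain Y where Y: "Y \<subseteq> {..Suc k}" "card Y \<le> 2 ^ (m + 1)" "W i Y" using ch by blast
      have "(2 :: nat) ^ (m + 1) \<le> 2 ^ (Suc m + 1)" by (intro power_increasing) auto
      then have "card Y \<le> 2 ^ (Suc m + 1)" using Y(2) by (rule le_trans[rotated])
      then show ?thesis using Y(1,3) False nu i by (intro exI[of _ Y]) (auto simp: W_def simp del: power_Suc)
    qed
  qed
qed

lemma digit_le: "digit (k + 2) I l \<in> {..Suc k}"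
  using mod_less_divisor[of "k + 2" "I div (k + 2) ^ l"] unfolding digit_def by simp

lemma tuple_covering:
  assumes "Y \<subseteq> {..Suc k}" "card Y \<le> tuple_len d"
  shows "\<exists>I < tuples d z. Y \<subseteq> digit (k + 2) I ` {..<tuple_len d}"
proof -
  have "finite Y" using assms(1) finite_subset by blast
  then obtain ys where ys: "set ys = Y" "length ys = card Y" using finite_distinct_list distinct_card by metis
  \<comment> \<open>Shorter sets of ranks are padded with the sentinel 0, which stays in the range
    of ranks.\<close>
  define xs where "xs = ys @ replicate (tuple_len d - card Y) 0"
  have "length xs = tuple_len d" using assms(2) ys by (simp add: xs_def)
  moreover have "y < k + 2" if "y \<in> set xs" for y using that ys assms(1) by (auto simp: xs_def split: if_splits)
  ultimately obtain I where I: "I < (k + 2) ^ tuple_len d" "\<forall>l < tuple_len d. digit (k + 2) I l = xs ! l"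
    using digits_exist[of xs "tuple_len d" "k + 2"] by blast
  have "Y \<subseteq> digit (k + 2) I ` {..<tuple_len d}"
  proof
    fix y assume "y \<in> Y"
    then have "y \<in> set xs" using ys by (simp add: xs_def)
    then obtain l where "l < tuple_len d" "xs ! l = y" using \<open>length xs = tuple_len d\<close> by (auto simp: in_set_conv_nth)
    then show "y \<in> digit (k + 2) I ` {..<tuple_len d}" using I(2) by force
  qed
  then show ?thesis using I(1) by (auto simp: tuples_def)
qed

text \<open>A single slot suffices, because some tuple contains all ranks that the witness needs. In
  this way the disjunction over slots becomes the truth of the subcircuit.\<close>

lemma hit2_iff:
  assumes "tuple_ok \<sigma>" "good m 0 j" "j < N" "m \<le> d"
  shows "(\<exists>i < wslots d z. hit2 d z m s j i (\<sigma> i)) \<longleftrightarrow> val j = s"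
proof
  assume "\<exists>i < wslots d z. hit2 d z m s j i (\<sigma> i)"
  then obtain i where i: "i < wslots d z" "4 ^ d \<le> i" "witness z m s j (facts d z (i - 4 ^ d) (\<sigma> i))"
    by (auto simp: hit2_def)
  define I where "I = i - 4 ^ d"
  have "I < tuples d z" "i = 4 ^ d + I" using i by (auto simp: I_def wslots_def)
  then have "witness z m s j (graph_of (digit (k + 2) I ` {..<tuple_len d}))"
    using i(3) assms(1) by (simp add: tuple_ok_def)
  moreover have "digit (k + 2) I ` {..<tuple_len d} \<subseteq> {..Suc k}" using digit_le by blast
  ultimately show "val j = s" using witness_sound assms(3) by blast
next
  assume "val j = s"
  then obtain Y where Y: "Y \<subseteq> {..Suc k}" "card Y \<le> 2 ^ (m + 1)" "witness z m s j (graph_of Y)"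
    using witness_complete[OF assms(2,3)] by blast
  have "(2 :: nat) ^ (m + 1) \<le> 2 ^ (d + 1)" using assms(4) by (intro power_increasing) auto
  then have "card Y \<le> tuple_len d" using Y(2) unfolding tuple_len_def by linarith
  then obtain I where I: "I < tuples d z" "Y \<subseteq> digit (k + 2) I ` {..<tuple_len d}" using tuple_covering[OF Y(1)] by blast
  have "witness z m s j (facts d z I (\<sigma> (4 ^ d + I)))"
  proof -
    have "graph_of Y \<subseteq> graph_of (digit (k + 2) I ` {..<tuple_len d})" using I(2) by (auto simp: graph_of_def)
    then show ?thesis using witness_mono[OF _ Y(3)] I(1) assms(1) by (simp add: tuple_ok_def)
  qed
  then have "hit2 d z m s j (4 ^ d + I) (\<sigma> (4 ^ d + I))" by (simp add: hit2_def)
  moreover have "4 ^ d + I < wslots d z" using I by (simp add: wslots_def)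
  ultimately show "\<exists>i < wslots d z. hit2 d z m s j i (\<sigma> i)" by blast
qed

lemma hit2_input:
  assumes "tuple_ok \<sigma>" "j < N" "inp z j"
  shows "(\<exists>i < wslots d z. hit2 d z 0 s j i (\<sigma> i)) \<longleftrightarrow> val j = s"
  using hit2_iff[OF assms(1) good_input] assms gate_enc(1)[OF wf assms(2), of k] by simp

lemma wslots_pos: "0 < wslots d z"
  using tuples_pos by (simp add: wslots_def)

lemma mem_less: "mem z j i \<Longrightarrow> i < N" "mem z j i \<Longrightarrow> i < nvalues d z"
  using N_le_nvalues by (auto simp: mem_def)

text \<open>
  The disjunction over both in-neighbours of a small gate commutes with the quantification over constraints,
  since a constraint is chosen for each in-neighbour separately.
\<close>

lemma small_choice:
  assumes j: "j < N" "\<not> large z j" and b: "0 < b"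
  shows "(\<forall>r < b. \<forall>r' < (b :: nat). \<exists>i' < N. mem z j i' \<and> Q i' (if not_first z j i' then r' else r)) \<longleftrightarrow>
    (\<exists>i' < N. mem z j i' \<and> (\<forall>r < b. Q i' r))"
proof
  assume l: "\<forall>r < b. \<forall>r' < b. \<exists>i' < N. mem z j i' \<and> Q i' (if not_first z j i' then r' else r)"
  show "\<exists>i' < N. mem z j i' \<and> (\<forall>r < b. Q i' r)"
  proof (rule ccontr)
    assume "\<not> (\<exists>i' < N. mem z j i' \<and> (\<forall>r < b. Q i' r))"
    then obtain f where f: "\<And>i'. mem z j i' \<Longrightarrow> f i' < b \<and> \<not> Q i' (f i')" using mem_less(1) by metis
    define c where "c w = (if \<exists>i'. mem z j i' \<and> not_first z j i' = w then f (SOME i'. mem z j i' \<and> not_first z j i' = w) else 0)" for w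
    have c: "c (not_first z j i') = f i'" if "mem z j i'" for i'
    proof -
      have "mem z j (SOME i''. mem z j i'' \<and> not_first z j i'' = not_first z j i') \<and>
        not_first z j (SOME i''. mem z j i'' \<and> not_first z j i'' = not_first z j i') = not_first z j i'"
        by (rule someI[of _ i']) (use that in simp)
      then show ?thesis using small_unique[OF j, of _ i'] that by (auto simp: c_def)
    qed
    have cb: "c w < b" for w
    proof (cases "\<exists>i'. mem z j i' \<and> not_first z j i' = w")
      case True
      then obtain i' where "mem z j i'" "not_first z j i' = w" by blast
      then show ?thesis using c[of i'] f[of i'] by auto
    next
      case False
      then have "c w = 0" unfolding c_def by (rule if_not_P)
      then show ?thesis using b by simp
    qed
    obtain i' where "mem z j i'" "Q i' (if not_first z j i' then c True else c False)" using l cb by blast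
    then show False using c[of i'] f[of i'] by (cases "not_first z j i'") auto
  qed
qed (auto split: if_splits)

text \<open>A universal large gate is absorbed by the range of constraints, an existential one by
  the disjunction over slots; the latter commutes with the other quantifiers since no constraint
  choices remain below it.\<close>

lemma hit1_iff:
  "tuple_ok \<sigma> \<Longrightarrow> good m 1 j \<Longrightarrow> j < N \<Longrightarrow> m \<le> d \<Longrightarrow>
   (\<forall>r < clauses d z m. \<exists>i < wslots d z. hit1 d z m s j r i (\<sigma> i)) \<longleftrightarrow> val j = s"
proof (induction m arbitrary: s j)
  case 0
  then show ?case using hit2_input[OF 0(1,3) good_0[OF 0(2,3)]] by simp
next
  case (Suc m)
  let ?D = "nvalues d z" and ?B = "clauses d z m" and ?K = "wslots d z"
  show ?case
  proof (cases "inp z j")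
    case True
    then have h: "hit1 d z (Suc m) s j r i w \<longleftrightarrow> hit2 d z 0 s j i w" for r i w by simp
    show ?thesis unfolding h using hit2_input[OF Suc.prems(1,3) True, of s] clauses_pos[of "Suc m"] by blast
  next
    case ninp: False
    define Q where "Q i' r' i \<longleftrightarrow> (if large z j then hit2 d z m s i' i (\<sigma> i)
      else if neg z j then hit1 d z m (\<not> s) i' r' i (\<sigma> i) else hit1 d z m s i' r' i (\<sigma> i))" for i' r' i
    have Q: "(\<forall>r' < ?B. \<exists>i < ?K. Q i' r' i) \<longleftrightarrow> val i' = (if neg z j then \<not> s else s)" if "mem z j i'" for i'
    proof (cases "large z j")
      case True
      then show ?thesis using hit2_iff[OF Suc.prems(1), of m i' s] good_mem[OF Suc.prems(2,3) that] Suc.prems(4)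
          neg_not_large[OF Suc.prems(3)] clauses_pos[of m] by (auto simp: Q_def)
    next
      case False
      then show ?thesis using Suc.IH[OF Suc.prems(1), of i'] good_mem[OF Suc.prems(2,3) that] Suc.prems(4)
        by (auto simp: Q_def)
    qed
    show ?thesis
    proof (cases "universal z s j")
      case True
      have "hit1 d z (Suc m) s j r i (\<sigma> i) \<longleftrightarrow> (mem z j (r mod ?D) \<longrightarrow> Q (r mod ?D) (r div ?D mod ?B) i)" for r i
        using ninp True by (simp add: Q_def)
      then have "(\<forall>r < clauses d z (Suc m). \<exists>i < ?K. hit1 d z (Suc m) s j r i (\<sigma> i)) \<longleftrightarrow>
        (\<forall>r < ?D * (?B * ?B). \<exists>i < ?K. mem z j (r mod ?D) \<longrightarrow> Q (r mod ?D) (r div ?D mod ?B) i)"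
        by (simp only: clauses.simps)
      also have "\<dots> \<longleftrightarrow> (\<forall>i' < ?D. \<forall>r' < ?B. \<exists>i < ?K. mem z j i' \<longrightarrow> Q i' r' i)"
        by (rule all_less_mult_mod[OF clauses_pos clauses_pos])
      also have "\<dots> \<longleftrightarrow> (\<forall>i' < N. mem z j i' \<longrightarrow> (\<forall>r' < ?B. \<exists>i < ?K. Q i' r' i))"
        using mem_less wslots_pos by blast
      also have "\<dots> \<longleftrightarrow> val j = s" using Q True val_gate[OF Suc.prems(3) ninp, of s] by simp
      finally show ?thesis .
    next
      case False
      then have nneg: "\<not> neg z j" by (simp add: universal_def)
      have h: "hit1 d z (Suc m) s j r i (\<sigma> i) \<longleftrightarrow> (\<exists>i' < N. mem z j i' \<and> Q i' (if not_first z j i' then r div ?B mod ?B else r mod ?B) i)" for r i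
        using ninp False nneg by (simp add: Q_def)
      have "(\<forall>r < clauses d z (Suc m). \<exists>i < ?K. hit1 d z (Suc m) s j r i (\<sigma> i)) \<longleftrightarrow>
        (\<forall>r < ?B * (?B * ?D). \<exists>i < ?K. \<exists>i' < N. mem z j i' \<and> Q i' (if not_first z j i' then r div ?B mod ?B else r mod ?B) i)"
        unfolding h by (simp only: clauses.simps mult.commute mult.left_commute)
      also have "\<dots> \<longleftrightarrow> (\<forall>r < ?B. \<forall>r' < ?B. \<exists>i < ?K. \<exists>i' < N. mem z j i' \<and> Q i' (if not_first z j i' then r' else r) i)"
        by (rule all_less_mult_mod[OF clauses_pos nvalues_pos])
      also have "\<dots> \<longleftrightarrow> (\<forall>r < ?B. \<forall>r' < ?B. \<exists>i' < N. mem z j i' \<and> (\<exists>i < ?K. Q i' (if not_first z j i' then r' else r) i))"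
        by blast
      also have "\<dots> \<longleftrightarrow> (\<exists>i' < N. mem z j i' \<and> (\<forall>r < ?B. \<exists>i < ?K. Q i' r i))"
      proof (cases "large z j")
        case True
        then have "Q i' r i \<longleftrightarrow> Q i' 0 i" for i' r i by (simp add: Q_def)
        then show ?thesis using clauses_pos[of m] by metis
      next
        case nl: False
        show ?thesis by (rule small_choice[OF Suc.prems(3) nl clauses_pos])
      qed
      also have "\<dots> \<longleftrightarrow> (\<exists>i' < N. mem z j i' \<and> val i' = s)" using Q nneg by auto
      also have "\<dots> \<longleftrightarrow> val j = s" using False nneg val_gate[OF Suc.prems(3) ninp, of s] by simp
      finally show ?thesis .
    qed
  qed
qed

text \<open>At an existential gate, constraints for candidates other than the value of slot
  \<open>p\<close> are hit by that slot; those for its value are not, so they force it to be a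
  suitable in-neighbour.\<close>

lemma hit0_sound:
  assumes \<sigma>: "tuple_ok \<sigma>" "\<And>i. i < wslots d z \<Longrightarrow> \<sigma> i < nvalues d z"
  shows "good m 2 j \<Longrightarrow> j < N \<Longrightarrow> m \<le> d \<Longrightarrow> p + 4 ^ m \<le> 4 ^ d \<Longrightarrow>
   \<forall>r < clauses d z m. \<exists>i < wslots d z. hit0 d z m s j p r i (\<sigma> i) \<Longrightarrow> val j = s"
proof (induction m arbitrary: s j p)
  case 0
  then show ?case using hit2_input[OF \<sigma>(1) 0(2) good_0[OF 0(1,2)], of s] by simp
next
  case (Suc m)
  let ?D = "nvalues d z" and ?B = "clauses d z m" and ?K = "wslots d z"
  show ?case
  proof (cases "inp z j")
    case True
    then have h: "hit0 d z (Suc m) s j p r i w \<longleftrightarrow> hit2 d z 0 s j i w" for r i w by simp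
    show ?thesis using hit2_input[OF \<sigma>(1) Suc.prems(2) True, of s] clauses_pos[of "Suc m"] Suc.prems(5) unfolding h by blast
  next
    case ninp: False
    define Q where "Q i' p' r' i \<longleftrightarrow> (if large z j then hit1 d z m s i' r' i (\<sigma> i)
      else if neg z j then hit0 d z m (\<not> s) i' p' r' i (\<sigma> i) else hit0 d z m s i' p' r' i (\<sigma> i))" for i' p' r' i
    have Q: "val i' = (if neg z j then \<not> s else s)"
      if "mem z j i'" "\<forall>r' < ?B. \<exists>i < ?K. Q i' p' r' i" "p' \<le> p + 1 + 4 ^ m" for i' p'
    proof (cases "large z j")
      case True
      then show ?thesis using hit1_iff[OF \<sigma>(1), of m i' s] good_mem[OF Suc.prems(1,2) that(1)] Suc.prems(3) that(2)
          neg_not_large[OF Suc.prems(2)] by (auto simp: Q_def)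
    next
      case False
      have "p' + 4 ^ m \<le> 4 ^ d"
      proof -
        have "0 < (4 :: nat) ^ m" by simp
        then show ?thesis using Suc.prems(4) that(3) unfolding power_Suc by linarith
      qed
      then show ?thesis using Suc.IH[of i' p'] good_mem[OF Suc.prems(1,2) that(1)] Suc.prems(3) that(2) False
        by (auto simp: Q_def)
    qed
    show ?thesis
    proof (cases "universal z s j")
      case True
      let ?p = "\<lambda>i'. p + 1 + (if not_first z j i' then 4 ^ m else 0)"
      have "hit0 d z (Suc m) s j p r i (\<sigma> i) \<longleftrightarrow> (mem z j (r mod ?D) \<longrightarrow> Q (r mod ?D) (?p (r mod ?D)) (r div ?D mod ?B) i)" for r i
        using ninp True by (simp add: Q_def)
      then have "\<forall>r < ?D * (?B * ?B). \<exists>i < ?K. mem z j (r mod ?D) \<longrightarrow> Q (r mod ?D) (?p (r mod ?D)) (r div ?D mod ?B) i"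
        using Suc.prems(5) by (simp only: clauses.simps)
      then have "\<forall>i' < ?D. \<forall>r' < ?B. \<exists>i < ?K. mem z j i' \<longrightarrow> Q i' (?p i') r' i"
        using all_less_mult_mod[OF clauses_pos[of m] clauses_pos[of m], where a = ?D and P = "\<lambda>i' r'. \<exists>i < ?K. mem z j i' \<longrightarrow> Q i' (?p i') r' i"] by blast
      then have a: "\<forall>r' < ?B. \<exists>i < ?K. Q i' (?p i') r' i" if "mem z j i'" for i'
        using mem_less(2)[OF that] that by blast
      have "val i' = (if neg z j then \<not> s else s)" if "mem z j i'" for i'
        by (rule Q[OF that a[OF that]]) simp
      then show ?thesis using True val_gate[OF Suc.prems(2) ninp, of s] by simp
    next
      case False
      then have nneg: "\<not> neg z j" by (simp add: universal_def)
      have "hit0 d z (Suc m) s j p r i (\<sigma> i) \<longleftrightarrow> i = p \<and> \<sigma> i \<noteq> r mod ?D \<or> mem z j (r mod ?D) \<and> Q (r mod ?D) (p + 1) (r div ?D mod ?B) i" for r i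
        using ninp False nneg by (simp add: Q_def)
      then have "\<forall>r < ?D * (?B * ?B). \<exists>i < ?K. i = p \<and> \<sigma> i \<noteq> r mod ?D \<or> mem z j (r mod ?D) \<and> Q (r mod ?D) (p + 1) (r div ?D mod ?B) i"
        using Suc.prems(5) by (simp only: clauses.simps)
      then have all: "\<forall>i' < ?D. \<forall>r' < ?B. \<exists>i < ?K. i = p \<and> \<sigma> i \<noteq> i' \<or> mem z j i' \<and> Q i' (p + 1) r' i"
        using all_less_mult_mod[OF clauses_pos[of m] clauses_pos[of m], where a = ?D and P = "\<lambda>i' r'. \<exists>i < ?K. i = p \<and> \<sigma> i \<noteq> i' \<or> mem z j i' \<and> Q i' (p + 1) r' i"] by blast
      have "p < ?K" using Suc.prems(4) one_le_power[of "4 :: nat" "Suc m"] tuples_pos by (simp add: wslots_def)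
      then have "\<sigma> p < ?D" by (rule \<sigma>(2))
      then have c: "mem z j (\<sigma> p) \<and> (\<exists>i < ?K. Q (\<sigma> p) (p + 1) r' i)" if "r' < ?B" for r' using all that by blast
      then have "mem z j (\<sigma> p)" using clauses_pos by blast
      moreover have "val (\<sigma> p) = (if neg z j then \<not> s else s)" using Q[OF calculation, of "p + 1"] c by simp
      ultimately show ?thesis using False val_gate[OF Suc.prems(2) ninp, of s] mem_less(1) by auto
    qed
  qed
qed

text \<open>Choices for a gate of depth \<open>m\<close> are confined to the block of
  \<open>4 ^ m\<close> slots from \<open>p\<close> on. One slot and two blocks for in-neighbours
  fit, as \<open>1 + 2 * 4 ^ m \<le> 4 ^ (m + 1)\<close>. Large gates may have many in-neighbours,
  but below them no choice slots are used. The formulation with arbitrary \<open>\<sigma>'\<close>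
  agreeing on the block allows choices for disjoint blocks to be merged.\<close>

lemma hit0_complete:
  assumes \<sigma>: "tuple_ok \<sigma>"
  shows "good m 2 j \<Longrightarrow> j < N \<Longrightarrow> m \<le> d \<Longrightarrow> p + 4 ^ m \<le> 4 ^ d \<Longrightarrow> val j = s \<Longrightarrow>
   \<exists>\<tau>. (\<forall>i. \<tau> i < nvalues d z) \<and> (\<forall>\<sigma>'. (\<forall>i \<ge> 4 ^ d. \<sigma>' i = \<sigma> i) \<longrightarrow> (\<forall>i. p \<le> i \<and> i < p + 4 ^ m \<longrightarrow> \<sigma>' i = \<tau> i) \<longrightarrow>
     (\<forall>r < clauses d z m. \<exists>i < wslots d z. hit0 d z m s j p r i (\<sigma>' i)))"
proof (induction m arbitrary: s j p)
  case 0
  have t: "tuple_ok \<sigma>'" if "\<forall>i \<ge> 4 ^ d. \<sigma>' i = \<sigma> i" for \<sigma>' using \<sigma> that by (simp add: tuple_ok_def)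
  show ?case
    by (intro exI[of _ "\<lambda>_. 0"]) (use hit2_input[OF t 0(2) good_0[OF 0(1,2)], of _ s] 0(5) nvalues_pos in simp)
next
  case (Suc m)
  let ?D = "nvalues d z" and ?B = "clauses d z m" and ?K = "wslots d z"
  have t: "tuple_ok \<sigma>'" if "\<forall>i \<ge> 4 ^ d. \<sigma>' i = \<sigma> i" for \<sigma>' using \<sigma> that by (simp add: tuple_ok_def)
  have four: "p + 1 + 2 * 4 ^ m \<le> p + 4 ^ Suc m" using one_le_power[of "4 :: nat" m] by simp
  show ?case
  proof (cases "inp z j")
    case True
    show ?thesis
      by (intro exI[of _ "\<lambda>_. 0"]) (use hit2_input[OF t Suc.prems(2) True, of _ s] Suc.prems(5) nvalues_pos True in simp)
  next
    case ninp: False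
    define Q where "Q \<sigma>' i' p' r' i \<longleftrightarrow> (if large z j then hit1 d z m s i' r' i (\<sigma>' i)
      else if neg z j then hit0 d z m (\<not> s) i' p' r' i (\<sigma>' i) else hit0 d z m s i' p' r' i (\<sigma>' i))" for \<sigma>' :: "nat \<Rightarrow> nat" and i' p' r' i
    have Q: "\<exists>\<tau>. (\<forall>i. \<tau> i < ?D) \<and> (\<forall>\<sigma>'. (\<forall>i \<ge> 4 ^ d. \<sigma>' i = \<sigma> i) \<longrightarrow>
        (\<not> large z j \<longrightarrow> (\<forall>i. p' \<le> i \<and> i < p' + 4 ^ m \<longrightarrow> \<sigma>' i = \<tau> i)) \<longrightarrow> (\<forall>r' < ?B. \<exists>i < ?K. Q \<sigma>' i' p' r' i))"
      if "mem z j i'" "val i' = (if neg z j then \<not> s else s)" "p' \<le> p + 1 + 4 ^ m" for i' p'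
    proof (cases "large z j")
      case True
      show ?thesis
      proof (intro exI[of _ "\<lambda>_. 0"] conjI allI impI)
        fix \<sigma>' r' assume a: "\<forall>i \<ge> 4 ^ d. \<sigma>' i = \<sigma> i" "r' < ?B"
        have "\<not> neg z j" using neg_not_large[OF Suc.prems(2)] True by blast
        then show "\<exists>i < ?K. Q \<sigma>' i' p' r' i"
          using hit1_iff[OF t[OF a(1)], of m i' s] good_mem[OF Suc.prems(1,2) that(1)] Suc.prems(3) that(2) a(2) True
          by (simp add: Q_def)
      qed (rule nvalues_pos)
    next
      case False
      have "p' + 4 ^ m \<le> 4 ^ d"
      proof -
        have "0 < (4 :: nat) ^ m" by simp
        then show ?thesis using Suc.prems(4) that(3) unfolding power_Suc by linarith
      qed
      then show ?thesis using Suc.IH[of i' p' "if neg z j then \<not> s else s"] good_mem[OF Suc.prems(1,2) that(1)] Suc.prems(3) that(2) False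
        unfolding Q_def by (cases "neg z j") simp_all
    qed
    show ?thesis
    proof (cases "universal z s j")
      case True
      let ?p = "\<lambda>i'. p + 1 + (if not_first z j i' then 4 ^ m else 0)"
      have ch: "val i' = (if neg z j then \<not> s else s)" if "mem z j i'" for i'
        using that True val_gate[OF Suc.prems(2) ninp, of s] Suc.prems(5) mem_less(1) by simp
      have "\<forall>i'. \<exists>\<tau>. mem z j i' \<longrightarrow> (\<forall>i. \<tau> i < ?D) \<and> (\<forall>\<sigma>'. (\<forall>i \<ge> 4 ^ d. \<sigma>' i = \<sigma> i) \<longrightarrow>
        (\<not> large z j \<longrightarrow> (\<forall>i. ?p i' \<le> i \<and> i < ?p i' + 4 ^ m \<longrightarrow> \<sigma>' i = \<tau> i)) \<longrightarrow> (\<forall>r' < ?B. \<exists>i < ?K. Q \<sigma>' i' (?p i') r' i))"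
      proof
        fix i'
        have "?p i' \<le> p + 1 + 4 ^ m" by simp
        then show "\<exists>\<tau>. mem z j i' \<longrightarrow> (\<forall>i. \<tau> i < ?D) \<and> (\<forall>\<sigma>'. (\<forall>i \<ge> 4 ^ d. \<sigma>' i = \<sigma> i) \<longrightarrow>
          (\<not> large z j \<longrightarrow> (\<forall>i. ?p i' \<le> i \<and> i < ?p i' + 4 ^ m \<longrightarrow> \<sigma>' i = \<tau> i)) \<longrightarrow> (\<forall>r' < ?B. \<exists>i < ?K. Q \<sigma>' i' (?p i') r' i))"
          using Q[of i' "?p i'"] ch[of i'] by blast
      qed
      then obtain T where T: "\<And>i'. mem z j i' \<Longrightarrow> (\<forall>i. T i' i < ?D) \<and> (\<forall>\<sigma>'. (\<forall>i \<ge> 4 ^ d. \<sigma>' i = \<sigma> i) \<longrightarrow>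
        (\<not> large z j \<longrightarrow> (\<forall>i. ?p i' \<le> i \<and> i < ?p i' + 4 ^ m \<longrightarrow> \<sigma>' i = T i' i)) \<longrightarrow> (\<forall>r' < ?B. \<exists>i < ?K. Q \<sigma>' i' (?p i') r' i))"
        by metis
      \<comment> \<open>Slot \<open>i\<close> lies in the half of the block that belongs to
        in-neighbour \<open>i'\<close>; for a small gate this determines \<open>i'\<close>.\<close>
      define P where "P i i' \<longleftrightarrow> mem z j i' \<and> not_first z j i' = (p + 1 + 4 ^ m \<le> i)" for i i'
      define \<tau> where "\<tau> i = (if \<exists>i'. P i i' then T (SOME i'. P i i') i else 0)" for i
      have \<tau>P: "\<tau> i = T i' i" if "P i i'" "\<not> large z j" for i i'
      proof -
        have "P i (SOME i'. P i i')" using that(1) by (rule someI)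
        then have "(SOME i'. P i i') = i'"
          using small_unique[OF Suc.prems(2) that(2), of "SOME i'. P i i'" i'] that(1) by (simp add: P_def)
        then show ?thesis using that(1) by (auto simp: \<tau>_def)
      qed
      show ?thesis
      proof (intro exI[of _ \<tau>] conjI allI impI)
        show "\<tau> i < ?D" for i
        proof (cases "\<exists>i'. P i i'")
          case True
          define i' where "i' = (SOME i'. P i i')"
          have "P i i'" unfolding i'_def using True by (rule someI_ex)
          then have "T i' i < ?D" using T[of i'] by (simp add: P_def)
          then show ?thesis using True unfolding \<tau>_def i'_def by (simp only: if_True)
        qed (simp add: \<tau>_def nvalues_pos)
        fix \<sigma>' r assume a: "\<forall>i \<ge> 4 ^ d. \<sigma>' i = \<sigma> i" "\<forall>i. p \<le> i \<and> i < p + 4 ^ Suc m \<longrightarrow> \<sigma>' i = \<tau> i" "r < clauses d z (Suc m)"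
        have h: "hit0 d z (Suc m) s j p r i (\<sigma>' i) \<longleftrightarrow> (mem z j (r mod ?D) \<longrightarrow> Q \<sigma>' (r mod ?D) (?p (r mod ?D)) (r div ?D mod ?B) i)" for i
          using ninp True by (simp add: Q_def)
        show "\<exists>i < ?K. hit0 d z (Suc m) s j p r i (\<sigma>' i)"
        proof (cases "mem z j (r mod ?D)")
          case m: True
          have "\<sigma>' i = T (r mod ?D) i" if "\<not> large z j" "?p (r mod ?D) \<le> i" "i < ?p (r mod ?D) + 4 ^ m" for i
          proof -
            have "P i (r mod ?D)" using m that by (auto simp: P_def split: if_splits)
            then have "\<tau> i = T (r mod ?D) i" using \<tau>P that(1) by blast
            moreover have "\<sigma>' i = \<tau> i" using a(2) that four by (auto split: if_splits)
            ultimately show ?thesis by simp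
          qed
          then have "\<forall>r' < ?B. \<exists>i < ?K. Q \<sigma>' (r mod ?D) (?p (r mod ?D)) r' i" using T[OF m] a(1) by blast
          moreover have "r div ?D mod ?B < ?B" using clauses_pos[of m] by simp
          ultimately show ?thesis unfolding h by blast
        qed (use h wslots_pos in auto)
      qed
    next
      case False
      then have nneg: "\<not> neg z j" by (simp add: universal_def)
      obtain c where c: "mem z j c" "val c = (if neg z j then \<not> s else s)"
        using False val_gate[OF Suc.prems(2) ninp, of s] Suc.prems(5) by auto
      obtain \<tau> where \<tau>: "\<And>i. \<tau> i < ?D" "\<And>\<sigma>'. (\<forall>i \<ge> 4 ^ d. \<sigma>' i = \<sigma> i) \<Longrightarrow>
        (\<not> large z j \<longrightarrow> (\<forall>i. p + 1 \<le> i \<and> i < p + 1 + 4 ^ m \<longrightarrow> \<sigma>' i = \<tau> i)) \<Longrightarrow> (\<forall>r' < ?B. \<exists>i < ?K. Q \<sigma>' c (p + 1) r' i)"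
        using Q[OF c, of "p + 1"] by auto
      show ?thesis
      proof (intro exI[of _ "\<tau>(p := c)"] conjI allI impI)
        show "(\<tau>(p := c)) i < ?D" for i using \<tau>(1) mem_less(2)[OF c(1)] by simp
        fix \<sigma>' r assume a: "\<forall>i \<ge> 4 ^ d. \<sigma>' i = \<sigma> i" "\<forall>i. p \<le> i \<and> i < p + 4 ^ Suc m \<longrightarrow> \<sigma>' i = (\<tau>(p := c)) i" "r < clauses d z (Suc m)"
        have h: "hit0 d z (Suc m) s j p r i (\<sigma>' i) \<longleftrightarrow> i = p \<and> \<sigma>' i \<noteq> r mod ?D \<or> mem z j (r mod ?D) \<and> Q \<sigma>' (r mod ?D) (p + 1) (r div ?D mod ?B) i" for i
          using ninp False nneg by (simp add: Q_def)
        have "\<sigma>' p = c" using a(2) one_le_power[of "4 :: nat" "Suc m"] by simp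
        have "p < ?K" using Suc.prems(4) one_le_power[of "4 :: nat" "Suc m"] tuples_pos by (simp add: wslots_def)
        show "\<exists>i < ?K. hit0 d z (Suc m) s j p r i (\<sigma>' i)"
        proof (cases "r mod ?D = c")
          case True
          have "\<forall>r' < ?B. \<exists>i < ?K. Q \<sigma>' c (p + 1) r' i" using a(1,2) four by (intro \<tau>(2)) auto
          moreover have "r div ?D mod ?B < ?B" using clauses_pos[of m] by simp
          ultimately show ?thesis unfolding h using True c(1) by blast
        next
          case False
          then show ?thesis unfolding h using \<open>p < ?K\<close> \<open>\<sigma>' p = c\<close> by auto
        qed
      qed
    qed
  qed
qed

end

lemma all_less_add: "(\<forall>r < a + b. Q r) \<longleftrightarrow> (\<forall>r < a. Q r) \<and> (\<forall>r < (b :: nat). Q (a + r))"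
proof (intro iffI conjI allI impI)
  fix r assume h: "(\<forall>r < a. Q r) \<and> (\<forall>r < b. Q (a + r))" "r < a + b"
  then show "Q r" by (cases "r < a") (auto dest!: spec[of _ "r - a"])
qed auto

section \<open>From values of the slots to weighted satisfying assignments and back\<close>

context weighted_circuit
begin

lemma constraints_split:
  assumes "\<And>i. i < wslots d z \<Longrightarrow> \<sigma> i < nvalues d z"
  shows "(\<forall>r < wconstraints d z. \<exists>i < wslots d z. wconstraint d z r i (\<sigma> i)) \<longleftrightarrow>
    (\<forall>r < clauses d z d. \<exists>i < wslots d z. hit0 d z d True (N - 1) 0 r i (\<sigma> i)) \<and>
    (\<forall>I < tuples d z. \<forall>J < tuples d z. compatible d z I (\<sigma> (4 ^ d + I)) J (\<sigma> (4 ^ d + J)))"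
proof -
  let ?K = "wslots d z" and ?P = "tuples d z" and ?D = "nvalues d z" and ?B = "clauses d z d"
  have "(\<exists>i < ?K. consistency d z I J A i (\<sigma> i)) \<longleftrightarrow> (\<sigma> (4 ^ d + I) = A \<longrightarrow> compatible d z I A J (\<sigma> (4 ^ d + J)))"
    if "I < ?P" "J < ?P" for I J A
  proof -
    have "4 ^ d + I < ?K" "4 ^ d + J < ?K" using that by (auto simp: wslots_def)
    then show ?thesis unfolding consistency_def by blast
  qed
  then have c: "(\<forall>A < ?D. \<exists>i < ?K. consistency d z I J A i (\<sigma> i)) \<longleftrightarrow> compatible d z I (\<sigma> (4 ^ d + I)) J (\<sigma> (4 ^ d + J))"
    if "I < ?P" "J < ?P" for I J
    using that assms[of "4 ^ d + I"] by (auto simp: wslots_def)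
  have 1: "(\<forall>r < ?B. \<exists>i < ?K. wconstraint d z r i (\<sigma> i)) \<longleftrightarrow> (\<forall>r < ?B. \<exists>i < ?K. hit0 d z d True (N - 1) 0 r i (\<sigma> i))"
    by (simp add: wconstraint_def)
  have "(\<forall>r < ?P * (?P * ?D). \<exists>i < ?K. wconstraint d z (?B + r) i (\<sigma> i)) \<longleftrightarrow>
    (\<forall>r < ?P * (?P * ?D). \<exists>i < ?K. consistency d z (r mod ?P) (r div ?P mod ?P) (r div ?P div ?P) i (\<sigma> i))"
    by (simp add: wconstraint_def)
  also have "\<dots> \<longleftrightarrow> (\<forall>I < ?P. \<forall>s < ?P * ?D. \<exists>i < ?K. consistency d z I (s mod ?P) (s div ?P) i (\<sigma> i))"
    by (rule all_less_mult)
  also have "\<dots> \<longleftrightarrow> (\<forall>I < ?P. \<forall>J < ?P. \<forall>A < ?D. \<exists>i < ?K. consistency d z I J A i (\<sigma> i))"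
    by (simp only: all_less_mult[of ?P ?D "\<lambda>J A. \<exists>i < ?K. consistency d z _ J A i (\<sigma> i)"])
  also have "\<dots> \<longleftrightarrow> (\<forall>I < ?P. \<forall>J < ?P. compatible d z I (\<sigma> (4 ^ d + I)) J (\<sigma> (4 ^ d + J)))"
    using c by auto
  finally show ?thesis unfolding wconstraints_def all_less_add 1 by simp
qed

lemma csp_imp_weighted_sat:
  assumes good: "good d 2 (N - 1)" and dom: "\<And>i. i < wslots d z \<Longrightarrow> \<sigma> i < nvalues d z"
    and hit: "\<forall>r < clauses d z d. \<exists>i < wslots d z. hit0 d z d True (N - 1) 0 r i (\<sigma> i)"
    and comp: "\<forall>I < tuples d z. \<forall>J < tuples d z. compatible d z I (\<sigma> (4 ^ d + I)) J (\<sigma> (4 ^ d + J))"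
  shows "weighted_sat C k"
proof -
  \<comment> \<open>Tuple number \<open>i \<le> k + 1\<close> has \<open>i\<close> as its lowest
    digit, so the first entry of its slot is the entry for rank \<open>i\<close>. Compatibility
    transfers it to the other slots.\<close>
  define t where "t i = digit (N + 2) (\<sigma> (4 ^ d + i)) 0" for i
  have tl: "0 < tuple_len d" by (simp add: tuple_len_def)
  have i0: "digit (k + 2) i 0 = i" if "i \<le> Suc k" for i using that by (simp add: digit_def)
  have ip: "i < tuples d z" if "i \<le> Suc k" for i using that k_le_tuples by simp
  have cmp: "(digit (k + 2) I l < digit (k + 2) J l' \<longleftrightarrow> digit (N + 2) (\<sigma> (4 ^ d + I)) l < digit (N + 2) (\<sigma> (4 ^ d + J)) l') \<and>
     (digit (k + 2) I l = 0 \<longrightarrow> digit (N + 2) (\<sigma> (4 ^ d + I)) l = 0) \<and>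
     (digit (k + 2) I l = k + 1 \<longrightarrow> digit (N + 2) (\<sigma> (4 ^ d + I)) l = N + 1) \<and>
     (0 < digit (k + 2) I l \<and> digit (k + 2) I l < k + 1 \<longrightarrow> 0 < digit (N + 2) (\<sigma> (4 ^ d + I)) l \<and>
        digit (N + 2) (\<sigma> (4 ^ d + I)) l < N + 1 \<and> inp z (digit (N + 2) (\<sigma> (4 ^ d + I)) l - 1))"
    if "I < tuples d z" "J < tuples d z" "l < tuple_len d" "l' < tuple_len d" for I J l l'
    using comp that unfolding compatible_def enc by blast
  have rank: "ranked_circuit C k t"
  proof (unfold_locales)
    show "t 0 = 0" using cmp[OF ip ip tl tl, of 0 0] i0[of 0] by (simp add: t_def)
    show "t (Suc k) = Suc N" using cmp[OF ip ip tl tl, of "Suc k" 0] i0[of "Suc k"] by (simp add: t_def)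
    show "t i < t i'" if "i < i'" "i' \<le> Suc k" for i i'
      using cmp[OF ip ip tl tl, of i i'] i0[of i] i0[of i'] that by (simp add: t_def)
    show "t i - 1 \<in> input_nodes C" if "0 < i" "i \<le> k" for i
    proof -
      have "0 < t i" "t i < N + 1" "inp z (t i - 1)"
        using cmp[OF ip ip tl tl, of i 0] i0[of i] that by (simp_all add: t_def)
      then show ?thesis using gate_enc(1)[OF wf, of "t i - 1" k] by (simp add: input_nodes_def)
    qed
  qed
  interpret ranked_circuit C k d t using rank .
  have "tuple_ok \<sigma>"
    unfolding tuple_ok_def
  proof (intro allI impI)
    fix I assume I: "I < tuples d z"
    have "digit (N + 2) (\<sigma> (4 ^ d + I)) l = t (digit (k + 2) I l)" if l: "l < tuple_len d" for l
    proof -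
      let ?i = "digit (k + 2) I l"
      have i: "?i \<le> Suc k" using digit_le[of I l] by simp
      show ?thesis using cmp[OF I ip[OF i] l tl] cmp[OF ip[OF i] I tl l] i0[OF i] by (simp add: t_def)
    qed
    then show "facts d z I (\<sigma> (4 ^ d + I)) = graph_of (digit (k + 2) I ` {..<tuple_len d})"
      by (force simp: facts_def graph_of_def)
  qed
  have N: "0 < N" using wf by (auto simp: circuit_wf_def)
  have "val (N - 1) = True"
    by (rule hit0_sound[OF \<open>tuple_ok \<sigma>\<close> dom good _ _ _ hit]) (use N in auto)
  moreover have "card {i \<in> input_nodes C. v i} = k"
  proof -
    have pos: "0 < t i" if "0 < i" "i \<le> k" for i using t_mono[of 0 i] that by simp
    have "{i \<in> input_nodes C. v i} = (\<lambda>i. t i - 1) ` {1..k}"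
    proof (intro equalityI subsetI)
      fix j assume "j \<in> {i \<in> input_nodes C. v i}"
      then obtain i where "0 < i" "i \<le> k" "t i = Suc j" by (auto simp: v_def)
      then show "j \<in> (\<lambda>i. t i - 1) ` {1..k}" by (intro image_eqI[of _ _ i]) auto
    next
      fix j assume "j \<in> (\<lambda>i. t i - 1) ` {1..k}"
      then obtain i where "i \<in> {1..k}" "j = t i - 1" by blast
      then have i: "0 < i" "i \<le> k" "j = t i - 1" by auto
      then show "j \<in> {i \<in> input_nodes C. v i}" using t_input[of i] pos[of i] by (auto simp: v_def)
    qed
    moreover have "inj_on (\<lambda>i. t i - 1) {1..k}"
    proof (rule inj_onI)
      fix i i' assume "i \<in> {1..k}" "i' \<in> {1..k}" "t i - 1 = t i' - 1"
      then have "t i = t i'" using pos[of i] pos[of i'] by simp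
      then show "i = i'" using t_less_iff[of i i'] t_less_iff[of i' i] \<open>i \<in> {1..k}\<close> \<open>i' \<in> {1..k}\<close> by simp
    qed
    ultimately show ?thesis by (simp add: card_image)
  qed
  ultimately show ?thesis unfolding weighted_sat_def by blast
qed

lemma weighted_sat_imp_csp:
  assumes good: "good d 2 (N - 1)" and sat: "weighted_sat C k"
  shows "\<exists>\<sigma>. (\<forall>i < wslots d z. \<sigma> i < nvalues d z) \<and>
    (\<forall>r < clauses d z d. \<exists>i < wslots d z. hit0 d z d True (N - 1) 0 r i (\<sigma> i)) \<and>
    (\<forall>I < tuples d z. \<forall>J < tuples d z. compatible d z I (\<sigma> (4 ^ d + I)) J (\<sigma> (4 ^ d + J)))"
proof -
  obtain v0 where v0: "card {i \<in> input_nodes C. v0 i} = k" "node_val C v0 (N - 1)"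
    using sat unfolding weighted_sat_def by blast
  define L where "L = sorted_list_of_set {i \<in> input_nodes C. v0 i}"
  have fin: "finite {i \<in> input_nodes C. v0 i}" by (simp add: input_nodes_def)
  have L: "length L = k" "set L = {i \<in> input_nodes C. v0 i}" "sorted_wrt (<) L"
    using fin v0(1) by (simp_all add: L_def)
  \<comment> \<open>The true inputs in increasing order, shifted by one so that 0 and
    \<open>N + 1\<close> are free as sentinels.\<close>
  define t where "t i = (if i = 0 then 0 else if i \<le> k then L ! (i - 1) + 1 else N + 1)" for i
  have LN: "L ! i < N" if "i < k" for i using nth_mem[of i L] that L by (auto simp: input_nodes_def)
  have rank: "ranked_circuit C k t"
  proof (unfold_locales)
    show "t 0 = 0" "t (Suc k) = Suc N" by (simp_all add: t_def)
    show "t i < t i'" if "i < i'" "i' \<le> Suc k" for i i'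
      using that LN[of "i - 1"] sorted_wrt_nth_less[OF L(3), of "i - 1" "i' - 1"] L(1) by (auto simp: t_def)
    show "t i - 1 \<in> input_nodes C" if "0 < i" "i \<le> k" for i
      using that nth_mem[of "i - 1" L] L by (auto simp: t_def)
  qed
  interpret ranked_circuit C k d t using rank .
  have vv: "v i = v0 i" if "i \<in> input_nodes C" for i
  proof
    assume "v i"
    then obtain i' where i': "0 < i'" "i' \<le> k" "t i' = Suc i" by (auto simp: v_def)
    then have "L ! (i' - 1) = i" by (simp add: t_def)
    then show "v0 i" using nth_mem[of "i' - 1" L] L i' by auto
  next
    assume "v0 i"
    then have "i \<in> set L" using that L by simp
    then obtain n where "n < k" "L ! n = i" using L(1) by (auto simp: in_set_conv_nth)
    then show "v i" unfolding v_def by (intro exI[of _ "Suc n"]) (simp add: t_def)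
  qed
  have N: "0 < N" using wf by (auto simp: circuit_wf_def)
  have "val (N - 1) = True" using node_val_cong[where j = "N - 1", OF vv] v0(2) N by simp
  have t_le: "t i < N + 2" if "i \<le> Suc k" for i
    using t_mono[of i "Suc k"] t_last that by (cases "i = Suc k") auto
  have "\<exists>A < nvalues d z. \<forall>l < tuple_len d. digit (N + 2) A l = t (digit (k + 2) I l)" for I
  proof -
    have "y < N + 2" if "y \<in> set (map (\<lambda>l. t (digit (k + 2) I l)) [0..<tuple_len d])" for y
      using that t_le digit_le[of I] by auto
    then show ?thesis
      using digits_exist[of "map (\<lambda>l. t (digit (k + 2) I l)) [0..<tuple_len d]" "tuple_len d" "N + 2"]
      by (auto simp: nvalues_def)
  qed
  then obtain A where A: "\<And>I. A I < nvalues d z" "\<And>I l. l < tuple_len d \<Longrightarrow> digit (N + 2) (A I) l = t (digit (k + 2) I l)"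
    by metis
  define \<sigma>0 where "\<sigma>0 i = A (i - 4 ^ d)" for i
  have "tuple_ok \<sigma>0"
    unfolding tuple_ok_def using A(2) by (auto simp: facts_def graph_of_def \<sigma>0_def image_iff)
  from hit0_complete[OF this good _ _ _ \<open>val (N - 1) = True\<close>, of 0] N
  obtain \<tau> where \<tau>: "\<And>i. \<tau> i < nvalues d z"
    "\<And>\<sigma>'. (\<forall>i \<ge> 4 ^ d. \<sigma>' i = \<sigma>0 i) \<Longrightarrow> (\<forall>i. i < 4 ^ d \<longrightarrow> \<sigma>' i = \<tau> i) \<Longrightarrow>
       \<forall>r < clauses d z d. \<exists>i < wslots d z. hit0 d z d True (N - 1) 0 r i (\<sigma>' i)"
    by auto
  define \<sigma> where "\<sigma> i = (if i < 4 ^ d then \<tau> i else \<sigma>0 i)" for i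
  have "\<forall>r < clauses d z d. \<exists>i < wslots d z. hit0 d z d True (N - 1) 0 r i (\<sigma> i)"
    by (rule \<tau>(2)) (auto simp: \<sigma>_def)
  moreover have "\<sigma> i < nvalues d z" for i using \<tau>(1) A(1) by (simp add: \<sigma>_def \<sigma>0_def)
  moreover have "compatible d z I (\<sigma> (4 ^ d + I)) J (\<sigma> (4 ^ d + J))" for I J
  proof -
    have s: "\<sigma> (4 ^ d + I) = A I" for I by (simp add: \<sigma>_def \<sigma>0_def)
    have in1: "0 < t i \<and> t i < N + 1 \<and> inp z (t i - 1)" if "0 < i" "i < k + 1" for i
      using t_mono[of 0 i] t_input[of i] that gate_enc(1)[OF wf, of "t i - 1" k] by (auto simp: input_nodes_def)
    show ?thesis unfolding compatible_def enc s
    proof (intro allI impI)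
      fix l l' assume l: "l < tuple_len d" "l' < tuple_len d"
      let ?i = "digit (k + 2) I l" and ?j = "digit (k + 2) J l'"
      have b: "?i \<le> Suc k" "?j \<le> Suc k" using digit_le[of I l] digit_le[of J l'] by auto
      have "t ?i < t ?j \<longleftrightarrow> ?i < ?j" by (rule t_less_iff[OF b])
      moreover have "?i = 0 \<longrightarrow> t ?i = 0" "?i = k + 1 \<longrightarrow> t ?i = N + 1" using t_0 t_last by auto
      moreover have "0 < ?i \<and> ?i < k + 1 \<longrightarrow> 0 < t ?i \<and> t ?i < N + 1 \<and> inp z (t ?i - 1)" using in1 by blast
      ultimately show "(?i < ?j \<longleftrightarrow> digit (N + 2) (A I) l < digit (N + 2) (A J) l') \<and> (?i = 0 \<longrightarrow> digit (N + 2) (A I) l = 0) \<and>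
        (?i = k + 1 \<longrightarrow> digit (N + 2) (A I) l = N + 1) \<and>
        (0 < ?i \<and> ?i < k + 1 \<longrightarrow> 0 < digit (N + 2) (A I) l \<and> digit (N + 2) (A I) l < N + 1 \<and> inp z (digit (N + 2) (A I) l - 1))"
        unfolding A(2)[OF l(1)] A(2)[OF l(2)] by blast
    qed
  qed
  ultimately show ?thesis by blast
qed

lemma csp_iff_weighted_sat:
  assumes "good d 2 (N - 1)"
  shows "csp_sat (wslots d z) (nvalues d z) (wconstraints d z) (wconstraint d z) \<longleftrightarrow> weighted_sat C k"
proof
  assume "csp_sat (wslots d z) (nvalues d z) (wconstraints d z) (wconstraint d z)"
  then obtain \<sigma> where \<sigma>: "\<And>i. i < wslots d z \<Longrightarrow> \<sigma> i < nvalues d z"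
    "\<forall>r < wconstraints d z. \<exists>i < wslots d z. wconstraint d z r i (\<sigma> i)"
    unfolding csp_sat_def by blast
  then have "(\<forall>r < clauses d z d. \<exists>i < wslots d z. hit0 d z d True (N - 1) 0 r i (\<sigma> i)) \<and>
    (\<forall>I < tuples d z. \<forall>J < tuples d z. compatible d z I (\<sigma> (4 ^ d + I)) J (\<sigma> (4 ^ d + J)))"
    using constraints_split[of \<sigma>] by blast
  then show "weighted_sat C k" using csp_imp_weighted_sat[OF assms, of \<sigma>] \<sigma>(1) by blast
next
  assume "weighted_sat C k"
  then obtain \<sigma> where \<sigma>: "\<And>i. i < wslots d z \<Longrightarrow> \<sigma> i < nvalues d z"
    "\<forall>r < clauses d z d. \<exists>i < wslots d z. hit0 d z d True (N - 1) 0 r i (\<sigma> i)"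
    "\<forall>I < tuples d z. \<forall>J < tuples d z. compatible d z I (\<sigma> (4 ^ d + I)) J (\<sigma> (4 ^ d + J))"
    using weighted_sat_imp_csp[OF assms] by blast
  then show "csp_sat (wslots d z) (nvalues d z) (wconstraints d z) (wconstraint d z)"
    unfolding csp_sat_def using constraints_split[of \<sigma>] by blast
qed

end

text \<open>A yes-instance only asserts that some circuit has this encoding; injectivity identifies
  it with the given one.\<close>

lemma csp_iff_WCS:
  assumes "y \<in> instances (WCS 2 d)"
  shows "y \<in> yes_instances (WCS 2 d) \<longleftrightarrow>
    csp_sat (wslots d (enc_par y)) (nvalues d (enc_par y)) (wconstraints d (enc_par y)) (wconstraint d (enc_par y))"
    and "weight (enc_par y) = snd y"
proof -
  obtain C k where C: "y = (enc_circuit C, k)" "circuit_wf C" "weft_at_most C 2" "depth_at_most C d"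
    using assms by (auto simp: WCS_def)
  interpret weighted_circuit C k d by unfold_locales (rule C(2))
  have "y \<in> yes_instances (WCS 2 d) \<longleftrightarrow> weighted_sat C k"
  proof
    assume "y \<in> yes_instances (WCS 2 d)"
    then obtain C' k' where "y = (enc_circuit C', k')" "circuit_wf C'" "weighted_sat C' k'" by (auto simp: WCS_def)
    then show "weighted_sat C k" using C enc_circuit_inject[of C C'] by auto
  next
    assume "weighted_sat C k"
    then show "y \<in> yes_instances (WCS 2 d)" using C by (auto simp: WCS_def)
  qed
  then show "y \<in> yes_instances (WCS 2 d) \<longleftrightarrow>
    csp_sat (wslots d (enc_par y)) (nvalues d (enc_par y)) (wconstraints d (enc_par y)) (wconstraint d (enc_par y))"
    using csp_iff_weighted_sat[OF good_output[OF C(4,3)]] C(1) by simp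
  show "weight (enc_par y) = snd y" using weight_enc[OF C(2)] C(1) by simp
qed

section \<open>Hardness\<close>

lemma generated_machine:
  assumes "generated f"
  obtains M c where "tm_wf M" "\<And>x. computes_within M x (f x) ((length x + 2) ^ c)"
proof -
  obtain bs where "\<forall>x. f x = blocks_output bs x" using assms unfolding generated_def by blast
  then show ?thesis using blocks_machine[of bs] that by metis
qed

lemma generated_polytime:
  assumes "generated f" shows "polytime f"
proof -
  obtain M c where M: "tm_wf M" "\<And>x. computes_within M x (f x) ((length x + 2) ^ c)"
    using generated_machine[OF assms] by blast
  then have "computes_within M x (f x) (poly ([:2, 1:] ^ c) (length x))" for x
    by (simp add: poly_power add.commute)
  then show ?thesis unfolding polytime_def using M(1) by blast
qed

lemma CRI_iff:
  assumes "cri_valid I" "target I \<in> R"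
  shows "enc_cri I \<in> instances (CRI R)" "enc_cri I \<in> yes_instances (CRI R) \<longleftrightarrow> cri_yes I"
    "(enc_cri I, budget I) \<in> instances (CRI_par R)" "(enc_cri I, budget I) \<in> yes_instances (CRI_par R) \<longleftrightarrow> cri_yes I"
  using assms enc_cri_inject[of I] by (auto simp: CRI_def CRI_par_def)

text \<open>All produced instances have target 1, so hardness holds for every set of targets that
  contains 1.\<close>

lemma NP_hard_CRI:
  assumes "1 \<in> R" shows "NP_hard (CRI R)"
  unfolding NP_hard_def
proof
  fix L assume "L \<in> class_NP"
  then obtain K D P C where d: "definable (\<lambda>x e. K x)" "definable (\<lambda>x e. D x)" "definable (\<lambda>x e. P x)"
    "\<And>f g h. definable f \<Longrightarrow> definable g \<Longrightarrow> definable h \<Longrightarrow> definable_pred (\<lambda>x e. C x (f x e) (g x e) (h x e))"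
    and L: "\<And>x. x \<in> L \<longleftrightarrow> csp_sat (K x) (D x) (P x) (C x)"
    using NP_csp[of L] by blast
  define I where "I x = csp_graph.cri (K x) (D x) (P x) (C x)" for x
  have "polytime (\<lambda>x. enc_cri (I x))" unfolding I_def by (intro generated_polytime generated_cri d)
  moreover have "cri_valid (I x)" "target (I x) \<in> R" "cri_yes (I x) \<longleftrightarrow> x \<in> L" for x
    using assms by (simp_all add: I_def csp_graph.cri_valid csp_graph.cri_yes L) (simp add: csp_graph.cri_def)
  ultimately show "poly_reducible L (CRI R)" unfolding poly_reducible_def using CRI_iff(1,2) by blast
qed

text \<open>Gives the new bounds on running time and parameter, which are polynomials of the old
  ones.\<close>

lemma computable_comp:
  assumes "computable g" "generated (\<lambda>x. replicate (f (length x)) True)"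
  shows "computable (\<lambda>n. f (g n))"
proof -
  obtain M1 where M1: "tm_wf M1" "\<And>n. \<exists>t. computes_within M1 (replicate n True) (replicate (g n) True) t"
    using assms(1) unfolding computable_def by blast
  obtain M2 c where M2: "tm_wf M2" "\<And>x. computes_within M2 x (replicate (f (length x)) True) ((length x + 2) ^ c)"
    using generated_machine[OF assms(2)] by blast
  obtain M where M: "tm_wf M" "\<And>x y z t1 t2. computes_within M1 x y t1 \<Longrightarrow> computes_within M2 y z t2 \<Longrightarrow>
       computes_within M x z (2 * t1 + t2 + 2)"
    using compose_machines[OF M1(1) M2(1)] by blast
  have "\<exists>t. computes_within M (replicate n True) (replicate (f (g n)) True) t" for n
    using M1(2)[of n] M2(2)[of "replicate (g n) True"] M(2) by fastforce
  then show ?thesis unfolding computable_def using M(1) by blast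
qed

text \<open>The given reduction to weighted circuits is followed by the translation to a graph. The
  budget is the number of slots, and this depends only on the fixed depth and on the weight.\<close>

lemma W2_hard_CRI:
  assumes "1 \<in> R" shows "W_hard 2 (CRI_par R)"
  unfolding W_hard_def
proof
  fix A assume "A \<in> class_W 2"
  then obtain d where "fpt_reducible A (WCS 2 d)" unfolding class_W_def by blast
  then obtain f M1 g h c where M1: "tm_wf M1" and g: "computable g" and h: "computable h"
    and red: "\<And>x k. computes_within M1 (enc_par (x, k)) (enc_par (f (x, k))) (g k * length (enc_par (x, k)) ^ c)"
      "\<And>x k. snd (f (x, k)) \<le> h k" "\<And>x k. f (x, k) \<in> instances (WCS 2 d)"
      "\<And>x k. (x, k) \<in> A \<longleftrightarrow> f (x, k) \<in> yes_instances (WCS 2 d)"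
    unfolding fpt_reducible_def by blast
  define I where "I z = csp_graph.cri (wslots d z) (nvalues d z) (wconstraints d z) (wconstraint d z)" for z
  have I: "cri_valid (I z)" "target (I z) \<in> R" "budget (I z) = wslots d z"
    "cri_yes (I z) \<longleftrightarrow> csp_sat (wslots d z) (nvalues d z) (wconstraints d z) (wconstraint d z)" for z
    using assms by (simp_all add: I_def csp_graph.cri_valid csp_graph.cri_yes) (simp_all add: csp_graph.cri_def)
  define F where "F z = enc_par (enc_cri (I z), wslots d z)" for z
  have "generated (\<lambda>z. replicate (wslots d z) True @ [False] @ enc_cri (I z))"
    unfolding I_def
    by (intro generated_append generated_replicate generated_const generated_cri definable_wparams definable_nvalues definable_wconstraint)
  then have "generated F" by (simp add: F_def[abs_def])
  then obtain M2 b where M2: "tm_wf M2" "\<And>z. computes_within M2 z (F z) ((length z + 2) ^ b)"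
    using generated_machine by blast
  obtain M where M: "tm_wf M" "\<And>x y z t1 t2. computes_within M1 x y t1 \<Longrightarrow> computes_within M2 y z t2 \<Longrightarrow>
       computes_within M x z (2 * t1 + t2 + 2)"
    using compose_machines[OF M1 M2(1)] by blast
  have "polyb (\<lambda>u. (u + 2) ^ b)" unfolding polyb_def by blast
  then have "polyb (\<lambda>u. 2 * u + (u + 2) ^ b + 2)" by (intro polyb_intros)
  then obtain a where a: "\<And>u :: nat. 2 * u + (u + 2) ^ b + 2 \<le> (u + 2) ^ a" unfolding polyb_def by blast
  define f' where "f' xk = (enc_cri (I (enc_par (f xk))), wslots d (enc_par (f xk)))" for xk
  have time: "computes_within M (enc_par (x, k)) (enc_par (f' (x, k))) ((g k + 2) ^ a * length (enc_par (x, k)) ^ (c * a))" for x k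
  proof -
    define n where "n = length (enc_par (x, k))"
    define T where "T = g k * n ^ c"
    define z where "z = enc_par (f (x, k))"
    have 1: "computes_within M1 (enc_par (x, k)) z T" using red(1)[of x k] by (simp only: T_def n_def z_def)
    have "length z \<le> T" by (rule length_output_le[OF M1 1])
    \<comment> \<open>The separating bit makes \<open>n\<close> positive, so constants can be
      absorbed into \<open>g k\<close>. A power of the product then splits into a function of
      \<open>k\<close> times a power of \<open>n\<close>.\<close>
    have "(1 :: nat) \<le> n ^ c" by (rule one_le_power) (simp add: n_def)
    then have "T + 2 \<le> (g k + 2) * n ^ c" by (simp add: T_def algebra_simps)
    have "2 * T + (length z + 2) ^ b + 2 \<le> 2 * T + (T + 2) ^ b + 2"
      using \<open>length z \<le> T\<close> by (simp add: power_mono)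
    also have "\<dots> \<le> (T + 2) ^ a" by (rule a)
    also have "\<dots> \<le> ((g k + 2) * n ^ c) ^ a" by (rule power_mono[OF \<open>T + 2 \<le> _\<close>]) simp
    also have "\<dots> = (g k + 2) ^ a * n ^ (c * a)" by (simp only: power_mult_distrib power_mult)
    finally have t: "2 * T + (length z + 2) ^ b + 2 \<le> (g k + 2) ^ a * n ^ (c * a)" .
    have "computes_within M (enc_par (x, k)) (F z) (2 * T + (length z + 2) ^ b + 2)" by (rule M(2)[OF 1 M2(2)])
    from computes_within_mono[OF this t] show ?thesis by (simp only: F_def f'_def z_def n_def)
  qed
  have r1: "computable (\<lambda>k. (g k + 2) ^ a)"
    by (rule computable_comp[OF g, of "\<lambda>m. (m + 2) ^ a"]) (intro generated_replicate definable_power definable_intros)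
  have r2: "computable (\<lambda>k. 4 ^ d + (h k + 2) ^ tuple_len d)"
    by (rule computable_comp[OF h, of "\<lambda>m. 4 ^ d + (m + 2) ^ tuple_len d"])
      (intro generated_replicate definable_add definable_power definable_intros)
  have r3: "snd (f' (x, k)) \<le> 4 ^ d + (h k + 2) ^ tuple_len d" for x k
    using csp_iff_WCS(2)[OF red(3)[of x k]] red(2)[of x k]
    by (simp add: f'_def wslots_def tuples_def power_mono)
  have r4: "f' (x, k) \<in> instances (CRI_par R)" for x k
    using CRI_iff(3)[OF I(1,2), of "enc_par (f (x, k))"] by (simp add: f'_def I(3))
  have r5: "(x, k) \<in> A \<longleftrightarrow> f' (x, k) \<in> yes_instances (CRI_par R)" for x k
    using CRI_iff(4)[OF I(1,2), of "enc_par (f (x, k))"] csp_iff_WCS(1)[OF red(3)[of x k]] red(4)[of x k]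
    by (simp add: f'_def I(3,4))
  show "fpt_reducible A (CRI_par R)"
    unfolding fpt_reducible_def
    by (rule exI[of _ f'], rule exI[of _ M], rule exI[of _ "\<lambda>k. (g k + 2) ^ a"],
        rule exI[of _ "\<lambda>k. 4 ^ d + (h k + 2) ^ tuple_len d"], rule exI[of _ "c * a"],
        intro conjI allI M(1) r1 r2 time r3 r4 r5)
qed

theorem theorem1:
  shows "NP_hard (CRI {0<..1}) \<and> W_hard 2 (CRI_par {0<..1}) \<and>
         NP_hard (CRI {1}) \<and> W_hard 2 (CRI_par {1})"
  by (intro conjI NP_hard_CRI W2_hard_CRI) auto

end
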